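(* Let $k\in\mathbb N$, let $\boldsymbol\alpha=(\alpha_{ij\ell})\in\mathbb R^{k\times k\times k}$ be symmetric under permutations of its indices and $\mathbf h=(h_{ij})\in\mathbb R^{k\times k}$ be symmetric. Let $\widetilde g^{\star}\in\widetilde{\mathcal W}^{(k)}_{\mathcal B}$ be a maximizer of the functional $\widetilde g\mapsto U^{(\mathcal B)}_{\boldsymbol\alpha,\mathbf h}(\widetilde g)-\frac12\mathcal I^{(\mathcal B)}(\widetilde g)$ over $\widetilde{\mathcal W}^{(k)}_{\mathcal B}$. Then for any representative $(g,\mathcal B^{(k)})$ of $\widetilde g^{\star}$ the following holds. 1. There exists $\delta>0$ such that $\delta\le g(x,y)\le1-\delta$ for a.e. $(x,y)\in[0,1]^2$. 2. For a.e. $(x,y)\in[0,1]^2$, $$g(x,y)=\frac{\exp\bigl(h_{\mathcal B}(x,y)+(\mathcal T^{(\mathcal B)}_{\boldsymbol\alpha}g)(x,y)\bigr)}{1+\exp\bigl(h_{\mathcal B}(x,y)+(\mathcal T^{(\mathcal B)}_{\boldsymbol\alpha}g)(x,y)\bigr)},$$ where $$(\mathcal T^{(\mathcal B)}_{\boldsymbol\alpha}g)(x,y)=\int_0^1\Delta_{\boldsymbol\alpha;\mathcal B}(x,y,z)\,g(x,z)\,g(y,z)\,dz,\qquad \Delta_{\boldsymbol\alpha;\mathcal B}(x,y,z)=\sum_{i,j,\ell=1}^k\alpha_{ij\ell}\mathbf 1_{\mathcal B_i}(x)\mathbf 1_{\mathcal B_j}(y)\mathbf 1_{\mathcal B_\ell}(z),$$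 and $h_{\mathcal B}(x,y)=\sum_{i,j=1}^kh_{ij}\mathbf 1_{\mathcal B_i}(x)\mathbf 1_{\mathcal B_j}(y)$.
   Context: Fix $k\in\mathbb N$ and $b_1,\dots,b_k>0$ with $\sum_i b_i=1$. $\mathcal B^{(k)}=(\mathcal B_1,\dots,\mathcal B_k)$ is the partition of $[0,1]$ into consecutive intervals with Lebesgue measure $\lambda(\mathcal B_i)=b_i$. Colored graphons. $\mathcal W$ is the set of measurable symmetric functions $g:[0,1]^2\to[0,1]$ (graphons), and $\mathcal W^{(k)}_{\mathcal B}=\mathcal W\times\{\mathcal B^{(k)}\}$. Set $$d^{(k)}_\square\bigl((g_1,\mathcal B^{(k)}),(g_2,\mathcal B^{(k)})\bigr)=\sup_{C,D\subseteq[0,1]}\sum_{i,j\in[k]}\Bigl|\int_{C\times D}\mathbf 1_{\mathcal B_i\times\mathcal B_j}(x,y)(g_1-g_2)(x,y)\,dx\,dy\Bigr|$$ (sup over measurable sets). $\Sigma_{\mathcal B}$ is the set of measure-preserving maps $\sigma:[0,1]\to[0,1]$ with $\lambda(\sigma^{-1}(\mathcal B_i)\triangle\mathcal B_i)=0$ for all $i\in[k]$; $g^\sigma(x,y)=g(\sigma(x),\sigma(y))$. Set $\delta^{(k)}_\square(g_1,g_2)=\inf_{\sigma\in\Sigma_{\mathcal B}}d^{(k)}_\square((g_1,\mathcal B^{(k)}),(g_2^\sigma,\mathcal B^{(k)}))$. $\widetilde{\mathcal W}^{(k)}_{\mathcal B}$ is the quotient of $\mathcal W^{(k)}_{\mathcal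 B}$ obtained by identifying colored graphons at $\delta^{(k)}_\square$-distance $0$ (in particular $(g,\mathcal B^{(k)})$ and $(g^\sigma,\mathcal B^{(k)})$ are identified for $\sigma\in\Sigma_{\mathcal B}$), with metric $\delta^{(k)}_\square$. Functionals. For a finite simple graph $H$ on $[m]$ with edge set $\mathcal E(H)$ and $\boldsymbol\ell\in[k]^m$, $t^{(\mathcal B)}_{\boldsymbol\ell}(H,g)=\int_{\mathcal B_{\ell_1}\times\cdots\times\mathcal B_{\ell_m}}\prod_{\{i,j\}\in\mathcal E(H)}g(x_i,x_j)\,dx_1\cdots dx_m$. $H_1$ is a single edge, $H_2$ a triangle. With $I(u)=u\ln u+(1-u)\ln(1-u)$, $I(0)=I(1)=0$, and $g$ the first component of any representative of $\widetilde g$, $$\mathcal I^{(\mathcal B)}(\widetilde g)=\sum_{i,j\in[k]}\int_{\mathcal B_i\times\mathcal B_j}I(g(x,y))\,dx\,dy,$$ $$U^{(\mathcal B)}_{\boldsymbol\alpha,\mathbf h}(\widetilde g)=\frac16\sum_{i,j,\ell\in[k]}\alpha_{ij\ell}\,t^{(\mathcal B)}_{ij\ell}(H_2,g)+\frac12\sum_{i,j\in[k]}h_{ij}\,t^{(\mathcal B)}_{ij}(H_1,g);$$ these do not depend on the representative. *)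

theory Defs
  imports "HOL-Analysis.Analysis"
begin

(* Colours are 0,...,k-1. A family B of sets indexed by the colours partitions the unit
   interval into consecutive intervals of lengths b 0,...,b (k-1); which of two neighbouring
   intervals owns their common endpoint is left open. *)
definition interval_partition :: "nat \<Rightarrow> (nat \<Rightarrow> real) \<Rightarrow> (nat \<Rightarrow> real set) \<Rightarrow> bool" where
  "interval_partition k b B \<longleftrightarrow>
     (\<forall>i<k. is_interval (B i) \<and> measure lebesgue (B i) = b i) \<and>
     disjoint_family_on B {..<k} \<and> (\<Union>i<k. B i) = {0..1} \<and>
     (\<forall>i j. i < j \<and> j < k \<longrightarrow> (\<forall>x\<in>B i. \<forall>y\<in>B j. x < y))"

(* Graphons are functions on the unit square. Values outside the square are
   unconstrained, and nothing below depends on them. *)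
type_synonym graphon = "real \<Rightarrow> real \<Rightarrow> real"

definition graphons :: "graphon set" where
  "graphons = {g.
     (\<lambda>(x, y). g x y) \<in> borel_measurable (lebesgue_on ({0..1} \<times> {0..1})) \<and>
     (\<forall>x\<in>{0..1}. \<forall>y\<in>{0..1}. g x y = g y x \<and> 0 \<le> g x y \<and> g x y \<le> 1)}"

type_synonym colored_graphon = "graphon \<times> (nat \<Rightarrow> real set)"

definition colored_graphons :: "(nat \<Rightarrow> real set) \<Rightarrow> colored_graphon set" where
  "colored_graphons B = graphons \<times> {B}"

(* The colored cut distance of (g1, B) and (g2, B). *)
definition cut_dist :: "nat \<Rightarrow> (nat \<Rightarrow> real set) \<Rightarrow> graphon \<Rightarrow> graphon \<Rightarrow> real" where
  "cut_dist k B g1 g2 =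
     (SUP (C, D) \<in> {(C, D). C \<in> sets lebesgue \<and> D \<in> sets lebesgue \<and> C \<subseteq> {0..1} \<and> D \<subseteq> {0..1}}.
        \<Sum>i<k. \<Sum>j<k.
          \<bar>LINT (x, y):C \<times> D|lebesgue. indicator (B i \<times> B j) (x, y) * (g1 x y - g2 x y)\<bar>)"

(* Measure-preserving maps of the unit interval, not necessarily invertible, that
   preserve every colour class up to a null set. *)
definition color_preserving_maps :: "nat \<Rightarrow> (nat \<Rightarrow> real set) \<Rightarrow> (real \<Rightarrow> real) set" where
  "color_preserving_maps k B = {\<sigma>.
     \<sigma> \<in> measurable (lebesgue_on {0..1}) (lebesgue_on {0..1}) \<and>
     distr (lebesgue_on {0..1}) (lebesgue_on {0..1}) \<sigma> = lebesgue_on {0..1} \<and>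
     (\<forall>i<k. emeasure lebesgue (sym_diff (\<sigma> -` B i \<inter> {0..1}) (B i)) = 0)}"

definition graphon_pullback :: "graphon \<Rightarrow> (real \<Rightarrow> real) \<Rightarrow> graphon" where
  "graphon_pullback g \<sigma> = (\<lambda>x y. g (\<sigma> x) (\<sigma> y))"

definition cut_metric :: "nat \<Rightarrow> (nat \<Rightarrow> real set) \<Rightarrow> graphon \<Rightarrow> graphon \<Rightarrow> real" where
  "cut_metric k B g1 g2 =
     (INF \<sigma> \<in> color_preserving_maps k B. cut_dist k B g1 (graphon_pullback g2 \<sigma>))"

definition cut_equiv ::
    "nat \<Rightarrow> (nat \<Rightarrow> real set) \<Rightarrow> (colored_graphon \<times> colored_graphon) set" where
  "cut_equiv k B = {(p, q). p \<in> colored_graphons B \<and> q \<in> colored_graphons B \<and>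
                            cut_metric k B (fst p) (fst q) = 0}"

definition reduced_graphons :: "nat \<Rightarrow> (nat \<Rightarrow> real set) \<Rightarrow> colored_graphon set set" where
  "reduced_graphons k B = colored_graphons B // cut_equiv k B"

(* Density of the graph with vertices 0,...,m-1 and edge set E (a set of two-element sets),
   vertex v carrying colour ls ! v. As g is only Lebesgue measurable, the product Borel
   measure has to be completed for the integrand to be measurable. *)
definition colored_density ::
    "nat \<Rightarrow> nat set set \<Rightarrow> (nat \<Rightarrow> real set) \<Rightarrow> nat list \<Rightarrow> graphon \<Rightarrow> real" where
  "colored_density m E B ls g =
     (LINT x:(\<Pi>\<^sub>E v\<in>{..<m}. B (ls ! v))|completion (\<Pi>\<^sub>M v\<in>{..<m}. lborel).
        \<Prod>e\<in>E. g (x (Min e)) (x (Max e)))"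

definition edge_density :: "(nat \<Rightarrow> real set) \<Rightarrow> nat \<Rightarrow> nat \<Rightarrow> graphon \<Rightarrow> real" where
  "edge_density B i j g = colored_density 2 {{0, 1}} B [i, j] g"

definition triangle_density :: "(nat \<Rightarrow> real set) \<Rightarrow> nat \<Rightarrow> nat \<Rightarrow> nat \<Rightarrow> graphon \<Rightarrow> real" where
  "triangle_density B i j l g = colored_density 3 {{0, 1}, {0, 2}, {1, 2}} B [i, j, l] g"

definition I_fun :: "real \<Rightarrow> real" where
  "I_fun u = (if u = 0 \<or> u = 1 then 0 else u * ln u + (1 - u) * ln (1 - u))"

definition entropy_functional :: "nat \<Rightarrow> (nat \<Rightarrow> real set) \<Rightarrow> graphon \<Rightarrow> real" where
  "entropy_functional k B g =
     (\<Sum>i<k. \<Sum>j<k. LINT (x, y):B i \<times> B j|lebesgue. I_fun (g x y))"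

definition energy_functional ::
    "nat \<Rightarrow> (nat \<Rightarrow> real set) \<Rightarrow> (nat \<Rightarrow> nat \<Rightarrow> nat \<Rightarrow> real) \<Rightarrow> (nat \<Rightarrow> nat \<Rightarrow> real) \<Rightarrow> graphon \<Rightarrow> real" where
  "energy_functional k B \<alpha> h g =
     1/6 * (\<Sum>i<k. \<Sum>j<k. \<Sum>l<k. \<alpha> i j l * triangle_density B i j l g) +
     1/2 * (\<Sum>i<k. \<Sum>j<k. h i j * edge_density B i j g)"

(* The functionals on the quotient are evaluated at the first component of a chosen
   representative; their values do not depend on the choice. *)
definition class_rep :: "colored_graphon set \<Rightarrow> graphon" where
  "class_rep G = fst (SOME p. p \<in> G)"

definition quotient_entropy :: "nat \<Rightarrow> (nat \<Rightarrow> real set) \<Rightarrow> colored_graphon set \<Rightarrow> real" where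
  "quotient_entropy k B G = entropy_functional k B (class_rep G)"

definition quotient_energy ::
    "nat \<Rightarrow> (nat \<Rightarrow> real set) \<Rightarrow> (nat \<Rightarrow> nat \<Rightarrow> nat \<Rightarrow> real) \<Rightarrow> (nat \<Rightarrow> nat \<Rightarrow> real) \<Rightarrow>
     colored_graphon set \<Rightarrow> real" where
  "quotient_energy k B \<alpha> h G = energy_functional k B \<alpha> h (class_rep G)"

(* Invariance under the two adjacent transpositions, which generate all permutations of
   the three indices. *)
definition symmetric_tensor :: "nat \<Rightarrow> (nat \<Rightarrow> nat \<Rightarrow> nat \<Rightarrow> real) \<Rightarrow> bool" where
  "symmetric_tensor k \<alpha> \<longleftrightarrow>
     (\<forall>i<k. \<forall>j<k. \<forall>l<k. \<alpha> i j l = \<alpha> j i l \<and> \<alpha> i j l = \<alpha> i l j)"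

definition \<Delta>_step ::
    "nat \<Rightarrow> (nat \<Rightarrow> real set) \<Rightarrow> (nat \<Rightarrow> nat \<Rightarrow> nat \<Rightarrow> real) \<Rightarrow> real \<Rightarrow> real \<Rightarrow> real \<Rightarrow> real" where
  "\<Delta>_step k B \<alpha> x y z =
     (\<Sum>i<k. \<Sum>j<k. \<Sum>l<k.
        \<alpha> i j l * indicator (B i) x * indicator (B j) y * indicator (B l) z)"

definition h_step :: "nat \<Rightarrow> (nat \<Rightarrow> real set) \<Rightarrow> (nat \<Rightarrow> nat \<Rightarrow> real) \<Rightarrow> real \<Rightarrow> real \<Rightarrow> real" where
  "h_step k B h x y = (\<Sum>i<k. \<Sum>j<k. h i j * indicator (B i) x * indicator (B j) y)"

definition T_op ::
    "nat \<Rightarrow> (nat \<Rightarrow> real set) \<Rightarrow> (nat \<Rightarrow> nat \<Rightarrow> nat \<Rightarrow> real) \<Rightarrow> graphon \<Rightarrow> real \<Rightarrow> real \<Rightarrow> real" where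
  "T_op k B \<alpha> g x y = (LINT z:{0..1}|lebesgue. \<Delta>_step k B \<alpha> x y z * g x z * g y z)"

end

theory Submission
  imports Defs "HOL-Probability.Probability_Measure" "HOL-Real_Asymp.Real_Asymp"
begin

text \<open>
  The value \<open>U - I/2\<close> does not depend on the representative, although the maps defining
  \<open>\<delta>\<^sub>\<box>\<close> need not be invertible: \<open>U\<close> is continuous in the cut norm by the counting
  lemma, and the entropy is a supremum of the functionals
  \<open>g \<mapsto> \<integral> g f - \<integral> ln (1 + exp f)\<close>, which behave well under cut-norm convergence of pullbacks. Hence any
  representative \<open>g\<close> maximizes \<open>U - I/2\<close> over all graphons.

  Let \<open>f = h + T g\<close> and let \<open>s = exp f / (1 + exp f)\<close>, the pointwise maximizer of
  \<open>u f - I(u)\<close>. Moving from \<open>g\<close> to \<open>g + t (s - g)\<close> changes \<open>U\<close> by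
  \<open>t/2 \<integral> f (s - g) + O(t\<^sup>2)\<close>, while by convexity the entropy grows at most by the factor \<open>t\<close> times
  its increment from \<open>g\<close> to \<open>s\<close>. So maximality forces the integral of the Legendre gap
  \<open>I(g) - g f + ln (1 + exp f) \<ge> 0\<close> to vanish, which means \<open>g = s\<close> almost everywhere. This avoids
  differentiating \<open>I\<close> at the boundary, and the bounds on \<open>g\<close> follow because \<open>f\<close> is bounded.
\<close>

section \<open>Legendre duality for the binary entropy\<close>

text \<open>The entropy is only lower semicontinuous in the cut norm, so a single passage to the
  limit would compare the entropies of two representatives in one direction only; this is why two
  kinds of test functions occur.

  Graphons and the maps between them are merely Lebesgue measurable and are controlled only on the
  unit square, which is awkward for Fubini arguments. The analysis is therefore carried out for
  Borel kernels that are symmetric and take values in [0,1] everywhere, on an abstract probability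
  space. A separate layer replaces a graphon and a colour-preserving map by such versions and
  evaluates all the functionals on them.

  The factors 1/6 and 1/2 in the energy fit together: by symmetry the three first-order terms of the
  cubic part coincide, and 3/6 = 1/2 is the weight of both the edge term and the entropy. Hence the
  first variation is half of a single linear functional with density \<open>f\<close>, and
  \<open>f\<close> can be paired with the entropy through Legendre duality.\<close>

definition logistic :: "real \<Rightarrow> real" where
  "logistic f = exp f / (1 + exp f)"

lemma logistic_bounds: "0 < logistic f" "logistic f < 1"
  by (simp_all add: logistic_def add_pos_pos)

lemma one_minus_logistic: "1 - logistic f = 1 / (1 + exp f)"
  using add_pos_pos[OF zero_less_one exp_gt_zero[of f]] by (simp add: logistic_def field_simps)

lemma logistic_uminus: "logistic (- f) = 1 - logistic f"
proof -
  have "0 < 1 + exp f" by (simp add: add_pos_pos)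
  then show ?thesis unfolding one_minus_logistic by (simp add: logistic_def exp_minus field_simps)
qed

lemma logistic_measurable[measurable]: "logistic \<in> borel_measurable borel"
  unfolding logistic_def by measurable

lemma logistic_mono: "a \<le> b \<Longrightarrow> logistic a \<le> logistic b"
proof -
  assume "a \<le> b"
  then have "1 / (1 + exp b) \<le> 1 / (1 + exp a)"
    by (intro divide_left_mono) (auto simp: add_pos_pos)
  then show ?thesis
    using one_minus_logistic[of a] one_minus_logistic[of b] by linarith
qed

lemma logistic_logit: "0 < u \<Longrightarrow> u < 1 \<Longrightarrow> logistic (ln (u / (1 - u))) = u"
  by (simp add: logistic_def field_simps)

lemma ln_logistic: "ln (logistic f) = f - ln (1 + exp f)"
  and ln_one_minus_logistic: "ln (1 - logistic f) = - ln (1 + exp f)"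
  using add_pos_pos[OF zero_less_one exp_gt_zero[of f]]
  by (simp add: logistic_def ln_div, simp add: one_minus_logistic ln_div)

lemma I_fun_logistic: "I_fun (logistic f) = logistic f * f - ln (1 + exp f)"
  using logistic_bounds[of f]
  by (simp add: I_fun_def ln_logistic ln_one_minus_logistic) (simp add: algebra_simps)

text \<open>The difference of the two sides is the relative entropy of the Bernoulli law with
  parameter \<open>u\<close> with respect to the one with parameter \<open>logistic f\<close>. Its
  nonnegativity and its equality case are those of \<open>ln x \<le> x - 1\<close>.\<close>

lemma I_fun_Legendre:
  assumes "0 \<le> u" "u \<le> 1"
  shows I_fun_ge: "u * f - ln (1 + exp f) \<le> I_fun u"
    and I_fun_eq_imp: "I_fun u = u * f - ln (1 + exp f) \<Longrightarrow> u = logistic f"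
proof -
  let ?s = "logistic f"
  \<comment> \<open>These strict bounds settle u = 0 and u = 1: the inequality is strict there, so
    the equality clause is vacuous.\<close>
  have L: "0 < ln (1 + exp f)" "f < ln (1 + exp f)"
    using ln_less_cancel_iff[of "exp f" "1 + exp f"] by (auto simp: add_pos_pos)
  have "u * f - ln (1 + exp f) \<le> I_fun u \<and> (I_fun u = u * f - ln (1 + exp f) \<longrightarrow> u = ?s)"
  proof (cases "u = 0 \<or> u = 1")
    case True
    then show ?thesis using L by (auto simp: I_fun_def)
  next
    case False
    then have u: "0 < u" "u < 1" using assms by auto
    note s = logistic_bounds[of f]
    have 1: "ln (?s / u) \<le> ?s / u - 1" "ln ((1 - ?s) / (1 - u)) \<le> (1 - ?s) / (1 - u) - 1"
      using u s by (auto intro!: ln_le_minus_one)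
    have 2: "u * ln (?s / u) \<le> ?s - u"
      using mult_left_mono[OF 1(1), of u] u by (simp add: right_diff_distrib)
    have 3: "(1 - u) * ln ((1 - ?s) / (1 - u)) \<le> u - ?s"
    proof -
      have "(1 - u) * ((1 - ?s) / (1 - u) - 1) = u - ?s" using u by (simp add: field_simps)
      then show ?thesis using mult_left_mono[OF 1(2), of "1 - u"] u by simp
    qed
    have 4: "u * f - ln (1 + exp f) - I_fun u =
        u * ln (?s / u) + (1 - u) * ln ((1 - ?s) / (1 - u))"
      using u s by (simp add: I_fun_def ln_div ln_logistic ln_one_minus_logistic) (simp add: algebra_simps)
    have "u = ?s" if "u * f - ln (1 + exp f) - I_fun u = 0"
    proof -
      have "u * ln (?s / u) = ?s - u" using 2 3 4 that by linarith
      then have "u * ln (?s / u) = u * (?s / u - 1)" using u by (simp add: right_diff_distrib)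
      then have "ln (?s / u) = ?s / u - 1" using u by (metis mult_left_cancel less_irrefl)
      then have "?s / u = 1" using u s by (intro ln_eq_minus_one) auto
      then show ?thesis using u by simp
    qed
    then show ?thesis using 2 3 4 by auto
  qed
  then show "u * f - ln (1 + exp f) \<le> I_fun u"
    and "I_fun u = u * f - ln (1 + exp f) \<Longrightarrow> u = logistic f" by auto
qed

lemma I_fun_nonpos: "0 \<le> u \<Longrightarrow> u \<le> 1 \<Longrightarrow> I_fun u \<le> 0"
  by (auto simp: I_fun_def intro!: add_nonpos_nonpos mult_nonneg_nonpos)

lemma I_fun_abs_le:
  assumes "0 \<le> u" "u \<le> 1"
  shows "\<bar>I_fun u\<bar> \<le> 1"
proof -
  have "ln 2 \<le> (1 :: real)" using ln_le_minus_one[of 2] by simp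
  then show ?thesis
    using I_fun_ge[OF assms, of 0] I_fun_nonpos[OF assms] by simp
qed

lemma I_fun_measurable[measurable]: "I_fun \<in> borel_measurable borel"
  unfolding I_fun_def by measurable

text \<open>The intermediate point lies strictly inside (0,1) even if \<open>u\<close> is 0 or 1, so
  it equals \<open>logistic f'\<close> for some \<open>f'\<close>. The affine function with slope
  \<open>f'\<close> touches \<open>I_fun\<close> at that point and stays below it at both endpoints,
  which gives convexity without derivatives.\<close>

lemma I_fun_convex_logistic:
  assumes "0 \<le> u" "u \<le> 1" "0 < t" "t < 1"
  shows "I_fun (u + t * (logistic f - u)) \<le> I_fun u + t * (I_fun (logistic f) - I_fun u)"
proof -
  let ?s = "logistic f" and ?v = "u + t * (logistic f - u)"
  have v: "?v = (1 - t) * u + t * ?s" by (simp add: algebra_simps)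
  have "0 < ?v" unfolding v using assms logistic_bounds[of f] by (intro add_nonneg_pos) auto
  moreover have "?v < 1"
  proof -
    have "?v < (1 - t) * 1 + t * 1"
      unfolding v using assms logistic_bounds[of f]
      by (intro add_le_less_mono mult_left_mono mult_strict_left_mono) auto
    then show ?thesis by simp
  qed
  ultimately obtain f' where f': "?v = logistic f'"
    using logistic_logit[of ?v] by metis
  have "I_fun ?v = ?v * f' - ln (1 + exp f')"
    unfolding f' by (rule I_fun_logistic)
  also have "\<dots> = (1 - t) * (u * f' - ln (1 + exp f')) + t * (?s * f' - ln (1 + exp f'))"
    unfolding v by (simp add: algebra_simps)
  also have "\<dots> \<le> (1 - t) * I_fun u + t * I_fun ?s"
    using assms logistic_bounds[of f] by (intro add_mono mult_left_mono I_fun_ge) auto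
  finally show ?thesis by (simp add: algebra_simps)
qed

lemma ln_one_plus_exp_bounds: "0 \<le> ln (1 + exp (f :: real))" "ln (1 + exp f) \<le> 1 + \<bar>f\<bar>"
proof -
  show "0 \<le> ln (1 + exp f)" by simp
  have "1 + exp f \<le> 2 * exp \<bar>f\<bar>"
    using one_le_exp_iff[of "\<bar>f\<bar>"] exp_le_cancel_iff[of f "\<bar>f\<bar>"] by linarith
  then have "ln (1 + exp f) \<le> ln (2 * exp \<bar>f\<bar>)" by (subst ln_le_cancel_iff) (auto simp: add_pos_pos)
  also have "\<dots> = ln 2 + \<bar>f\<bar>" by (simp add: ln_mult)
  also have "\<dots> \<le> 1 + \<bar>f\<bar>" using ln_le_minus_one[of 2] by simp
  finally show "ln (1 + exp f) \<le> 1 + \<bar>f\<bar>" .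
qed

text \<open>Replacing \<open>u\<close> by its truncation to \<open>[d, 1 - d]\<close> makes the optimal dual variable
  bounded and loses at most \<open>-I(d)\<close>.\<close>

lemma I_fun_truncated_dual:
  assumes "0 \<le> u" "u \<le> 1" "0 < d" "d < 1/2"
  defines "v \<equiv> max d (min u (1 - d))"
  defines "f \<equiv> ln (v / (1 - v))"
  shows "I_fun u + I_fun d \<le> u * f - ln (1 + exp f)"
proof -
  have v: "0 < v" "v < 1" using assms by auto
  have lf: "logistic f = v" unfolding f_def by (rule logistic_logit[OF v])
  \<comment> \<open>The correction \<open>(u - v) * f\<close> is never negative: truncation from
    below happens where \<open>f \<le> 0\<close>, truncation from above where
    \<open>f \<ge> 0\<close>. What remains is \<open>I_fun v\<close>, which is
    \<open>I_fun u\<close> without truncation and \<open>I_fun d\<close> otherwise; the missing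
    summand is nonpositive.\<close>
  have eq: "u * f - ln (1 + exp f) = I_fun v + (u - v) * f"
    using I_fun_logistic[of f] unfolding lf by (simp add: algebra_simps)
  have d0: "I_fun d \<le> 0" "I_fun u \<le> 0" using assms by (auto intro!: I_fun_nonpos)
  have dd: "I_fun (1 - d) = I_fun d" using assms by (auto simp: I_fun_def)
  consider "u < d" | "d \<le> u" "u \<le> 1 - d" | "1 - d < u" by linarith
  then show ?thesis
  proof cases
    case 1
    then have "v = d" using assms by auto
    moreover have "f \<le> 0" unfolding f_def \<open>v = d\<close> using assms by (subst ln_le_zero_iff) auto
    ultimately show ?thesis using 1 eq d0 mult_nonpos_nonpos[of "u - v" f] by simp
  next
    case 2
    then have "v = u" using assms by auto
    then show ?thesis using eq d0 by simp
  next
    case 3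
    then have v': "v = 1 - d" using assms by auto
    moreover have "f \<ge> 0" unfolding f_def v' using assms by (subst ln_ge_zero_iff) auto
    ultimately have "0 \<le> (u - v) * f" using 3 by (intro mult_nonneg_nonneg) auto
    moreover have "I_fun v = I_fun d" using v' dd by simp
    ultimately show ?thesis using eq d0 by linarith
  qed
qed

text \<open>The shift by 3 keeps the truncation level strictly below 1/2 for every \<open>n\<close>,
  as \<open>I_fun_truncated_dual\<close> demands.\<close>

lemma I_fun_tendsto_0: "((\<lambda>n. I_fun (1 / (real n + 3))) \<longlongrightarrow> 0) sequentially"
proof -
  have "((\<lambda>n. 1 / (real n + 3) * ln (1 / (real n + 3)) +
     (1 - 1 / (real n + 3)) * ln (1 - 1 / (real n + 3))) \<longlongrightarrow> 0) sequentially"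
    by real_asymp
  moreover have "I_fun (1 / (real n + 3)) = 1 / (real n + 3) * ln (1 / (real n + 3)) +
     (1 - 1 / (real n + 3)) * ln (1 - 1 / (real n + 3))" for n
    by (auto simp: I_fun_def)
  ultimately show ?thesis by simp
qed

section \<open>Cut norm and subgraph densities on a probability space\<close>

lemma (in prob_space) integrable_bounded:
  fixes f :: "'a \<Rightarrow> real"
  assumes "f \<in> borel_measurable M" "\<And>x. \<bar>f x\<bar> \<le> c"
  shows "integrable M f"
  using assms by (intro integrable_const_bound[of _ c]) auto

text \<open>A nonintegrable function has integral 0, so the estimate covers it too and can be
  applied to arbitrary sections.\<close>

lemma (in prob_space) abs_integral_bounded:
  fixes f :: "'a \<Rightarrow> real"
  assumes "\<And>x. \<bar>f x\<bar> \<le> c"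
  shows "\<bar>\<integral>x. f x \<partial>M\<bar> \<le> c"
proof -
  have "0 \<le> c" using assms[of undefined] by linarith
  have "norm (\<integral>x. f x \<partial>M) \<le> (\<integral>x. norm (f x) \<partial>M)" by (rule integral_norm_bound)
  also have "\<dots> \<le> (\<integral>x. c \<partial>M)" using assms \<open>0 \<le> c\<close> by (intro integral_mono') auto
  finally show ?thesis by (simp add: prob_space)
qed

lemma abs_mult_le_one: "\<bar>a\<bar> \<le> (1 :: real) \<Longrightarrow> \<bar>b\<bar> \<le> 1 \<Longrightarrow> \<bar>a * b\<bar> \<le> 1"
  by (simp add: abs_mult mult_le_one)

lemma abs_mult_le: "\<bar>a\<bar> \<le> (c :: real) \<Longrightarrow> \<bar>b\<bar> \<le> 1 \<Longrightarrow> \<bar>a * b\<bar> \<le> c"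
  using mult_mono[of "\<bar>a\<bar>" c "\<bar>b\<bar>" 1] by (simp add: abs_mult)

text \<open>Everything up to the fixed-point equation uses only that the vertex space is a
  probability space. With uncompleted products, Fubini and \<open>measurable\<close> apply
  directly.\<close>

locale graphon_space = prob_space M for M :: "'a measure"
begin

abbreviation M2 :: "('a \<times> 'a) measure" where "M2 \<equiv> M \<Otimes>\<^sub>M M"
abbreviation M3 :: "('a \<times> 'a \<times> 'a) measure" where "M3 \<equiv> M \<Otimes>\<^sub>M M2"

sublocale P2: pair_prob_space M M ..
sublocale P3: pair_prob_space M M2 ..

lemma integral_M3_iterated:
  fixes F :: "'a \<times> 'a \<times> 'a \<Rightarrow> real"
  assumes F[measurable]: "F \<in> borel_measurable M3" and bd: "\<And>w. \<bar>F w\<bar> \<le> c"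
  shows "(\<integral>w. F w \<partial>M3) = (\<integral>x. \<integral>y. \<integral>z. F (x, y, z) \<partial>M \<partial>M \<partial>M)"
proof -
  have "(\<integral>w. F w \<partial>M3) = (\<integral>x. \<integral>v. F (x, v) \<partial>M2 \<partial>M)"
    by (rule P3.integral_fst'[symmetric]) (auto intro!: P3.integrable_bounded bd)
  also have "\<dots> = (\<integral>x. \<integral>y. \<integral>z. F (x, y, z) \<partial>M \<partial>M \<partial>M)"
  proof (rule Bochner_Integration.integral_cong[OF refl])
    fix x assume [measurable]: "x \<in> space M"
    show "(\<integral>v. F (x, v) \<partial>M2) = (\<integral>y. \<integral>z. F (x, y, z) \<partial>M \<partial>M)"
      by (rule P2.integral_fst'[symmetric]) (auto intro!: P2.integrable_bounded bd)
  qed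
  finally show ?thesis .
qed

text \<open>Together with the exchange of the first two variables this moves any edge of the
  triangle into any position.\<close>

lemma integral_M3_swap_23:
  fixes F :: "'a \<times> 'a \<times> 'a \<Rightarrow> real"
  assumes F[measurable]: "F \<in> borel_measurable M3" and bd: "\<And>w. \<bar>F w\<bar> \<le> c"
  shows "(\<integral>(x, y, z). F (x, z, y) \<partial>M3) = (\<integral>w. F w \<partial>M3)"
proof -
  have "(\<integral>(x, y, z). F (x, z, y) \<partial>M3) = (\<integral>x. \<integral>y. \<integral>z. F (x, z, y) \<partial>M \<partial>M \<partial>M)"
    by (subst integral_M3_iterated[where c=c]) (auto intro!: bd)
  also have "\<dots> = (\<integral>x. \<integral>y. \<integral>z. F (x, y, z) \<partial>M \<partial>M \<partial>M)"
  proof (rule Bochner_Integration.integral_cong[OF refl])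
    fix x assume [measurable]: "x \<in> space M"
    show "(\<integral>y. \<integral>z. F (x, z, y) \<partial>M \<partial>M) = (\<integral>y. \<integral>z. F (x, y, z) \<partial>M \<partial>M)"
      by (rule P2.Fubini_integral) (auto intro!: P2.integrable_bounded bd)
  qed
  also have "\<dots> = (\<integral>w. F w \<partial>M3)" by (rule integral_M3_iterated[symmetric]) (auto intro!: bd)
  finally show ?thesis .
qed

lemma integral_M3_swap_12:
  fixes F :: "'a \<times> 'a \<times> 'a \<Rightarrow> real"
  assumes F[measurable]: "F \<in> borel_measurable M3" and bd: "\<And>w. \<bar>F w\<bar> \<le> c"
  shows "(\<integral>(x, y, z). F (y, x, z) \<partial>M3) = (\<integral>w. F w \<partial>M3)"
proof -
  have "(\<integral>(x, y, z). F (y, x, z) \<partial>M3) = (\<integral>x. \<integral>y. \<integral>z. F (y, x, z) \<partial>M \<partial>M \<partial>M)"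
    by (subst integral_M3_iterated[where c=c]) (auto intro!: bd)
  also have "\<dots> = (\<integral>x. \<integral>y. \<integral>z. F (x, y, z) \<partial>M \<partial>M \<partial>M)"
    by (rule P2.Fubini_integral[where f="\<lambda>y x. \<integral>z. F (y, x, z) \<partial>M"])
      (auto intro!: P2.integrable_bounded abs_integral_bounded bd)
  also have "\<dots> = (\<integral>w. F w \<partial>M3)" by (rule integral_M3_iterated[symmetric]) (auto intro!: bd)
  finally show ?thesis .
qed

text \<open>Integrating out the second coordinate leaves a linear functional of \<open>a\<close>
  with density \<open>H\<close>, which is largest when \<open>a\<close> is the indicator of the set
  where \<open>H\<close> is positive.\<close>

lemma optimal_indicator:
  fixes D :: "'a \<times> 'a \<Rightarrow> real"
  assumes D[measurable]: "D \<in> borel_measurable M2" and bd: "\<And>w. \<bar>D w\<bar> \<le> c"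
    and a[measurable]: "a \<in> borel_measurable M" and a01: "\<And>x. 0 \<le> a x \<and> a x \<le> (1 :: real)"
  shows "\<exists>A\<in>sets M. (\<integral>w. D w * a (fst w) \<partial>M2) \<le> (\<integral>w. D w * indicator A (fst w) \<partial>M2)"
proof -
  define H where "H x = (\<integral>y. D (x, y) \<partial>M)" for x
  have [measurable]: "H \<in> borel_measurable M" unfolding H_def by measurable
  have Hbd: "\<bar>H x\<bar> \<le> c" for x unfolding H_def by (intro abs_integral_bounded bd)
  define A where "A = {x\<in>space M. H x > 0}"
  have [measurable]: "A \<in> sets M" unfolding A_def by measurable
  have eq: "(\<integral>w. D w * u (fst w) \<partial>M2) = (\<integral>x. H x * u x \<partial>M)"
    if [measurable]: "u \<in> borel_measurable M" and u: "\<And>x. 0 \<le> u x \<and> u x \<le> 1" for u :: "'a \<Rightarrow> real"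
  proof -
    have "(\<integral>w. D w * u (fst w) \<partial>M2) = (\<integral>x. \<integral>y. D (x, y) * u x \<partial>M \<partial>M)"
      using u by (subst P2.integral_fst'[symmetric])
        (auto intro!: P2.integrable_bounded[where c=c] abs_mult_le bd)
    then show ?thesis unfolding H_def by simp
  qed
  have "(\<integral>x. H x * a x \<partial>M) \<le> (\<integral>x. H x * indicator A x \<partial>M)"
  proof (rule integral_mono)
    fix x assume "x \<in> space M"
    then show "H x * a x \<le> H x * indicator A x"
      using a01[of x] by (auto simp: A_def indicator_def mult_left_le mult_nonpos_nonneg)
  qed (use a01 in \<open>auto intro!: integrable_bounded[where c=c] abs_mult_le Hbd\<close>)
  then show ?thesis using eq[of a] eq[of "indicator A"] a01 by (intro bexI[of _ A]) auto
qed

text \<open>A bilinear form in two [0,1]-valued functions is largest at indicators: \<open>a\<close>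
  is replaced first with \<open>b\<close> kept fixed, then \<open>b\<close>. Applying this to
  \<open>D\<close> and to \<open>- D\<close> bounds the absolute value.\<close>

lemma cut_bound_functions:
  fixes D :: "'a \<times> 'a \<Rightarrow> real"
  assumes D[measurable]: "D \<in> borel_measurable M2" and bd: "\<And>w. \<bar>D w\<bar> \<le> c"
    and cut: "\<And>A B. A \<in> sets M \<Longrightarrow> B \<in> sets M \<Longrightarrow> \<bar>\<integral>w. D w * indicator (A \<times> B) w \<partial>M2\<bar> \<le> e"
    and a[measurable]: "a \<in> borel_measurable M" and a01: "\<And>x. 0 \<le> a x \<and> a x \<le> (1 :: real)"
    and b[measurable]: "b \<in> borel_measurable M" and b01: "\<And>x. 0 \<le> b x \<and> b x \<le> (1 :: real)"
  shows "\<bar>\<integral>w. D w * a (fst w) * b (snd w) \<partial>M2\<bar> \<le> e"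
proof -
  have upper: "(\<integral>w. D w * a (fst w) * b (snd w) \<partial>M2) \<le> e"
    if [measurable]: "D \<in> borel_measurable M2" and bd: "\<And>w. \<bar>D w\<bar> \<le> c"
      and cut: "\<And>A B. A \<in> sets M \<Longrightarrow> B \<in> sets M \<Longrightarrow> \<bar>\<integral>w. D w * indicator (A \<times> B) w \<partial>M2\<bar> \<le> e"
    for D :: "'a \<times> 'a \<Rightarrow> real"
  proof -
    obtain A where A[measurable]: "A \<in> sets M" and
      1: "(\<integral>w. (D w * b (snd w)) * a (fst w) \<partial>M2) \<le> (\<integral>w. (D w * b (snd w)) * indicator A (fst w) \<partial>M2)"
      using optimal_indicator[of "\<lambda>w. D w * b (snd w)" c a] a01 b01 by (auto simp: abs_mult_le bd)
    \<comment> \<open>The coordinates are exchanged because \<open>optimal_indicator\<close> acts on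
      a factor in the first one.\<close>
    have "(\<integral>w. (D w * b (snd w)) * indicator A (fst w) \<partial>M2)
      = (\<integral>(x, y). (D (y, x) * b x) * indicator A y \<partial>M2)"
      using P2.integral_product_swap[of "\<lambda>w. (D w * b (snd w)) * indicator A (fst w)"] by simp
    also have "\<dots> = (\<integral>w. (D (snd w, fst w) * indicator A (snd w)) * b (fst w) \<partial>M2)"
      by (intro Bochner_Integration.integral_cong) auto
    finally have 2: "(\<integral>w. (D w * b (snd w)) * indicator A (fst w) \<partial>M2) = \<dots>" .
    obtain B where B[measurable]: "B \<in> sets M" and
      3: "(\<integral>w. (D (snd w, fst w) * indicator A (snd w)) * b (fst w) \<partial>M2) \<le>
       (\<integral>w. (D (snd w, fst w) * indicator A (snd w)) * indicator B (fst w) \<partial>M2)"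
      using optimal_indicator[of "\<lambda>w. D (snd w, fst w) * indicator A (snd w)" c b] b01
      by (auto simp: abs_mult_le bd)
    have "(\<integral>w. (D (snd w, fst w) * indicator A (snd w)) * indicator B (fst w) \<partial>M2) =
      (\<integral>(x, y). D (y, x) * indicator (A \<times> B) (y, x) \<partial>M2)"
      by (intro Bochner_Integration.integral_cong) (auto simp: indicator_def)
    also have "\<dots> = (\<integral>w. D w * indicator (A \<times> B) w \<partial>M2)"
      using P2.integral_product_swap[of "\<lambda>w. D w * indicator (A \<times> B) w"] by simp
    also have "\<dots> \<le> e" using cut[OF A B] by linarith
    finally show ?thesis using 1 2 3 by (simp add: mult_ac)
  qed
  have "(\<integral>w. - D w * a (fst w) * b (snd w) \<partial>M2) \<le> e"
    using bd cut by (intro upper) auto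
  moreover have "(\<integral>w. D w * a (fst w) * b (snd w) \<partial>M2) \<le> e"
    using bd cut by (intro upper) auto
  ultimately show ?thesis by simp
qed

text \<open>With the vertex opposite to the edge of \<open>D\<close> held fixed, the other two edge
  factors become functions of one endpoint of that edge each, so the bilinear bound applies;
  integrating over the fixed vertex preserves it. The second and third forms are permutations of the
  first.\<close>

lemma triangle_cut_bound:
  fixes D :: "'a \<times> 'a \<Rightarrow> real"
  assumes D[measurable]: "D \<in> borel_measurable M2" and bd: "\<And>w. \<bar>D w\<bar> \<le> c"
    and cut: "\<And>A B. A \<in> sets M \<Longrightarrow> B \<in> sets M \<Longrightarrow> \<bar>\<integral>w. D w * indicator (A \<times> B) w \<partial>M2\<bar> \<le> e"
    and a[measurable]: "a \<in> borel_measurable M2" and a01: "\<And>x. 0 \<le> a x \<and> a x \<le> (1 :: real)"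
    and b[measurable]: "b \<in> borel_measurable M2" and b01: "\<And>x. 0 \<le> b x \<and> b x \<le> (1 :: real)"
  shows "\<bar>\<integral>(x, y, z). D (y, z) * a (x, y) * b (x, z) \<partial>M3\<bar> \<le> e"
    and "\<bar>\<integral>(x, y, z). D (x, z) * a (x, y) * b (y, z) \<partial>M3\<bar> \<le> e"
    and "\<bar>\<integral>(x, y, z). D (x, y) * a (x, z) * b (y, z) \<partial>M3\<bar> \<le> e"
proof -
  have *: "\<bar>\<integral>(x, y, z). D (y, z) * a (x, y) * b (x, z) \<partial>M3\<bar> \<le> e"
    if [measurable]: "a \<in> borel_measurable M2" "b \<in> borel_measurable M2"
      and a01: "\<And>x. 0 \<le> a x \<and> a x \<le> 1" and b01: "\<And>x. 0 \<le> b x \<and> b x \<le> 1"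
    for a b :: "'a \<times> 'a \<Rightarrow> real"
  proof -
    have "(\<integral>(x, y, z). D (y, z) * a (x, y) * b (x, z) \<partial>M3) =
      (\<integral>x. \<integral>w. D w * a (x, fst w) * b (x, snd w) \<partial>M2 \<partial>M)"
      using a01 b01 by (subst P3.integral_fst'[symmetric])
        (auto intro!: P3.integrable_bounded[where c=c] abs_mult_le bd simp: case_prod_unfold)
    \<comment> \<open>\<open>abs_integral_bounded\<close> asks for a bound at every
      \<open>x\<close>, whereas the sections of \<open>a\<close> and \<open>b\<close> are known to
      be measurable only for \<open>x\<close> in the space; the indicator removes all other
      points.\<close>
    also have "\<dots> = (\<integral>x. indicator (space M) x * (\<integral>w. D w * a (x, fst w) * b (x, snd w) \<partial>M2) \<partial>M)"
      by (intro Bochner_Integration.integral_cong) auto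
    also have "\<bar>\<dots>\<bar> \<le> e"
    proof (rule abs_integral_bounded)
      fix x
      have "0 \<le> e" using cut[of "{}" "{}"] by simp
      moreover have "\<bar>\<integral>w. D w * a (x, fst w) * b (x, snd w) \<partial>M2\<bar> \<le> e" if [measurable]: "x \<in> space M"
        using a01 b01 by (intro cut_bound_functions[OF D bd cut]) auto
      ultimately show "\<bar>indicator (space M) x * (\<integral>w. D w * a (x, fst w) * b (x, snd w) \<partial>M2)\<bar> \<le> e"
        by (auto simp: indicator_def)
    qed
    finally show ?thesis .
  qed
  show 1: "\<bar>\<integral>(x, y, z). D (y, z) * a (x, y) * b (x, z) \<partial>M3\<bar> \<le> e"
    using a01 b01 by (intro *) auto
  have 2: "\<bar>\<integral>(x, y, z). D (x, z) * a (x, y) * b (y, z) \<partial>M3\<bar> \<le> e"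
    if [measurable]: "a \<in> borel_measurable M2" "b \<in> borel_measurable M2"
      and a01: "\<And>x. 0 \<le> a x \<and> a x \<le> 1" and b01: "\<And>x. 0 \<le> b x \<and> b x \<le> 1"
    for a b :: "'a \<times> 'a \<Rightarrow> real"
  proof -
    have "(\<integral>(x, y, z). D (x, z) * a (x, y) * b (y, z) \<partial>M3) =
      (\<integral>(x, y, z). D (y, z) * a (y, x) * b (x, z) \<partial>M3)"
      using integral_M3_swap_12[of "\<lambda>(x, y, z). D (x, z) * a (x, y) * b (y, z)" c, symmetric] a01 b01
      by (simp add: abs_mult_le bd case_prod_unfold)
    then show ?thesis using *[of "\<lambda>w. a (snd w, fst w)" b] a01 b01 by simp
  qed
  show "\<bar>\<integral>(x, y, z). D (x, z) * a (x, y) * b (y, z) \<partial>M3\<bar> \<le> e"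
    using a01 b01 by (intro 2) auto
  have "(\<integral>(x, y, z). D (x, y) * a (x, z) * b (y, z) \<partial>M3) =
      (\<integral>(x, y, z). D (x, z) * a (x, y) * b (z, y) \<partial>M3)"
    using integral_M3_swap_23[of "\<lambda>(x, y, z). D (x, y) * a (x, z) * b (y, z)" c, symmetric] a01 b01
    by (simp add: abs_mult_le bd case_prod_unfold)
  then show "\<bar>\<integral>(x, y, z). D (x, y) * a (x, z) * b (y, z) \<partial>M3\<bar> \<le> e"
    using 2[of a "\<lambda>w. b (snd w, fst w)"] a01 b01 by simp
qed

section \<open>Kernels, densities and the counting lemmas\<close>

definition measure_preserving :: "('a \<Rightarrow> 'a) \<Rightarrow> bool" where
  "measure_preserving \<sigma> \<longleftrightarrow> \<sigma> \<in> measurable M M \<and> distr M M \<sigma> = M"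

text \<open>A bound on the cut norm, stated without forming the supremum. It carries no colours: the
  coloured distance dominates the plain one by the triangle inequality over blocks, so colours enter
  only through vertex weights and admissible maps.\<close>

definition cut_le :: "real \<Rightarrow> ('a \<times> 'a \<Rightarrow> real) \<Rightarrow> bool" where
  "cut_le e D \<longleftrightarrow> (\<forall>A\<in>sets M. \<forall>B\<in>sets M. \<bar>\<integral>w. D w * indicator (A \<times> B) w \<partial>M2\<bar> \<le> e)"

text \<open>Bounds and symmetry hold everywhere rather than almost everywhere, so that integrability
  and permutations of variables need no null sets.\<close>

definition sym_kernel :: "('a \<times> 'a \<Rightarrow> real) \<Rightarrow> bool" where
  "sym_kernel g \<longleftrightarrow> g \<in> borel_measurable M2 \<and> (\<forall>w. 0 \<le> g w \<and> g w \<le> 1) \<and> (\<forall>x y. g (x, y) = g (y, x))"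

lemma sym_kernelD:
  assumes "sym_kernel g"
  shows "g \<in> borel_measurable M2" "0 \<le> g w" "g w \<le> 1" "\<bar>g w\<bar> \<le> 1" "g (x, y) = g (y, x)"
proof -
  have g: "g \<in> borel_measurable M2" "\<And>w. 0 \<le> g w \<and> g w \<le> 1" "g (x, y) = g (y, x)"
    using assms unfolding sym_kernel_def by blast+
  show "g \<in> borel_measurable M2" "0 \<le> g w" "g w \<le> 1" "g (x, y) = g (y, x)"
    using g by blast+
  then show "\<bar>g w\<bar> \<le> 1" by simp
qed

definition triangle :: "('a \<Rightarrow> real) \<Rightarrow> ('a \<Rightarrow> real) \<Rightarrow> ('a \<Rightarrow> real) \<Rightarrow> ('a \<times> 'a \<Rightarrow> real) \<Rightarrow> real" where
  "triangle u v w g = (\<integral>(x, y, z). u x * v y * w z * (g (x, y) * g (x, z) * g (y, z)) \<partial>M3)"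

definition edge :: "('a \<Rightarrow> real) \<Rightarrow> ('a \<Rightarrow> real) \<Rightarrow> ('a \<times> 'a \<Rightarrow> real) \<Rightarrow> real" where
  "edge u v g = (\<integral>(x, y). u x * v y * g (x, y) \<partial>M2)"

definition entropy :: "('a \<times> 'a \<Rightarrow> real) \<Rightarrow> real" where
  "entropy g = (\<integral>w. I_fun (g w) \<partial>M2)"

lemma cut_leD: "cut_le e D \<Longrightarrow> A \<in> sets M \<Longrightarrow> B \<in> sets M \<Longrightarrow> \<bar>\<integral>w. D w * indicator (A \<times> B) w \<partial>M2\<bar> \<le> e"
  by (auto simp: cut_le_def)

text \<open>The product over the three edges telescopes, with one factor \<open>p\<close> turned
  into \<open>q\<close> at a time, so each of the three differences contains \<open>D\<close>
  exactly once. The vertex weights are absorbed into the two remaining edge factors, which stay in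
  [0,1]. The constant 3 counts the edges.\<close>

lemma triangle_counting:
  assumes p: "sym_kernel p" and q: "sym_kernel q" and cut: "cut_le e (\<lambda>w. p w - q w)"
    and [measurable]: "u \<in> borel_measurable M" "v \<in> borel_measurable M" "w \<in> borel_measurable M"
    and u: "\<And>x. 0 \<le> u x \<and> u x \<le> 1" and v: "\<And>x. 0 \<le> v x \<and> v x \<le> 1" and w: "\<And>x. 0 \<le> w x \<and> w x \<le> 1"
  shows "\<bar>triangle u v w p - triangle u v w q\<bar> \<le> 3 * e"
proof -
  note [measurable] = sym_kernelD(1)[OF p] sym_kernelD(1)[OF q]
  define D where "D w = p w - q w" for w
  have [measurable]: "D \<in> borel_measurable M2" unfolding D_def by measurable
  have bd: "\<bar>D w\<bar> \<le> 1" for w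
    using sym_kernelD(2,3)[OF p, of w] sym_kernelD(2,3)[OF q, of w] by (auto simp: D_def)
  note cutD = cut_leD[OF cut, folded D_def]
  note tcb = triangle_cut_bound[of D, OF _ bd cutD]
  note pq01 = sym_kernelD(2,3)[OF p] sym_kernelD(2,3)[OF q]
  define F1 where "F1 = (\<lambda>(x, y, z). D (x, y) * (u x * w z * p (x, z)) * (v y * p (y, z)))"
  define F2 where "F2 = (\<lambda>(x, y, z). D (x, z) * (u x * v y * q (x, y)) * (w z * p (y, z)))"
  define F3 where "F3 = (\<lambda>(x, y, z). D (y, z) * (u x * v y * q (x, y)) * (w z * q (x, z)))"
  have "\<bar>\<integral>(x, y, z). D (x, y) * (case (x, z) of (x, z) \<Rightarrow> u x * w z * p (x, z)) *
      (case (y, z) of (y, z) \<Rightarrow> v y * p (y, z)) \<partial>M3\<bar> \<le> e"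
    using u v w pq01 by (intro tcb(3)) (auto intro!: mult_le_one)
  then have 1: "\<bar>\<integral>x. F1 x \<partial>M3\<bar> \<le> e" unfolding F1_def prod.case .
  have "\<bar>\<integral>(x, y, z). D (x, z) * (case (x, y) of (x, y) \<Rightarrow> u x * v y * q (x, y)) *
      (case (y, z) of (y, z) \<Rightarrow> w z * p (y, z)) \<partial>M3\<bar> \<le> e"
    using u v w pq01 by (intro tcb(2)) (auto intro!: mult_le_one)
  then have 2: "\<bar>\<integral>x. F2 x \<partial>M3\<bar> \<le> e" unfolding F2_def prod.case .
  have "\<bar>\<integral>(x, y, z). D (y, z) * (case (x, y) of (x, y) \<Rightarrow> u x * v y * q (x, y)) *
      (case (x, z) of (x, z) \<Rightarrow> w z * q (x, z)) \<partial>M3\<bar> \<le> e"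
    using u v w pq01 by (intro tcb(1)) (auto intro!: mult_le_one)
  then have 3: "\<bar>\<integral>x. F3 x \<partial>M3\<bar> \<le> e" unfolding F3_def prod.case .
  have [simp]: "integrable M3 F1" "integrable M3 F2" "integrable M3 F3"
    unfolding F1_def F2_def F3_def using u v w pq01
    by (auto intro!: P3.integrable_bounded[where c=1] abs_mult_le_one bd)
  have int: "integrable M3 (\<lambda>(x, y, z). u x * v y * w z * (g (x, y) * g (x, z) * g (y, z)))"
    if "sym_kernel g" for g
    using u v w sym_kernelD(1)[OF that] sym_kernelD(2-4)[OF that]
    by (auto intro!: P3.integrable_bounded[where c=1] abs_mult_le_one)
  have "u x * v y * w z * (p (x, y) * p (x, z) * p (y, z)) -
      u x * v y * w z * (q (x, y) * q (x, z) * q (y, z)) =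
      F1 (x, y, z) + F2 (x, y, z) + F3 (x, y, z)" for x y z
    unfolding F1_def F2_def F3_def D_def prod.case by algebra
  then have "triangle u v w p - triangle u v w q = (\<integral>x. F1 x + F2 x + F3 x \<partial>M3)"
    unfolding triangle_def
    by (subst Bochner_Integration.integral_diff[symmetric, OF int[OF p] int[OF q]])
      (auto intro!: Bochner_Integration.integral_cong simp del: Bochner_Integration.integral_add)
  also have "\<dots> = (\<integral>x. F1 x \<partial>M3) + (\<integral>x. F2 x \<partial>M3) + (\<integral>x. F3 x \<partial>M3)" by simp
  finally show ?thesis using 1 2 3 by linarith
qed

lemma edge_counting:
  assumes p: "sym_kernel p" and q: "sym_kernel q" and cut: "cut_le e (\<lambda>w. p w - q w)"
    and [measurable]: "u \<in> borel_measurable M" "v \<in> borel_measurable M"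
    and u: "\<And>x. 0 \<le> u x \<and> u x \<le> 1" and v: "\<And>x. 0 \<le> v x \<and> v x \<le> 1"
  shows "\<bar>edge u v p - edge u v q\<bar> \<le> e"
proof -
  note [measurable] = sym_kernelD(1)[OF p] sym_kernelD(1)[OF q]
  have bd: "\<bar>p w - q w\<bar> \<le> 1" for w
    using sym_kernelD(2,3)[OF p, of w] sym_kernelD(2,3)[OF q, of w] by auto
  have int: "integrable M2 (\<lambda>(x, y). u x * v y * g (x, y))" if "sym_kernel g" for g
    using u v sym_kernelD(1)[OF that] sym_kernelD(2-4)[OF that]
    by (auto intro!: P2.integrable_bounded[where c=1] abs_mult_le_one)
  have "edge u v p - edge u v q = (\<integral>w. (p w - q w) * u (fst w) * v (snd w) \<partial>M2)"
    unfolding edge_def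
    by (subst Bochner_Integration.integral_diff[symmetric, OF int[OF p] int[OF q]])
      (auto intro!: Bochner_Integration.integral_cong simp: algebra_simps)
  also have "\<bar>\<dots>\<bar> \<le> e"
    using u v by (intro cut_bound_functions[OF _ bd cut_leD[OF cut]]) auto
  finally show ?thesis .
qed

section \<open>Invariance under measure-preserving maps\<close>

lemma measure_preserving_measurable: "measure_preserving \<sigma> \<Longrightarrow> \<sigma> \<in> measurable M M"
  by (simp add: measure_preserving_def)

lemma distr_M2:
  assumes "measure_preserving \<sigma>"
  shows "distr M2 M2 (\<lambda>w. (\<sigma> (fst w), \<sigma> (snd w))) = M2"
  using pair_measure_distr[of \<sigma> M M \<sigma> M M] assms
  by (simp add: measure_preserving_def case_prod_unfold sigma_finite_measure_axioms)

lemma distr_M3: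
  assumes "measure_preserving \<sigma>"
  shows "distr M3 M3 (\<lambda>w. (\<sigma> (fst w), \<sigma> (fst (snd w)), \<sigma> (snd (snd w)))) = M3"
proof -
  have [measurable]: "\<sigma> \<in> measurable M M" using assms by (simp add: measure_preserving_def)
  show ?thesis
    using pair_measure_distr[of \<sigma> M M "\<lambda>w. (\<sigma> (fst w), \<sigma> (snd w))" M2 M2] distr_M2[OF assms] assms
    by (simp add: measure_preserving_def case_prod_unfold P2.sigma_finite_measure_axioms)
qed

definition pullback :: "('a \<times> 'a \<Rightarrow> real) \<Rightarrow> ('a \<Rightarrow> 'a) \<Rightarrow> 'a \<times> 'a \<Rightarrow> real" where
  "pullback g \<sigma> w = g (\<sigma> (fst w), \<sigma> (snd w))"

lemma pullback_measurable:
  assumes [measurable]: "measure_preserving \<sigma>" "g \<in> borel_measurable M2"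
  shows "pullback g \<sigma> \<in> borel_measurable M2"
proof -
  have [measurable]: "\<sigma> \<in> measurable M M" using assms by (simp add: measure_preserving_def)
  show ?thesis unfolding pullback_def by measurable
qed

lemma sym_kernel_pullback:
  assumes "sym_kernel g" "measure_preserving \<sigma>"
  shows "sym_kernel (pullback g \<sigma>)"
  using sym_kernelD[OF assms(1)] pullback_measurable[OF assms(2), of g]
  by (auto simp: sym_kernel_def pullback_def)

lemma integral_pullback:
  assumes s: "measure_preserving \<sigma>" and [measurable]: "f \<in> borel_measurable M2"
  shows "(\<integral>w. pullback f \<sigma> w \<partial>M2) = (\<integral>w. f w \<partial>M2)"
proof -
  have [measurable]: "\<sigma> \<in> measurable M M" using s by (simp add: measure_preserving_def)
  show ?thesis
    using integral_distr[of "\<lambda>w. (\<sigma> (fst w), \<sigma> (snd w))" M2 M2 f]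
    by (simp add: distr_M2[OF s] pullback_def)
qed

lemma integrable_pullback:
  fixes f :: "'a \<times> 'a \<Rightarrow> real"
  assumes s: "measure_preserving \<sigma>" and f: "integrable M2 f"
  shows "integrable M2 (pullback f \<sigma>)"
proof -
  have [measurable]: "\<sigma> \<in> measurable M M" using s by (simp add: measure_preserving_def)
  have "integrable (distr M2 M2 (\<lambda>w. (\<sigma> (fst w), \<sigma> (snd w)))) f"
    by (simp add: distr_M2[OF s] f)
  then show ?thesis
    unfolding pullback_def[abs_def] by (rule integrable_distr[rotated]) measurable
qed

lemma entropy_pullback:
  assumes s: "measure_preserving \<sigma>" and [measurable]: "g \<in> borel_measurable M2"
  shows "entropy (pullback g \<sigma>) = entropy g"
  using integral_pullback[OF s, of "\<lambda>w. I_fun (g w)"] by (simp add: entropy_def pullback_def)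

lemma AE_M2_coordinates:
  assumes "AE x in M. P x" "Measurable.pred M P"
  shows "AE w in M2. P (fst w) \<and> P (snd w)"
  using assms by (intro P2.AE_pair_measure) auto

text \<open>The exceptional set is enclosed in a measurable null set, which supplies the
  measurability that \<open>AE_M2_coordinates\<close> asks for.\<close>

lemma AE_M2_both:
  assumes "AE x in M. P x"
  shows "AE w in M2. P (fst w) \<and> P (snd w)"
proof -
  obtain N where N: "{x \<in> space M. \<not> P x} \<subseteq> N" "emeasure M N = 0" "N \<in> sets M"
    using AE_E[OF assms] by blast
  have "AE x in M. x \<notin> N" using N by (intro AE_not_in) (auto simp: null_sets_def)
  moreover have "Measurable.pred M (\<lambda>x. x \<notin> N)" using N(3) by measurable
  ultimately have "AE w in M2. fst w \<notin> N \<and> snd w \<notin> N" by (rule AE_M2_coordinates)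
  with AE_space show ?thesis
    by eventually_elim (use N(1) in \<open>auto simp: space_pair_measure\<close>)
qed

lemma AE_M3_coordinates:
  assumes "AE x in M. P x" and [measurable]: "Measurable.pred M P"
  shows "AE w in M3. P (fst w) \<and> P (fst (snd w)) \<and> P (snd (snd w))"
proof (intro P3.AE_pair_measure)
  show "{w \<in> space M3. P (fst w) \<and> P (fst (snd w)) \<and> P (snd (snd w))} \<in> sets M3" by measurable
  show "AE x in M. AE y in M2. P (fst (x, y)) \<and> P (fst (snd (x, y))) \<and> P (snd (snd (x, y)))"
    using assms(1)
  proof eventually_elim
    case (elim x)
    show ?case using AE_M2_coordinates[OF assms] by eventually_elim (use elim in auto)
  qed
qed

text \<open>Changing variables by \<open>\<sigma>\<close> moves the kernel and the weights
  simultaneously; almost everywhere invariance then restores the weights.\<close>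

lemma edge_pullback:
  assumes s: "measure_preserving \<sigma>" and [measurable]: "g \<in> borel_measurable M2"
    "u \<in> borel_measurable M" "v \<in> borel_measurable M"
    and inv: "AE x in M. u (\<sigma> x) = u x \<and> v (\<sigma> x) = v x"
  shows "edge u v (pullback g \<sigma>) = edge u v g"
proof -
  have [measurable]: "\<sigma> \<in> measurable M M" using s by (simp add: measure_preserving_def)
  have "Measurable.pred M (\<lambda>x. u (\<sigma> x) = u x \<and> v (\<sigma> x) = v x)" by measurable
  note ae = AE_M2_coordinates[OF inv this]
  have "edge u v g = (\<integral>w. pullback (\<lambda>(x, y). u x * v y * g (x, y)) \<sigma> w \<partial>M2)"
    unfolding edge_def by (rule integral_pullback[OF s, symmetric]) measurable
  also have "\<dots> = (\<integral>(x, y). u x * v y * pullback g \<sigma> (x, y) \<partial>M2)"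
    unfolding pullback_def case_prod_unfold
  proof (rule integral_cong_AE)
    show "AE w in M2. u (fst (\<sigma> (fst w), \<sigma> (snd w))) * v (snd (\<sigma> (fst w), \<sigma> (snd w))) *
        g (fst (\<sigma> (fst w), \<sigma> (snd w)), snd (\<sigma> (fst w), \<sigma> (snd w))) =
      u (fst w) * v (snd w) * g (\<sigma> (fst (fst w, snd w)), \<sigma> (snd (fst w, snd w)))"
      using ae by eventually_elim auto
  qed measurable
  finally show ?thesis by (simp add: edge_def)
qed

lemma triangle_pullback:
  assumes s: "measure_preserving \<sigma>" and [measurable]: "g \<in> borel_measurable M2"
    "u \<in> borel_measurable M" "v \<in> borel_measurable M" "w \<in> borel_measurable M"
    and inv: "AE x in M. u (\<sigma> x) = u x \<and> v (\<sigma> x) = v x \<and> w (\<sigma> x) = w x"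
  shows "triangle u v w (pullback g \<sigma>) = triangle u v w g"
proof -
  have [measurable]: "\<sigma> \<in> measurable M M" using s by (simp add: measure_preserving_def)
  define F where "F = (\<lambda>(x, y, z). u x * v y * w z * (g (x, y) * g (x, z) * g (y, z)))"
  define F' where "F' = (\<lambda>(x, y, z). u x * v y * w z *
    (pullback g \<sigma> (x, y) * pullback g \<sigma> (x, z) * pullback g \<sigma> (y, z)))"
  let ?T = "\<lambda>r. (\<sigma> (fst r), \<sigma> (fst (snd r)), \<sigma> (snd (snd r)))"
  have [measurable]: "F \<in> borel_measurable M3" unfolding F_def by measurable
  have [measurable]: "F' \<in> borel_measurable M3" unfolding F'_def pullback_def by measurable
  have "Measurable.pred M (\<lambda>x. u (\<sigma> x) = u x \<and> v (\<sigma> x) = v x \<and> w (\<sigma> x) = w x)" by measurable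
  note ae = AE_M3_coordinates[OF inv this]
  have "(\<integral>r. F r \<partial>M3) = (\<integral>r. F (?T r) \<partial>M3)"
    using integral_distr[of ?T M3 M3 F] by (simp add: distr_M3[OF s])
  also have "\<dots> = (\<integral>r. F' r \<partial>M3)"
  proof (rule integral_cong_AE)
    show "AE r in M3. F (?T r) = F' r"
      using ae by eventually_elim (auto simp: F_def F'_def pullback_def)
  qed measurable
  finally show ?thesis by (simp add: triangle_def F_def F'_def)
qed

lemma AE_M2_swap:
  assumes "AE w in M2. P w"
  shows "AE w in M2. P (snd w, fst w)"
proof -
  have "AE w in distr M2 M2 (\<lambda>(x, y). (y, x)). P w"
    by (subst P2.distr_pair_swap[symmetric]) (rule assms)
  then have "AE w in M2. P (case w of (x, y) \<Rightarrow> (y, x))" by (rule AE_distrD[rotated]) measurable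
  then show ?thesis by (simp add: case_prod_unfold)
qed

text \<open>A kernel is known only up to a null set of pairs, whereas a triangle evaluates it at
  three pairs of coordinates. Fubini shows that the exceptional triples are still
  negligible.\<close>

lemma AE_M3_pairs:
  assumes ae: "AE w in M2. P w" and [measurable]: "Measurable.pred M2 P"
  shows "AE (x, y, z) in M3. P (x, y) \<and> P (x, z) \<and> P (y, z)"
proof (rule P3.AE_pair_measure)
  show "{w \<in> space M3. case w of (x, y, z) \<Rightarrow> P (x, y) \<and> P (x, z) \<and> P (y, z)} \<in> sets M3"
    by measurable
  have "AE x in M. AE y in M. P (x, y)" using P2.AE_pair[OF ae] .
  with AE_space[of M] show "AE x in M. AE w in M2. case (x, w) of (x, y, z) \<Rightarrow> P (x, y) \<and> P (x, z) \<and> P (y, z)"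
  proof eventually_elim
    case (elim x)
    note [measurable] = elim(1)
    have "AE w in M2. P (x, fst w)"
      using elim(2) by (intro P2.AE_pair_measure) auto
    moreover have "AE w in M2. P (x, snd w)"
      using elim(2) by (intro P2.AE_pair_measure) auto
    ultimately show ?case using ae by eventually_elim auto
  qed
qed

section \<open>Entropy under cut convergence\<close>

text \<open>A cut bound controls rectangles only, and the test function may move with
  \<open>n\<close>. Both are handled by approximation in L1: the set of good \<open>f\<close>
  contains indicators of rectangles and is closed under sums, multiples and dominated limits, hence
  contains every integrable function.\<close>

lemma cut_weak_convergence:
  fixes D :: "nat \<Rightarrow> 'a \<times> 'a \<Rightarrow> real"
  assumes D[measurable]: "\<And>n. D n \<in> borel_measurable M2" and bd: "\<And>n w. \<bar>D n w\<bar> \<le> 1"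
    and \<tau>: "\<And>n. measure_preserving (\<tau> n)"
    and cut: "\<And>n. cut_le (e n) (D n)" and e: "e \<longlonglongrightarrow> 0"
    and f: "integrable M2 f"
  shows "(\<lambda>n. \<integral>w. D n w * pullback f (\<tau> n) w \<partial>M2) \<longlonglongrightarrow> 0"
proof -
  have [measurable]: "\<tau> n \<in> measurable M M" for n by (rule measure_preserving_measurable[OF \<tau>])
  define Pr where "Pr f \<longleftrightarrow> (\<lambda>n. \<integral>w. D n w * pullback f (\<tau> n) w \<partial>M2) \<longlonglongrightarrow> 0" for f :: "'a \<times> 'a \<Rightarrow> real"
  have int: "integrable M2 (\<lambda>w. D n w * pullback f (\<tau> n) w)" if "integrable M2 f" for n f
  proof (rule Bochner_Integration.integrable_bound[OF integrable_pullback[OF \<tau>[of n] that]])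
    have [measurable]: "pullback f (\<tau> n) \<in> borel_measurable M2"
      using borel_measurable_integrable[OF that] by (intro pullback_measurable \<tau>)
    show "(\<lambda>w. D n w * pullback f (\<tau> n) w) \<in> borel_measurable M2" by measurable
    show "AE w in M2. norm (D n w * pullback f (\<tau> n) w) \<le> norm (pullback f (\<tau> n) w)"
      using bd by (auto simp: abs_mult mult_left_le_one_le)
  qed
  \<comment> \<open>Since \<open>\<tau> n\<close> preserves the measure, the bound does not depend
    on \<open>n\<close>; this uniformity justifies exchanging the limit in \<open>n\<close> with the
    L1 approximation of \<open>f\<close>.\<close>
  have bound: "\<bar>\<integral>w. D n w * pullback f (\<tau> n) w \<partial>M2\<bar> \<le> (\<integral>w. \<bar>f w\<bar> \<partial>M2)" if f: "integrable M2 f" for n f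
  proof -
    have [measurable]: "f \<in> borel_measurable M2" using f by auto
    have "\<bar>\<integral>w. D n w * pullback f (\<tau> n) w \<partial>M2\<bar> \<le> (\<integral>w. \<bar>D n w * pullback f (\<tau> n) w\<bar> \<partial>M2)"
      by (rule integral_abs_bound)
    also have "\<dots> \<le> (\<integral>w. \<bar>pullback f (\<tau> n) w\<bar> \<partial>M2)"
      by (rule integral_mono[OF integrable_abs[OF int[OF f]] integrable_abs[OF integrable_pullback[OF \<tau> f]]])
        (use bd in \<open>simp add: abs_mult mult_left_le_one_le\<close>)
    also have "\<dots> = (\<integral>w. pullback (\<lambda>w. \<bar>f w\<bar>) (\<tau> n) w \<partial>M2)" by (simp add: pullback_def)
    also have "\<dots> = (\<integral>w. \<bar>f w\<bar> \<partial>M2)" by (rule integral_pullback[OF \<tau>]) measurable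
    finally show ?thesis .
  qed
  have sum_closed: "Pr (\<lambda>w. f w + g w)" if "integrable M2 f" "integrable M2 g" "Pr f" "Pr g" for f g
  proof -
    have "(\<integral>w. D n w * pullback (\<lambda>w. f w + g w) (\<tau> n) w \<partial>M2) =
      (\<integral>w. D n w * pullback f (\<tau> n) w \<partial>M2) + (\<integral>w. D n w * pullback g (\<tau> n) w \<partial>M2)" for n
      by (subst Bochner_Integration.integral_add[symmetric, OF int[OF that(1)] int[OF that(2)]])
        (simp add: pullback_def distrib_left)
    then show ?thesis using tendsto_add[OF that(3,4)[unfolded Pr_def]] by (simp add: Pr_def)
  qed
  have scale: "Pr (\<lambda>w. f w * c)" if "Pr f" for f c
    using tendsto_mult_right[OF that[unfolded Pr_def], of c]
    by (simp add: Pr_def pullback_def mult.assoc[symmetric])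
  \<comment> \<open>The factor 2 is the domination that \<open>integrable_induct\<close> provides
    for its approximating sequence; it makes 3 times the absolute value of \<open>f\<close> a
    dominating function for the differences.\<close>
  have lim_closed: "Pr f" if s: "\<And>i. integrable M2 (s i)" "\<And>i. Pr (s i)" and f: "integrable M2 f"
    and conv: "\<And>w. w \<in> space M2 \<Longrightarrow> (\<lambda>i. s i w) \<longlonglongrightarrow> f w"
    and dom: "\<And>i w. w \<in> space M2 \<Longrightarrow> \<bar>s i w\<bar> \<le> 2 * \<bar>f w\<bar>" for s f
  proof -
    have [measurable]: "\<And>i. s i \<in> borel_measurable M2" "f \<in> borel_measurable M2" using s f by auto
    have l1: "(\<lambda>i. \<integral>w. \<bar>f w - s i w\<bar> \<partial>M2) \<longlonglongrightarrow> (\<integral>w. 0 \<partial>M2)"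
    proof (rule integral_dominated_convergence[where w="\<lambda>w. 3 * \<bar>f w\<bar>"])
      show "AE w in M2. (\<lambda>i. \<bar>f w - s i w\<bar>) \<longlonglongrightarrow> 0"
        using conv by (intro AE_I2 tendsto_rabs_zero) (auto intro!: tendsto_eq_intros)
      show "AE w in M2. norm \<bar>f w - s i w\<bar> \<le> 3 * \<bar>f w\<bar>" for i
      proof (rule AE_I2)
        fix w assume "w \<in> space M2"
        then show "norm \<bar>f w - s i w\<bar> \<le> 3 * \<bar>f w\<bar>" using dom[of w i] by simp
      qed
    qed (use f in auto)
    show "Pr f"
      unfolding Pr_def
    proof (rule LIMSEQ_I)
      fix r :: real assume r: "0 < r"
      from LIMSEQ_D[OF l1, of "r / 2"] r obtain i where
        "norm ((\<integral>w. \<bar>f w - s i w\<bar> \<partial>M2) - (\<integral>w. 0 \<partial>M2)) < r / 2" by auto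
      then have i: "(\<integral>w. \<bar>f w - s i w\<bar> \<partial>M2) < r / 2" by simp
      from LIMSEQ_D[OF s(2)[of i, unfolded Pr_def], of "r / 2"] r obtain N where
        N: "\<And>n. n \<ge> N \<Longrightarrow> \<bar>\<integral>w. D n w * pullback (s i) (\<tau> n) w \<partial>M2\<bar> < r / 2" by auto
      show "\<exists>N. \<forall>n\<ge>N. norm ((\<integral>w. D n w * pullback f (\<tau> n) w \<partial>M2) - 0) < r"
      proof (intro exI allI impI)
        fix n assume n: "N \<le> n"
        have "(\<integral>w. D n w * pullback (\<lambda>w. f w - s i w) (\<tau> n) w \<partial>M2) =
          (\<integral>w. D n w * pullback f (\<tau> n) w \<partial>M2) - (\<integral>w. D n w * pullback (s i) (\<tau> n) w \<partial>M2)"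
          by (subst Bochner_Integration.integral_diff[symmetric, OF int[OF f] int[OF s(1)]])
            (simp add: pullback_def right_diff_distrib)
        moreover have "\<bar>\<integral>w. D n w * pullback (\<lambda>w. f w - s i w) (\<tau> n) w \<partial>M2\<bar> \<le> (\<integral>w. \<bar>f w - s i w\<bar> \<partial>M2)"
          using f s(1) by (intro bound) auto
        ultimately show "norm ((\<integral>w. D n w * pullback f (\<tau> n) w \<partial>M2) - 0) < r"
          using N[OF n] i by simp
      qed
    qed
  qed
  \<comment> \<open>Both coordinates are moved by the same one-variable map, so the preimage of a
    rectangle is again a rectangle and obeys the cut bound \<open>e n\<close>.\<close>
  have rect: "Pr (indicator (A \<times> B))" if [measurable]: "A \<in> sets M" "B \<in> sets M" for A B
  proof -
    have "\<bar>\<integral>w. D n w * pullback (indicator (A \<times> B)) (\<tau> n) w \<partial>M2\<bar> \<le> e n" for n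
    proof -
      have "(\<integral>w. D n w * pullback (indicator (A \<times> B)) (\<tau> n) w \<partial>M2) =
        (\<integral>w. D n w * indicator ((\<tau> n -` A \<inter> space M) \<times> (\<tau> n -` B \<inter> space M)) w \<partial>M2)"
        by (intro Bochner_Integration.integral_cong)
          (auto simp: pullback_def indicator_def space_pair_measure)
      then show ?thesis using cut[of n] by (simp add: cut_le_def)
    qed
    then have "\<forall>\<^sub>F n in sequentially.
        norm (\<integral>w. D n w * pullback (indicator (A \<times> B)) (\<tau> n) w \<partial>M2) \<le> e n" by simp
    then show ?thesis unfolding Pr_def by (rule Lim_null_comparison[OF _ e])
  qed
  have ind: "Pr (indicator X)" if "X \<in> sets M2" for X
  proof -
    show ?thesis
      using Int_stable_pair_measure_generator pair_measure_closed that
      unfolding sets_pair_measure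
    proof (induct X rule: sigma_sets_induct_disjoint)
      case (basic A)
      then show "Pr (indicator A)" using rect by auto
    next
      case empty
      show ?case using rect[OF sets.empty_sets sets.empty_sets] by (simp only: Sigma_empty1 lessThan_0 UN_empty)
    next
      case (compl A)
      then have [measurable]: "A \<in> sets M2" by (simp add: sets_pair_measure)
      have "Pr (\<lambda>w. indicator (space M \<times> space M) w + indicator A w * (-1))"
        using scale[OF compl(2), of "-1"] rect[of "space M" "space M"]
        by (intro sum_closed) (auto intro!: P2.integrable_bounded[where c=1])
      moreover have "(\<lambda>w. indicator (space M \<times> space M) w + indicator A w * (-1 :: real)) =
          indicator (space M \<times> space M - A)"
        using sets.sets_into_space[OF \<open>A \<in> sets M2\<close>]
        by (auto simp: fun_eq_iff indicator_def space_pair_measure)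
      ultimately show ?case by simp
    next
      case (union A)
      then have [measurable]: "\<And>i. A i \<in> sets M2" by (auto simp: sets_pair_measure)
      have "Pr (indicator (\<Union>i<k. A i))" for k
      proof (induction k)
        case 0
        show ?case using rect[OF sets.empty_sets sets.empty_sets] by (simp only: Sigma_empty1 lessThan_0 UN_empty)
      next
        case (Suc k)
        have "Pr (\<lambda>w. indicator (\<Union>i<k. A i) w + indicator (A k) w)"
          using Suc union(3) by (intro sum_closed) (auto intro!: P2.integrable_bounded[where c=1])
        moreover have "(\<lambda>w. indicator (\<Union>i<k. A i) w + indicator (A k) w :: real) =
          indicator (\<Union>i<Suc k. A i)"
        proof -
          have "A i \<inter> A k = {}" if "i < k" for i
            using that by (intro disjoint_family_onD[OF union(1)]) auto
          then have "(\<Union>i<k. A i) \<inter> A k = {}" by blast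
          then show ?thesis by (simp add: fun_eq_iff lessThan_Suc Un_commute flip: indicator_disj_union)
        qed
        ultimately show ?case by simp
      qed
      note partial_unions = this
      show ?case
      proof (rule lim_closed[of "\<lambda>k. indicator (\<Union>i<k. A i)"])
        show "integrable M2 (indicator (\<Union>i<k. A i) :: _ \<Rightarrow> real)" for k
          by (rule P2.integrable_bounded[where c=1]) auto
        show "integrable M2 (indicator (\<Union>i. A i) :: _ \<Rightarrow> real)"
          by (rule P2.integrable_bounded[where c=1]) auto
        show "(\<lambda>k. indicator (\<Union>i<k. A i) w) \<longlonglongrightarrow> (indicator (\<Union>i. A i) w :: real)" for w
          by (rule LIMSEQ_indicator_UN)
        show "\<bar>indicator (\<Union>i<k. A i) w\<bar> \<le> 2 * \<bar>indicator (\<Union>i. A i) w :: real\<bar>" for k w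
          by (auto simp: indicator_def)
      qed (rule partial_unions)
    qed
  qed
  from f have "Pr f"
  proof (induction rule: integrable_induct)
    case (base A c)
    then show ?case using scale[OF ind[of A], of c] by simp
  next
    case (add f g)
    then show ?case using sum_closed by blast
  next
    case (lim f s)
    then show ?case using lim_closed[of s f] by simp
  qed
  then show ?thesis by (simp add: Pr_def)
qed

section \<open>The entropy as a supremum of dual functionals\<close>

lemma integrable_I_fun:
  assumes "sym_kernel g"
  shows "integrable M2 (\<lambda>w. I_fun (g w))"
  using sym_kernelD(1-3)[OF assms]
  by (intro P2.integrable_bounded[where c=1] I_fun_abs_le) auto

lemma integrable_dual:
  assumes "sym_kernel g" and [measurable]: "f \<in> borel_measurable M2" and "\<And>w. \<bar>f w\<bar> \<le> c"
  shows "integrable M2 (\<lambda>w. g w * f w)" "integrable M2 (\<lambda>w. ln (1 + exp (f w)))"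
proof -
  note [measurable] = sym_kernelD(1)[OF assms(1)]
  show "integrable M2 (\<lambda>w. g w * f w)"
    using abs_mult_le[OF assms(3) sym_kernelD(4)[OF assms(1)]]
    by (intro P2.integrable_bounded[where c=c]) (auto simp: mult.commute)
  show "integrable M2 (\<lambda>w. ln (1 + exp (f w)))"
  proof (intro P2.integrable_bounded[where c="1 + c"])
    show "\<bar>ln (1 + exp (f w))\<bar> \<le> 1 + c" for w
      using ln_one_plus_exp_bounds[of "f w"] assms(3)[of w] by linarith
  qed measurable
qed

lemma dual_le_entropy:
  assumes "sym_kernel g" and [measurable]: "f \<in> borel_measurable M2" and "\<And>w. \<bar>f w\<bar> \<le> c"
  shows "(\<integral>w. g w * f w \<partial>M2) - (\<integral>w. ln (1 + exp (f w)) \<partial>M2) \<le> entropy g"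
proof -
  note int = integrable_dual[OF assms]
  have "(\<integral>w. g w * f w \<partial>M2) - (\<integral>w. ln (1 + exp (f w)) \<partial>M2) =
      (\<integral>w. g w * f w - ln (1 + exp (f w)) \<partial>M2)"
    using int by simp
  also have "\<dots> \<le> entropy g"
    unfolding entropy_def using int sym_kernelD(2,3)[OF assms(1)]
    by (intro integral_mono integrable_I_fun assms(1) I_fun_ge) auto
  finally show ?thesis .
qed

text \<open>The optimal dual variable is the logit of \<open>g\<close>, which is unbounded near the
  values 0 and 1, while cut convergence is tested against bounded \<open>f\<close>. Truncating at
  level \<open>d\<close> costs at most \<open>- I_fun d\<close>, and this tends to 0.\<close>

lemma entropy_le_dual:
  assumes g: "sym_kernel g"
    and dual: "\<And>f c. f \<in> borel_measurable M2 \<Longrightarrow> (\<And>w. \<bar>f w\<bar> \<le> c) \<Longrightarrow>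
      (\<integral>w. g w * f w \<partial>M2) - (\<integral>w. ln (1 + exp (f w)) \<partial>M2) \<le> E"
  shows "entropy g \<le> E"
proof -
  note [measurable] = sym_kernelD(1)[OF g]
  note g01 = sym_kernelD(2,3)[OF g]
  have "entropy g + I_fun (1 / (real n + 3)) \<le> E" for n
  proof -
    define d where "d = 1 / (real n + 3)"
    have d: "0 < d" "d < 1/2" by (auto simp: d_def field_simps)
    define v where "v w = max d (min (g w) (1 - d))" for w
    define f where "f w = ln (v w / (1 - v w))" for w
    have v: "d \<le> v w" "v w \<le> 1 - d" for w using d by (auto simp: v_def)
    have f[measurable]: "f \<in> borel_measurable M2" unfolding f_def v_def by measurable
    have fb: "\<bar>f w\<bar> \<le> - ln d" for w
    proof -
      have "ln d \<le> ln (v w)" "ln (v w) \<le> 0" "ln d \<le> ln (1 - v w)" "ln (1 - v w) \<le> 0"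
        using v[of w] d by auto
      moreover have "f w = ln (v w) - ln (1 - v w)" unfolding f_def using v[of w] d by (simp add: ln_div)
      ultimately show ?thesis by linarith
    qed
    note int = integrable_dual[OF g f fb]
    have "entropy g + I_fun d = (\<integral>w. I_fun (g w) + I_fun d \<partial>M2)"
      unfolding entropy_def using integrable_I_fun[OF g] by (simp add: P2.prob_space)
    also have "\<dots> \<le> (\<integral>w. g w * f w - ln (1 + exp (f w)) \<partial>M2)"
      using int integrable_I_fun[OF g] g01 d unfolding f_def v_def
      by (intro integral_mono I_fun_truncated_dual) auto
    also have "\<dots> = (\<integral>w. g w * f w \<partial>M2) - (\<integral>w. ln (1 + exp (f w)) \<partial>M2)"
      using int by simp
    also have "\<dots> \<le> E" by (rule dual[OF f fb])
    finally show ?thesis by (simp add: d_def)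
  qed
  moreover have "(\<lambda>n. entropy g + I_fun (1 / (real n + 3))) \<longlonglongrightarrow> entropy g + 0"
    by (intro tendsto_add tendsto_const I_fun_tendsto_0)
  ultimately have "entropy g + 0 \<le> E" by (intro LIMSEQ_le_const2) auto
  then show ?thesis by simp
qed

text \<open>What a vanishing infimum over maps yields when it may fail to be attained. The relation
  is one-sided: only \<open>q\<close> is pulled back. The set \<open>S\<close> carries the colour
  invariance of the maps.\<close>

definition cut_approximable :: "('a \<Rightarrow> 'a) set \<Rightarrow> ('a \<times> 'a \<Rightarrow> real) \<Rightarrow> ('a \<times> 'a \<Rightarrow> real) \<Rightarrow> bool" where
  "cut_approximable S p q \<longleftrightarrow>
     (\<forall>e>0. \<exists>\<sigma>\<in>S. measure_preserving \<sigma> \<and> cut_le e (\<lambda>w. p w - pullback q \<sigma> w))"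

text \<open>Testing \<open>p - q\<^sup>\<sigma>\<close> against fixed functions \<open>f\<close> bounds the entropy of \<open>p\<close>; testing it against
  \<open>f\<^sup>\<sigma>\<close> bounds that of \<open>q\<close>, so no measure-preserving map has to be inverted.\<close>

lemma entropy_cut_approximable:
  assumes p: "sym_kernel p" and q: "sym_kernel q" and pq: "cut_approximable S p q"
  shows "entropy p = entropy q"
proof -
  note [measurable] = sym_kernelD(1)[OF p] sym_kernelD(1)[OF q]
  have "\<exists>\<sigma>. measure_preserving \<sigma> \<and> cut_le (inverse (real (Suc n))) (\<lambda>w. p w - pullback q \<sigma> w)" for n
    using pq[unfolded cut_approximable_def, rule_format, of "inverse (real (Suc n))"] by auto
  then obtain \<sigma> where \<sigma>: "\<And>n. measure_preserving (\<sigma> n)"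
    and cut: "\<And>n. cut_le (inverse (real (Suc n))) (\<lambda>w. p w - pullback q (\<sigma> n) w)"
    by metis
  have \<sigma>_meas[measurable]: "\<sigma> n \<in> measurable M M" for n by (rule measure_preserving_measurable[OF \<sigma>])
  note qs = sym_kernel_pullback[OF q \<sigma>]
  note [measurable] = sym_kernelD(1)[OF qs]
  have bd: "\<bar>p w - pullback q (\<sigma> n) w\<bar> \<le> 1" for n w
    using sym_kernelD(2,3)[OF p, of w] sym_kernelD(2,3)[OF qs, of n w] by linarith
  \<comment> \<open>With the identity as \<open>\<tau>\<close>, \<open>cut_weak_convergence\<close>
    covers fixed test functions; with \<open>\<sigma>\<close> it covers the moving ones.\<close>
  have id: "measure_preserving (\<lambda>x. x)" by (simp add: measure_preserving_def distr_id[unfolded id_def])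
  show ?thesis
  proof (rule antisym)
    show "entropy p \<le> entropy q"
    proof (rule entropy_le_dual[OF p])
      fix f :: "'a \<times> 'a \<Rightarrow> real" and c assume f[measurable]: "f \<in> borel_measurable M2" and fb: "\<And>w. \<bar>f w\<bar> \<le> c"
      let ?R = "\<lambda>n. \<integral>w. (p w - pullback q (\<sigma> n) w) * pullback f (\<lambda>x. x) w \<partial>M2"
      have "?R \<longlonglongrightarrow> 0"
        using bd cut id LIMSEQ_inverse_real_of_nat P2.integrable_bounded[OF f fb]
        by (intro cut_weak_convergence) auto
      moreover have "(\<integral>w. p w * f w \<partial>M2) - (\<integral>w. ln (1 + exp (f w)) \<partial>M2) \<le> entropy q + ?R n" for n
      proof -
        have "?R n = (\<integral>w. p w * f w \<partial>M2) - (\<integral>w. pullback q (\<sigma> n) w * f w \<partial>M2)"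
          using integrable_dual(1)[OF p f fb] integrable_dual(1)[OF qs f fb]
          by (simp add: pullback_def[of f] left_diff_distrib)
        then show ?thesis
          using dual_le_entropy[OF qs f fb, of n] entropy_pullback[OF \<sigma>, of q n] by simp
      qed
      ultimately have "(\<integral>w. p w * f w \<partial>M2) - (\<integral>w. ln (1 + exp (f w)) \<partial>M2) \<le> entropy q + 0"
        by (intro LIMSEQ_le_const[OF tendsto_add[OF tendsto_const]]) auto
      then show "(\<integral>w. p w * f w \<partial>M2) - (\<integral>w. ln (1 + exp (f w)) \<partial>M2) \<le> entropy q" by simp
    qed
    show "entropy q \<le> entropy p"
    proof (rule entropy_le_dual[OF q])
      fix f :: "'a \<times> 'a \<Rightarrow> real" and c assume f[measurable]: "f \<in> borel_measurable M2" and fb: "\<And>w. \<bar>f w\<bar> \<le> c"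
      let ?R = "\<lambda>n. \<integral>w. (p w - pullback q (\<sigma> n) w) * pullback f (\<sigma> n) w \<partial>M2"
      have "?R \<longlonglongrightarrow> 0"
        using bd cut \<sigma> LIMSEQ_inverse_real_of_nat P2.integrable_bounded[OF f fb]
        by (intro cut_weak_convergence) auto
      moreover have "(\<integral>w. q w * f w \<partial>M2) - (\<integral>w. ln (1 + exp (f w)) \<partial>M2) + ?R n \<le> entropy p" for n
      proof -
        have fs: "pullback f (\<sigma> n) \<in> borel_measurable M2" by (rule pullback_measurable[OF \<sigma> f])
        have fsb: "\<bar>pullback f (\<sigma> n) w\<bar> \<le> c" for w by (simp add: pullback_def fb)
        have "?R n = (\<integral>w. p w * pullback f (\<sigma> n) w \<partial>M2) - (\<integral>w. pullback q (\<sigma> n) w * pullback f (\<sigma> n) w \<partial>M2)"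
          using integrable_dual(1)[OF p fs fsb] integrable_dual(1)[OF qs fs fsb]
          by (simp add: left_diff_distrib)
        \<comment> \<open>Kernel and test function are moved by the same map, so the dual functional
          of \<open>q\<close> at \<open>f\<close> is recovered exactly; only the term with
          \<open>p\<close> involves a limit.\<close>
        moreover have "(\<integral>w. pullback q (\<sigma> n) w * pullback f (\<sigma> n) w \<partial>M2) = (\<integral>w. q w * f w \<partial>M2)"
          using integral_pullback[OF \<sigma>, of "\<lambda>w. q w * f w" n] by (simp add: pullback_def)
        moreover have "(\<integral>w. ln (1 + exp (pullback f (\<sigma> n) w)) \<partial>M2) = (\<integral>w. ln (1 + exp (f w)) \<partial>M2)"
          using integral_pullback[OF \<sigma>, of "\<lambda>w. ln (1 + exp (f w))" n] by (simp add: pullback_def)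
        ultimately show ?thesis using dual_le_entropy[OF p fs fsb] by simp
      qed
      ultimately have "(\<integral>w. q w * f w \<partial>M2) - (\<integral>w. ln (1 + exp (f w)) \<partial>M2) + 0 \<le> entropy p"
        by (intro LIMSEQ_le_const2[OF tendsto_add[OF tendsto_const]]) auto
      then show "(\<integral>w. q w * f w \<partial>M2) - (\<integral>w. ln (1 + exp (f w)) \<partial>M2) \<le> entropy p" by simp
    qed
  qed
qed

lemma triangle_cut_approximable:
  assumes p: "sym_kernel p" and q: "sym_kernel q" and pq: "cut_approximable S p q"
    and [measurable]: "u \<in> borel_measurable M" "v \<in> borel_measurable M" "w \<in> borel_measurable M"
    and u: "\<And>x. 0 \<le> u x \<and> u x \<le> 1" and v: "\<And>x. 0 \<le> v x \<and> v x \<le> 1" and w: "\<And>x. 0 \<le> w x \<and> w x \<le> 1"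
    and inv: "\<And>\<sigma>. \<sigma> \<in> S \<Longrightarrow> AE x in M. u (\<sigma> x) = u x \<and> v (\<sigma> x) = v x \<and> w (\<sigma> x) = w x"
  shows "triangle u v w p = triangle u v w q"
proof -
  have "\<bar>triangle u v w p - triangle u v w q\<bar> \<le> 0"
  proof (rule field_le_epsilon)
    fix e :: real assume "0 < e"
    obtain \<sigma> where \<sigma>: "\<sigma> \<in> S" "measure_preserving \<sigma>" "cut_le (e / 3) (\<lambda>w. p w - pullback q \<sigma> w)"
      using pq[unfolded cut_approximable_def, rule_format, of "e / 3"] \<open>0 < e\<close> by auto
    have "\<bar>triangle u v w p - triangle u v w (pullback q \<sigma>)\<bar> \<le> 3 * (e / 3)"
      using \<sigma> u v w by (intro triangle_counting p sym_kernel_pullback[OF q]) auto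
    moreover have "triangle u v w (pullback q \<sigma>) = triangle u v w q"
      by (rule triangle_pullback[OF \<sigma>(2) sym_kernelD(1)[OF q] _ _ _ inv[OF \<sigma>(1)]]) measurable
    ultimately show "\<bar>triangle u v w p - triangle u v w q\<bar> \<le> 0 + e" by simp
  qed
  then show ?thesis by simp
qed

lemma edge_cut_approximable:
  assumes p: "sym_kernel p" and q: "sym_kernel q" and pq: "cut_approximable S p q"
    and [measurable]: "u \<in> borel_measurable M" "v \<in> borel_measurable M"
    and u: "\<And>x. 0 \<le> u x \<and> u x \<le> 1" and v: "\<And>x. 0 \<le> v x \<and> v x \<le> 1"
    and inv: "\<And>\<sigma>. \<sigma> \<in> S \<Longrightarrow> AE x in M. u (\<sigma> x) = u x \<and> v (\<sigma> x) = v x"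
  shows "edge u v p = edge u v q"
proof -
  have "\<bar>edge u v p - edge u v q\<bar> \<le> 0"
  proof (rule field_le_epsilon)
    fix e :: real assume "0 < e"
    obtain \<sigma> where \<sigma>: "\<sigma> \<in> S" "measure_preserving \<sigma>" "cut_le e (\<lambda>w. p w - pullback q \<sigma> w)"
      using pq[unfolded cut_approximable_def, rule_format, of e] \<open>0 < e\<close> by auto
    have "\<bar>edge u v p - edge u v (pullback q \<sigma>)\<bar> \<le> e"
      using \<sigma> u v by (intro edge_counting p sym_kernel_pullback[OF q]) auto
    moreover have "edge u v (pullback q \<sigma>) = edge u v q"
      by (rule edge_pullback[OF \<sigma>(2) sym_kernelD(1)[OF q] _ _ inv[OF \<sigma>(1)]]) measurable
    ultimately show "\<bar>edge u v p - edge u v q\<bar> \<le> 0 + e" by simp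
  qed
  then show ?thesis by simp
qed

section \<open>The variational argument\<close>

text \<open>The number \<open>K\<close> below is the integral of a nonnegative Legendre gap.
  Comparing \<open>g\<close> with the convex combinations \<open>gt\<close> bounds it by a multiple
  of \<open>t\<close>, so it vanishes, and the equality case of the duality determines
  \<open>g\<close> pointwise.\<close>

lemma maximizer_fixed_point:
  fixes \<Delta> :: "'a \<times> 'a \<times> 'a \<Rightarrow> real" and h :: "'a \<times> 'a \<Rightarrow> real"
  defines "T \<equiv> \<lambda>g w. \<integral>z. \<Delta> (fst w, snd w, z) * g (fst w, z) * g (snd w, z) \<partial>M"
  defines "J \<equiv> \<lambda>g. 1/6 * (\<integral>(x, y, z). \<Delta> (x, y, z) * (g (x, y) * g (x, z) * g (y, z)) \<partial>M3) +
     1/2 * (\<integral>w. h w * g w \<partial>M2) - 1/2 * entropy g"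
  assumes \<Delta>[measurable]: "\<Delta> \<in> borel_measurable M3" and \<Delta>b: "\<And>w. \<bar>\<Delta> w\<bar> \<le> a"
    and \<Delta>s: "\<And>x y z. \<Delta> (x, y, z) = \<Delta> (y, x, z)" "\<And>x y z. \<Delta> (x, y, z) = \<Delta> (x, z, y)"
    and h[measurable]: "h \<in> borel_measurable M2" and hb: "\<And>w. \<bar>h w\<bar> \<le> c"
    and hs: "\<And>x y. h (x, y) = h (y, x)"
    and g: "sym_kernel g"
    and max: "\<And>g'. sym_kernel g' \<Longrightarrow> J g' \<le> J g"
  shows "AE w in M2. g w = logistic (h w + T g w)"
proof -
  note [measurable] = sym_kernelD(1)[OF g]
  note g01 = sym_kernelD(2,3,4)[OF g] and gs = sym_kernelD(5)[OF g]
  have Tb: "\<bar>T g w\<bar> \<le> a" for w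
    unfolding T_def using g01 by (intro abs_integral_bounded abs_mult_le \<Delta>b) auto
  have [measurable]: "T g \<in> borel_measurable M2" unfolding T_def by measurable
  have Ts: "T g (x, y) = T g (y, x)" for x y
    unfolding T_def using \<Delta>s(1)[of x y] by (simp add: mult_ac)
  define f where "f w = h w + T g w" for w
  have fm[measurable]: "f \<in> borel_measurable M2" unfolding f_def by measurable
  have fb: "\<bar>f w\<bar> \<le> c + a" for w using hb[of w] Tb[of w] by (simp add: f_def)
  define s where "s w = logistic (f w)" for w
  have s: "sym_kernel s"
    unfolding sym_kernel_def s_def
    using logistic_bounds hs Ts by (auto simp: less_imp_le f_def)
  note [measurable] = sym_kernelD(1)[OF s]
  define d where "d w = s w - g w" for w
  have [measurable]: "d \<in> borel_measurable M2" unfolding d_def by measurable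
  have db: "\<bar>d w\<bar> \<le> 1" for w
    using g01(1,2)[of w] sym_kernelD(2,3)[OF s, of w] by (simp add: d_def)
  have ds: "d (x, y) = d (y, x)" for x y
    using gs[of x y] sym_kernelD(5)[OF s, of x y] by (simp add: d_def)
  \<comment> \<open>One third of the derivative of the cubic term at \<open>g\<close> in direction
    \<open>d\<close>. In \<open>F1\<close>, \<open>F2\<close> and \<open>F3\<close> the direction
    occupies one edge each; by symmetry of \<open>\<Delta>\<close> and of \<open>g\<close> all three
    integrals equal \<open>Q\<close>.\<close>
  define Q where "Q = (\<integral>w. d w * T g w \<partial>M2)"
  define F1 where "F1 = (\<lambda>(x, y, z). \<Delta> (x, y, z) * (d (x, y) * g (x, z) * g (y, z)))"
  define F2 where "F2 = (\<lambda>(x, y, z). \<Delta> (x, y, z) * (g (x, y) * d (x, z) * g (y, z)))"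
  define F3 where "F3 = (\<lambda>(x, y, z). \<Delta> (x, y, z) * (g (x, y) * g (x, z) * d (y, z)))"
  have [measurable]: "F1 \<in> borel_measurable M3" "F2 \<in> borel_measurable M3" "F3 \<in> borel_measurable M3"
    unfolding F1_def F2_def F3_def by measurable
  have Fb: "\<bar>F1 w\<bar> \<le> a" "\<bar>F2 w\<bar> \<le> a" "\<bar>F3 w\<bar> \<le> a" for w
    unfolding F1_def F2_def F3_def case_prod_unfold
    by (intro abs_mult_le abs_mult_le_one \<Delta>b db g01)+
  have Fint: "integrable M3 F1" "integrable M3 F2" "integrable M3 F3"
    using Fb by (auto intro!: P3.integrable_bounded)
  have Q1: "(\<integral>w. F1 w \<partial>M3) = Q"
  proof -
    have 1: "(\<integral>z. F1 (x, y, z) \<partial>M) = d (x, y) * T g (x, y)" for x y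
    proof -
      have "F1 (x, y, z) = d (x, y) * (\<Delta> (x, y, z) * g (x, z) * g (y, z))" for z
        by (simp add: F1_def mult_ac)
      then show ?thesis by (simp only: integral_mult_right_zero T_def fst_conv snd_conv)
    qed
    have dT: "integrable M2 (\<lambda>w. d w * T g w)"
    proof (rule P2.integrable_bounded[where c=a])
      show "\<bar>d w * T g w\<bar> \<le> a" for w
        using abs_mult_le[OF Tb[of w] db[of w]] by (simp add: mult.commute)
    qed measurable
    have 2: "(\<integral>x. \<integral>y. d (x, y) * T g (x, y) \<partial>M \<partial>M) = Q"
      unfolding Q_def by (rule P2.integral_fst'[OF dT])
    have "(\<integral>w. F1 w \<partial>M3) = (\<integral>x. \<integral>y. \<integral>z. F1 (x, y, z) \<partial>M \<partial>M \<partial>M)"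
      by (rule integral_M3_iterated[OF _ Fb(1)]) measurable
    then show ?thesis unfolding 1 2 .
  qed
  have Q2: "(\<integral>w. F2 w \<partial>M3) = Q"
  proof -
    have "F2 (x, z, y) = F1 (x, y, z)" for x y z
      using \<Delta>s(2)[of x y z] gs[of y z] by (simp add: F1_def F2_def mult_ac)
    then have "(\<integral>w. F2 w \<partial>M3) = (\<integral>(x, y, z). F1 (x, y, z) \<partial>M3)"
      using integral_M3_swap_23[of F2 a] Fb(2) by simp
    then show ?thesis using Q1 by (simp add: case_prod_unfold)
  qed
  have Q3: "(\<integral>w. F3 w \<partial>M3) = Q"
  proof -
    have "F3 (y, x, z) = F2 (x, y, z)" for x y z
      using \<Delta>s(1)[of x y z] gs[of x y] by (simp add: F3_def F2_def mult_ac)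
    then have "(\<integral>w. F3 w \<partial>M3) = (\<integral>(x, y, z). F2 (x, y, z) \<partial>M3)"
      using integral_M3_swap_12[of F3 a] Fb(3) by simp
    then show ?thesis using Q2 by (simp add: case_prod_unfold)
  qed
  define C where "C u = (\<integral>(x, y, z). \<Delta> (x, y, z) * (u (x, y) * u (x, z) * u (y, z)) \<partial>M3)"
    for u :: "'a \<times> 'a \<Rightarrow> real"
  have Cint: "integrable M3 (\<lambda>(x, y, z). \<Delta> (x, y, z) * (u (x, y) * u (x, z) * u (y, z)))"
    if u: "sym_kernel u" for u
  proof -
    note [measurable] = sym_kernelD(1)[OF u]
    show ?thesis unfolding case_prod_unfold
      by (intro P3.integrable_bounded[where c=a] abs_mult_le abs_mult_le_one \<Delta>b sym_kernelD(4)[OF u])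
        measurable
  qed
  define K where "K = (\<integral>w. I_fun (g w) - (g w * f w - ln (1 + exp (f w))) \<partial>M2)"
  note dual_int = integrable_dual[OF g fm fb]
  have "integrable M2 (\<lambda>w. d w * h w)" "integrable M2 (\<lambda>w. d w * T g w)"
    using abs_mult_le[OF hb db] abs_mult_le[OF Tb db]
    by (auto intro!: P2.integrable_bounded simp: mult.commute)
  note dint = this
  have ent_s: "entropy s = (\<integral>w. s w * f w - ln (1 + exp (f w)) \<partial>M2)"
    unfolding entropy_def s_def I_fun_logistic ..
  \<comment> \<open>This identifies \<open>K\<close> with twice the first-order gain available by
    moving from \<open>g\<close> towards \<open>s\<close>, the entropy being replaced by its
    chord.\<close>
  have K: "K = Q + (\<integral>w. d w * h w \<partial>M2) - entropy s + entropy g"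
  proof -
    have "Q + (\<integral>w. d w * h w \<partial>M2) = (\<integral>w. s w * f w - g w * f w \<partial>M2)"
      unfolding Q_def using dint
      by (subst Bochner_Integration.integral_add[symmetric])
        (auto intro!: Bochner_Integration.integral_cong simp: d_def f_def algebra_simps)
    also have "\<dots> = (\<integral>w. s w * f w \<partial>M2) - (\<integral>w. g w * f w \<partial>M2)"
      using dual_int(1) integrable_dual(1)[OF s fm fb] by simp
    finally show ?thesis
      unfolding K_def ent_s
      using dual_int integrable_dual(1)[OF s fm fb] integrable_I_fun[OF g]
      by (simp add: entropy_def)
  qed
  \<comment> \<open>Up to an error of at most 4 a t^2 / 6, the gain is at least t K / 2. Maximality
    makes the gain nonpositive, and dividing by t / 2 gives the constant 4/3.\<close>
  have main: "K \<le> 4/3 * a * t" if t: "0 < t" "t < 1" for t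
  proof -
    define gt where "gt w = g w + t * d w" for w
    have gt: "sym_kernel gt"
      unfolding sym_kernel_def
    proof (intro conjI allI)
      show "gt \<in> borel_measurable M2" unfolding gt_def by measurable
      show "gt (x, y) = gt (y, x)" for x y using ds gs by (simp add: gt_def)
      fix w
      have conv: "gt w = (1 - t) * g w + t * s w" by (simp add: gt_def d_def algebra_simps)
      have terms: "(1 - t) * g w \<le> 1 - t" "t * s w \<le> t" "0 \<le> (1 - t) * g w" "0 \<le> t * s w"
        using t g01(1,2)[of w] sym_kernelD(2,3)[OF s, of w] by (auto intro!: mult_left_le)
      show "0 \<le> gt w" using conv terms by linarith
      show "gt w \<le> 1" using conv terms by linarith
    qed
    have cubic: "C g + 3 * t * Q - 4 * a * t\<^sup>2 \<le> C gt"
    proof -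
      \<comment> \<open>All terms of order at least two in \<open>t\<close>, divided by t^2; the
        cubic one therefore keeps a factor \<open>t\<close>. Each of the four summands is bounded by
        1, whence the bound 4 a.\<close>
      define R where "R = (\<lambda>(x, y, z). \<Delta> (x, y, z) * (d (x, y) * d (x, z) * g (y, z) +
        d (x, y) * g (x, z) * d (y, z) + g (x, y) * d (x, z) * d (y, z) +
        t * (d (x, y) * d (x, z) * d (y, z))))"
      have [measurable]: "R \<in> borel_measurable M3" unfolding R_def by measurable
      have Rb: "\<bar>R w\<bar> \<le> a * 4" for w
      proof -
        obtain x y z where w: "w = (x, y, z)" by (cases w)
        have "\<bar>d (x, y) * d (x, z) * g (y, z)\<bar> \<le> 1" "\<bar>d (x, y) * g (x, z) * d (y, z)\<bar> \<le> 1"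
          "\<bar>g (x, y) * d (x, z) * d (y, z)\<bar> \<le> 1" "\<bar>t * (d (x, y) * d (x, z) * d (y, z))\<bar> \<le> 1"
          using t by (intro abs_mult_le_one db g01; simp)+
        then have "\<bar>d (x, y) * d (x, z) * g (y, z) +
          d (x, y) * g (x, z) * d (y, z) + g (x, y) * d (x, z) * d (y, z) +
          t * (d (x, y) * d (x, z) * d (y, z))\<bar> \<le> 4" by linarith
        then show ?thesis
          unfolding w R_def prod.case abs_mult using \<Delta>b[of "(x, y, z)"] by (intro mult_mono) auto
      qed
      have Rint: "integrable M3 R" by (rule P3.integrable_bounded[OF _ Rb]) measurable
      have pt: "\<Delta> (x, y, z) * (gt (x, y) * gt (x, z) * gt (y, z)) =
        \<Delta> (x, y, z) * (g (x, y) * g (x, z) * g (y, z)) +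
        (t * (F1 (x, y, z) + F2 (x, y, z) + F3 (x, y, z)) + t\<^sup>2 * R (x, y, z))" for x y z
        unfolding gt_def F1_def F2_def F3_def R_def prod.case by algebra
      have "C gt = (\<integral>w. (case w of (x, y, z) \<Rightarrow> \<Delta> (x, y, z) * (g (x, y) * g (x, z) * g (y, z))) +
        (t * (F1 w + F2 w + F3 w) + t\<^sup>2 * R w) \<partial>M3)"
        unfolding C_def by (rule Bochner_Integration.integral_cong) (use pt in auto)
      also have "\<dots> = C g + (t * (Q + Q + Q) + t\<^sup>2 * (\<integral>w. R w \<partial>M3))"
        unfolding C_def using Cint[OF g] Fint Rint Q1 Q2 Q3 by simp
      also have "\<dots> \<ge> C g + (t * (Q + Q + Q) + t\<^sup>2 * (- (a * 4)))"
        using P3.abs_integral_bounded[of R "a * 4"] Rb by (intro add_left_mono mult_left_mono) auto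
      finally show ?thesis by (simp add: algebra_simps)
    qed
    have lin: "(\<integral>w. h w * gt w \<partial>M2) = (\<integral>w. h w * g w \<partial>M2) + t * (\<integral>w. d w * h w \<partial>M2)"
    proof -
      have "integrable M2 (\<lambda>w. h w * g w)"
        by (intro P2.integrable_bounded[where c=c] abs_mult_le hb g01) measurable
      moreover have "h w * gt w = h w * g w + t * (d w * h w)" for w
        by (simp add: gt_def algebra_simps)
      ultimately show ?thesis using dint(1) by simp
    qed
    have "entropy gt \<le> (\<integral>w. I_fun (g w) + t * (I_fun (s w) - I_fun (g w)) \<partial>M2)"
      unfolding entropy_def
    proof (rule integral_mono)
      show "I_fun (gt w) \<le> I_fun (g w) + t * (I_fun (s w) - I_fun (g w))" for w
        unfolding gt_def d_def s_def using t g01 by (intro I_fun_convex_logistic) auto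
    qed (use integrable_I_fun[OF g] integrable_I_fun[OF s] integrable_I_fun[OF gt] in auto)
    also have "\<dots> = entropy g + t * (entropy s - entropy g)"
      unfolding entropy_def using integrable_I_fun[OF g] integrable_I_fun[OF s] by simp
    finally have "t * K \<le> t * (4/3 * a * t)"
      using cubic lin max[OF gt] unfolding J_def C_def[symmetric] K
      by (simp add: algebra_simps power2_eq_square)
    then show ?thesis using t by simp
  qed
  have "K \<le> 0"
  proof (rule field_le_epsilon)
    fix e :: real assume e: "0 < e"
    have a: "0 \<le> a" using \<Delta>b[of undefined] by linarith
    \<comment> \<open>Adding 1 keeps the denominator positive when \<open>a\<close> is 0, and the
      cap 1/2 ensures that \<open>t\<close> is admissible.\<close>
    define t where "t = min (1/2) (e / (4/3 * a + 1))"
    have t: "0 < t" "t < 1" using e a by (auto simp: t_def)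
    have "4/3 * a * t \<le> (4/3 * a + 1) * (e / (4/3 * a + 1))"
      using a e by (intro mult_mono) (auto simp: t_def)
    also have "\<dots> = e" using a by simp
    finally show "K \<le> 0 + e" using main[OF t] by simp
  qed
  have nonneg: "0 \<le> I_fun (g w) - (g w * f w - ln (1 + exp (f w)))" for w
    using I_fun_ge[OF g01(1,2), of w "f w"] by simp
  moreover have int: "integrable M2 (\<lambda>w. I_fun (g w) - (g w * f w - ln (1 + exp (f w))))"
    using dual_int integrable_I_fun[OF g] by auto
  ultimately have "K = 0"
    using \<open>K \<le> 0\<close> unfolding K_def by (intro antisym integral_nonneg) auto
  then have "AE w in M2. I_fun (g w) - (g w * f w - ln (1 + exp (f w))) = 0"
    unfolding K_def using integral_nonneg_eq_0_iff_AE[OF int] nonneg by auto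
  then show ?thesis
  proof eventually_elim
    case (elim w)
    then show ?case using I_fun_eq_imp[OF g01(1,2), of w "f w"] by (simp add: f_def)
  qed
qed

end

section \<open>Graphons on the unit interval\<close>

lemma measurable_completion_cong_AE:
  assumes f0: "f0 \<in> measurable N L" and ae: "AE x in N. f x = f0 x" and sp: "\<And>x. x \<in> space N \<Longrightarrow> f x \<in> space L"
  shows "f \<in> measurable (completion N) L"
proof (rule measurableI)
  fix A assume A: "A \<in> sets L"
  show "f -` A \<inter> space (completion N) \<in> sets (completion N)"
  proof (rule completion.in_sets_AE[where A="f0 -` A \<inter> space N"])
    show "AE x in completion N. x \<in> f0 -` A \<inter> space N \<longleftrightarrow> x \<in> f -` A \<inter> space (completion N)"
      using AE_completion[OF ae] by eventually_elim auto
  qed (use measurable_sets[OF f0 A] in auto)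
qed (use sp in auto)

text \<open>Since \<open>lebesgue\<close> is the completion of \<open>lborel\<close>, this turns the
  Lebesgue integrals in the definitions, and those over completed finite products, into Borel
  integrals of an almost everywhere equal function.\<close>

lemma integral_completion_cong_AE:
  fixes f :: "'a \<Rightarrow> 'b::{banach, second_countable_topology}"
  assumes f0: "f0 \<in> borel_measurable N" and ae: "AE x in N. f x = f0 x"
  shows "integral\<^sup>L (completion N) f = integral\<^sup>L N f0"
proof -
  have "integral\<^sup>L (completion N) f = integral\<^sup>L (completion N) f0"
    using measurable_completion_cong_AE[OF f0 ae] measurable_completion[OF f0] AE_completion[OF ae]
    by (intro integral_cong_AE) auto
  then show ?thesis by (simp add: integral_completion f0)
qed

text \<open>A density on the whole line instead of a restricted space: the underlying space stays
  \<open>UNIV\<close> and the measurable sets are exactly the Borel sets, also for the products with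
  two and three factors.\<close>

definition unit_measure :: "real measure" where
  "unit_measure = density lborel (indicator {0..1})"

lemma sets_unit_measure[simp, measurable_cong]: "sets unit_measure = sets borel"
  and space_unit_measure[simp]: "space unit_measure = UNIV"
  by (simp_all add: unit_measure_def)

interpretation unit: graphon_space unit_measure
proof -
  have "emeasure unit_measure UNIV = 1"
    unfolding unit_measure_def by (subst emeasure_density) auto
  then interpret prob_space unit_measure by (intro prob_spaceI) simp
  show "graphon_space unit_measure" by unfold_locales
qed

abbreviation "unit2 \<equiv> unit_measure \<Otimes>\<^sub>M unit_measure"
abbreviation "unit3 \<equiv> unit_measure \<Otimes>\<^sub>M unit2"
abbreviation "square \<equiv> {0..1::real} \<times> {0..1::real}"
abbreviation "cube \<equiv> {0..1::real} \<times> {0..1::real} \<times> {0..1::real}"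

lemma square_borel[measurable]: "square \<in> sets borel"
  by (intro borel_closed closed_Times) auto

lemma cube_borel[measurable]: "cube \<in> sets borel"
  by (intro borel_closed closed_Times) auto

lemma unit2_eq: "unit2 = density lborel (indicator square)"
proof -
  have "unit2 = density (lborel \<Otimes>\<^sub>M lborel) (\<lambda>(x, y). indicator {0..1} x * indicator {0..1} y)"
    unfolding unit_measure_def
    by (rule pair_measure_density)
      (auto simp: lborel.sigma_finite_measure_axioms unit.sigma_finite_measure_axioms simp flip: unit_measure_def)
  also have "(\<lambda>(x, y). indicator {0..1} x * indicator {0..1} y) = (indicator square :: _ \<Rightarrow> ennreal)"
    by (auto simp: indicator_def)
  finally show ?thesis by (simp add: lborel_prod)
qed

lemma unit3_eq: "unit3 = density lborel (indicator cube)"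
proof -
  have "unit3 = density (lborel \<Otimes>\<^sub>M lborel) (\<lambda>(x, w). indicator {0..1} x * indicator square w)"
    unfolding unit2_eq unfolding unit_measure_def
    by (rule pair_measure_density)
      (auto simp: lborel.sigma_finite_measure_axioms unit.P2.sigma_finite_measure_axioms intro!: borel_measurable_indicator simp flip: unit2_eq)
  also have "(\<lambda>(x, w). indicator {0..1} x * indicator square w) = (indicator cube :: _ \<Rightarrow> ennreal)"
    by (auto simp: indicator_def)
  finally show ?thesis by (simp add: lborel_prod)
qed

lemma space_unit2[simp]: "space unit2 = UNIV" and space_unit3[simp]: "space unit3 = UNIV"
  by (simp_all add: space_pair_measure)

lemma sets_unit2[simp]: "sets unit2 = sets borel"
  using sets_pair_measure_cong[OF sets_unit_measure sets_unit_measure] unfolding borel_prod .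

lemma sets_unit3[simp]: "sets unit3 = sets borel"
  using sets_pair_measure_cong[OF sets_unit_measure sets_unit2] unfolding borel_prod .

lemma measurable_unit2_iff: "f \<in> measurable unit2 N \<longleftrightarrow> f \<in> measurable borel N"
  using measurable_cong_sets[OF sets_unit2 refl] by blast

lemma measurable_unit3_iff: "f \<in> measurable unit3 N \<longleftrightarrow> f \<in> measurable borel N"
  using measurable_cong_sets[OF sets_unit3 refl] by blast

lemma AE_unit: "(AE x in unit_measure. P x) \<longleftrightarrow> (AE x in lborel. x \<in> {0..1} \<longrightarrow> P x)"
  unfolding unit_measure_def by (subst AE_density) (auto simp: indicator_def)

lemma AE_unit2: "(AE w in unit2. P w) \<longleftrightarrow> (AE w in lborel. w \<in> square \<longrightarrow> P w)"
  unfolding unit2_eq by (subst AE_density) (auto simp: indicator_def intro!: borel_measurable_indicator)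

lemma AE_unit3: "(AE w in unit3. P w) \<longleftrightarrow> (AE w in lborel. w \<in> cube \<longrightarrow> P w)"
  unfolding unit3_eq by (subst AE_density) (auto simp: indicator_def intro!: borel_measurable_indicator)

lemma AE_lebesgue_on_square: "(AE w in lebesgue_on square. P w) \<longleftrightarrow> (AE w in unit2. P w)"
  using square_borel by (subst AE_restrict_space_iff) (simp_all add: AE_completion_iff AE_unit2)

lemma integral_density_indicator:
  fixes f :: "'a \<Rightarrow> real"
  assumes "f \<in> borel_measurable N" "A \<in> sets N"
  shows "integral\<^sup>L (density N (indicator A)) f = (\<integral>x. indicator A x * f x \<partial>N)"
  using integral_density[of f N "indicator A"] assms by (simp add: ennreal_indicator)

lemma integral_unit_measure:
  fixes f :: "real \<Rightarrow> real"
  assumes "f \<in> borel_measurable borel"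
  shows "(\<integral>x. f x \<partial>unit_measure) = (\<integral>x. indicator {0..1} x * f x \<partial>lborel)"
  unfolding unit_measure_def using assms by (intro integral_density_indicator) auto

lemma set_integral_lebesgue_square:
  fixes f :: "real \<times> real \<Rightarrow> real"
  assumes [measurable]: "A \<in> sets borel" and A: "A \<subseteq> square" and [measurable]: "f0 \<in> borel_measurable borel"
    and ae: "AE w in unit2. w \<in> A \<longrightarrow> f w = f0 w"
  shows "(LINT w:A|lebesgue. f w) = (\<integral>w. indicator A w * f0 w \<partial>unit2)"
proof -
  have "(LINT w:A|lebesgue. f w) = (\<integral>w. indicator square w * (indicator A w * f0 w) \<partial>lborel)"
    unfolding set_lebesgue_integral_def
  proof (rule integral_completion_cong_AE)
    show "AE w in lborel. indicator A w *\<^sub>R f w = indicator square w * (indicator A w * f0 w)"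
      using ae unfolding AE_unit2 by eventually_elim (use A in \<open>auto simp: indicator_def\<close>)
    show "(\<lambda>w. indicator square w * (indicator A w * f0 w)) \<in> borel_measurable lborel"
      by (intro borel_measurable_times borel_measurable_indicator) auto
  qed
  also have "\<dots> = (\<integral>w. indicator A w * f0 w \<partial>unit2)"
    unfolding unit2_eq by (rule integral_density_indicator[symmetric]) auto
  finally show ?thesis .
qed

section \<open>Borel representatives of graphons\<close>

definition represents :: "(real \<times> real \<Rightarrow> real) \<Rightarrow> graphon \<Rightarrow> bool" where
  "represents g0 g \<longleftrightarrow> unit.sym_kernel g0 \<and> (AE w in unit2. g (fst w) (snd w) = g0 w)"

text \<open>A Borel version of the graphon may lose symmetry and bounds on a null set. Averaging it
  with its transpose and clamping to [0,1] restores both everywhere and changes nothing at almost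
  every point of the square.\<close>

lemma graphon_represented:
  assumes "g \<in> graphons"
  shows "\<exists>g0. represents g0 g"
proof -
  have m: "(\<lambda>(x, y). g x y) \<in> borel_measurable (lebesgue_on square)"
    and sym: "\<And>x y. x \<in> {0..1} \<Longrightarrow> y \<in> {0..1} \<Longrightarrow> g x y = g y x \<and> 0 \<le> g x y \<and> g x y \<le> 1"
    using assms by (auto simp: graphons_def)
  from m have "(\<lambda>w. indicator square w *\<^sub>R (case w of (x, y) \<Rightarrow> g x y)) \<in> borel_measurable lebesgue"
    using square_borel by (subst (asm) borel_measurable_restrict_space_iff) auto
  then obtain f where f: "f \<in> borel_measurable lborel"
    and fae: "AE w in lborel. indicator square w *\<^sub>R (case w of (x, y) \<Rightarrow> g x y) = f w"
    using completion_ex_borel_measurable_real by blast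
  have [measurable]: "f \<in> borel_measurable unit2" using f by (simp add: measurable_unit2_iff)
  define g0 where "g0 w = max 0 (min 1 ((f w + f (snd w, fst w)) / 2))" for w
  have "unit.sym_kernel g0"
    unfolding unit.sym_kernel_def
  proof (intro conjI allI)
    show "g0 \<in> borel_measurable unit2" unfolding g0_def by measurable
  qed (auto simp: g0_def add.commute)
  moreover have ae: "AE w in unit2. w \<in> square \<and> g (fst w) (snd w) = f w"
    using fae unfolding AE_unit2 by eventually_elim auto
  have "AE w in unit2. g (fst w) (snd w) = g0 w"
    using ae unit.AE_M2_swap[OF ae]
  proof eventually_elim
    case (elim w)
    obtain x y where w: "w = (x, y)" by (cases w)
    have xy: "x \<in> {0..1}" "y \<in> {0..1}" and "f (x, y) = g x y" "f (y, x) = g y x"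
      using elim by (simp_all add: w)
    then have "g0 w = max 0 (min 1 (g x y))"
      using conjunct1[OF sym[OF xy]] by (simp add: g0_def w)
    then show ?case using conjunct2[OF sym[OF xy]] by (simp add: w)
  qed
  ultimately show ?thesis by (auto simp: represents_def)
qed

text \<open>The converse direction, by which every Borel kernel can serve as a competitor in the
  maximization.\<close>

lemma sym_kernel_graphon:
  assumes "unit.sym_kernel g0"
  shows "(\<lambda>x y. g0 (x, y)) \<in> graphons" "represents g0 (\<lambda>x y. g0 (x, y))"
proof -
  have "g0 \<in> borel_measurable lborel"
    using unit.sym_kernelD(1)[OF assms] by (simp add: measurable_unit2_iff)
  then have "(\<lambda>(x, y). g0 (x, y)) \<in> borel_measurable (lebesgue_on square)"
    by (intro measurable_restrict_space1 measurable_completion) simp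
  then show "(\<lambda>x y. g0 (x, y)) \<in> graphons"
    using unit.sym_kernelD[OF assms] by (auto simp: graphons_def)
  show "represents g0 (\<lambda>x y. g0 (x, y))" using assms by (simp add: represents_def)
qed

lemma interval_partition_facts:
  assumes "interval_partition k b B"
  shows "\<And>i. i < k \<Longrightarrow> B i \<in> sets borel" "\<And>i. i < k \<Longrightarrow> B i \<subseteq> {0..1}"
    and "\<And>x. x \<in> {0..1} \<Longrightarrow> (\<Sum>i<k. indicator (B i) x) = (1 :: real)"
proof -
  show "\<And>i. i < k \<Longrightarrow> B i \<in> sets borel"
    using assms by (auto simp: interval_partition_def intro!: real_interval_borel_measurable)
  have U: "(\<Union>i<k. B i) = {0..1}" and d: "disjoint_family_on B {..<k}"
    using assms by (auto simp: interval_partition_def)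
  show "\<And>i. i < k \<Longrightarrow> B i \<subseteq> {0..1}" using U by auto
  fix x :: real assume "x \<in> {0..1}"
  then obtain i where i: "i < k" "x \<in> B i" using U by blast
  have "(\<Sum>j<k. indicator (B j) x) = (\<Sum>j<k. if j = i then 1 else 0 :: real)"
  proof (rule sum.cong[OF refl])
    fix j assume j: "j \<in> {..<k}"
    show "indicator (B j) x = (if j = i then 1 else 0 :: real)"
      using i j disjoint_family_onD[OF d, of i j] by (auto simp: indicator_def)
  qed
  then show "(\<Sum>i<k. indicator (B i) x) = (1 :: real)" using i by simp
qed

lemma AE_unit2_square: "AE w in unit2. w \<in> square"
  by (simp add: AE_unit2)

lemma representsD:
  assumes "represents g0 g"
  shows "unit.sym_kernel g0" "AE w in unit2. g (fst w) (snd w) = g0 w"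
  using assms by (auto simp: represents_def)

text \<open>The sum of the block indicators factors into two sums over colours, and each of them is
  1 on the unit interval.\<close>

lemma sum_integral_color_blocks:
  assumes part: "interval_partition k b B" and f: "f \<in> borel_measurable borel" "\<And>w. \<bar>f w\<bar> \<le> (c :: real)"
  shows "(\<Sum>i<k. \<Sum>j<k. \<integral>w. indicator (B i \<times> B j) w * f w \<partial>unit2) = (\<integral>w. f w \<partial>unit2)"
proof -
  note B = interval_partition_facts[OF part]
  have int: "integrable unit2 (\<lambda>w. indicator (B i \<times> B j) w * f w)" if "i < k" "j < k" for i j
  proof (rule unit.P2.integrable_bounded[where c=c])
    show "(\<lambda>w. indicator (B i \<times> B j) w * f w) \<in> borel_measurable unit2"
      unfolding measurable_unit2_iff
      by (intro borel_measurable_times borel_measurable_indicator borel_Times B that f)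
    show "\<bar>indicator (B i \<times> B j) w * f w\<bar> \<le> c" for w
      using f(2)[of w] by (auto simp: indicator_def)
  qed
  have "(\<Sum>i<k. \<Sum>j<k. \<integral>w. indicator (B i \<times> B j) w * f w \<partial>unit2) =
      (\<Sum>i<k. \<integral>w. (\<Sum>j<k. indicator (B i \<times> B j) w * f w) \<partial>unit2)"
    using int by (intro sum.cong refl Bochner_Integration.integral_sum[symmetric]) auto
  also have "\<dots> = (\<integral>w. (\<Sum>i<k. \<Sum>j<k. indicator (B i \<times> B j) w * f w) \<partial>unit2)"
    using int by (intro Bochner_Integration.integral_sum[symmetric] Bochner_Integration.integrable_sum) auto
  also have "\<dots> = (\<integral>w. f w \<partial>unit2)"
  proof (rule integral_cong_AE)
    show "(\<lambda>w. \<Sum>i<k. \<Sum>j<k. indicator (B i \<times> B j) w * f w) \<in> borel_measurable unit2"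
      using int by (intro borel_measurable_sum) (auto dest: borel_measurable_integrable)
    show "f \<in> borel_measurable unit2" using f by (simp add: measurable_unit2_iff)
    show "AE w in unit2. (\<Sum>i<k. \<Sum>j<k. indicator (B i \<times> B j) w * f w) = f w"
      using AE_unit2_square
    proof eventually_elim
      case (elim w)
      have "(\<Sum>i<k. \<Sum>j<k. indicator (B i \<times> B j) w * f w) =
        (\<Sum>i<k. indicator (B i) (fst w)) * (\<Sum>j<k. indicator (B j) (snd w)) * f w"
        unfolding indicator_times sum_product by (simp only: sum_distrib_right)
      also have "\<dots> = f w" using elim B(3)[of "fst w"] B(3)[of "snd w"] by (cases w) auto
      finally show ?case .
    qed
  qed
  finally show ?thesis .
qed

lemma entropy_functional_eq:
  assumes part: "interval_partition k b B" and rep: "represents g0 g"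
  shows "entropy_functional k B g = unit.entropy g0"
proof -
  note B = interval_partition_facts[OF part]
  note g0 = representsD(1)[OF rep]
  have [measurable]: "g0 \<in> borel_measurable borel"
    using unit.sym_kernelD(1)[OF g0] by (simp add: measurable_unit2_iff)
  have Im: "(\<lambda>w. I_fun (g0 w)) \<in> borel_measurable borel" by measurable
  have "(LINT w:B i \<times> B j|lebesgue. case w of (x, y) \<Rightarrow> I_fun (g x y)) =
      (\<integral>w. indicator (B i \<times> B j) w * I_fun (g0 w) \<partial>unit2)" if "i < k" "j < k" for i j
  proof (rule set_integral_lebesgue_square[OF borel_Times[OF B(1)[OF that(1)] B(1)[OF that(2)]] _ Im])
    show "B i \<times> B j \<subseteq> square" using B(2)[OF that(1)] B(2)[OF that(2)] by auto
    show "AE w in unit2. w \<in> B i \<times> B j \<longrightarrow> (case w of (x, y) \<Rightarrow> I_fun (g x y)) = I_fun (g0 w)"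
      using representsD(2)[OF rep] by eventually_elim (auto simp: case_prod_unfold)
  qed
  then have "entropy_functional k B g = (\<Sum>i<k. \<Sum>j<k. \<integral>w. indicator (B i \<times> B j) w * I_fun (g0 w) \<partial>unit2)"
    unfolding entropy_functional_def by (intro sum.cong refl) auto
  also have "\<dots> = unit.entropy g0"
    unfolding unit.entropy_def
    using I_fun_abs_le[OF unit.sym_kernelD(2,3)[OF g0]] by (rule sum_integral_color_blocks[OF part Im])
  finally show ?thesis .
qed

section \<open>Subgraph densities as integrals over the square and the cube\<close>

interpretation lborels: product_sigma_finite "\<lambda>_ :: nat. lborel :: real measure"
  by unfold_locales

lemma lessThan_2_3: "{..<2 :: nat} = {0, 1}" "{..<3 :: nat} = {0, 1, 2}"
  by auto

text \<open>The identification of pairs with points of the finite product measure, whose elements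
  are extensional functions; hence the restriction to \<open>{..<2}\<close>.\<close>

definition vec2 :: "real \<times> real \<Rightarrow> nat \<Rightarrow> real" where
  "vec2 w = (\<lambda>v\<in>{..<2}. if v = 0 then fst w else snd w)"

definition vec3 :: "real \<times> real \<times> real \<Rightarrow> nat \<Rightarrow> real" where
  "vec3 w = (\<lambda>v\<in>{..<3}. if v = 0 then fst w else if v = 1 then fst (snd w) else snd (snd w))"

lemma vec2_apply: "vec2 w 0 = fst w" "vec2 w 1 = snd w"
  by (simp_all add: vec2_def)

lemma vec3_apply: "vec3 w 0 = fst w" "vec3 w 1 = fst (snd w)" "vec3 w 2 = snd (snd w)"
  by (simp_all add: vec3_def)

lemma vec2_measurable[measurable]: "vec2 \<in> measurable lborel (\<Pi>\<^sub>M v\<in>{..<2}. lborel)"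
proof -
  have "vec2 \<in> measurable (lborel \<Otimes>\<^sub>M lborel) (\<Pi>\<^sub>M v\<in>{..<2}. lborel)"
    unfolding vec2_def by measurable
  then show ?thesis by (simp add: lborel_prod)
qed

lemma vec3_measurable[measurable]: "vec3 \<in> measurable lborel (\<Pi>\<^sub>M v\<in>{..<3}. lborel)"
proof -
  have "vec3 \<in> measurable (lborel \<Otimes>\<^sub>M (lborel \<Otimes>\<^sub>M lborel)) (\<Pi>\<^sub>M v\<in>{..<3}. lborel)"
    unfolding vec3_def by measurable
  then show ?thesis by (simp add: lborel_prod)
qed

lemma vec2_in_PiE: "vec2 w \<in> Pi\<^sub>E {..<2} A \<longleftrightarrow> fst w \<in> A 0 \<and> snd w \<in> A 1"
  unfolding vec2_def restrict_PiE_iff lessThan_2_3 by simp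

lemma vec3_in_PiE: "vec3 w \<in> Pi\<^sub>E {..<3} A \<longleftrightarrow> fst w \<in> A 0 \<and> fst (snd w) \<in> A 1 \<and> snd (snd w) \<in> A 2"
  unfolding vec3_def restrict_PiE_iff lessThan_2_3 by simp

lemma emeasure_lborel_Times:
  fixes A :: "'a::euclidean_space set" and C :: "'b::euclidean_space set"
  assumes "A \<in> sets borel" "C \<in> sets borel"
  shows "emeasure lborel (A \<times> C) = emeasure lborel A * emeasure lborel C"
  unfolding lborel_prod[symmetric] using assms by (intro lborel.emeasure_pair_measure_Times) auto

lemma distr_vec2: "distr lborel (\<Pi>\<^sub>M v\<in>{..<2}. lborel) vec2 = (\<Pi>\<^sub>M v\<in>{..<2}. lborel)"
proof (rule lborels.PiM_eqI)
  fix A :: "nat \<Rightarrow> real set" assume A: "\<And>i. i \<in> {..<2} \<Longrightarrow> A i \<in> sets lborel"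
  have Ab: "A 0 \<in> sets borel" "A 1 \<in> sets borel" using A[of 0] A[of 1] by auto
  have "vec2 -` Pi\<^sub>E {..<2} A \<inter> space lborel = A 0 \<times> A 1"
    by (rule set_eqI) (simp only: vimage_eq Int_iff vec2_in_PiE mem_Times_iff space_lborel space_borel UNIV_I simp_thms)
  moreover have "Pi\<^sub>E {..<2} A \<in> sets (\<Pi>\<^sub>M v\<in>{..<2}. lborel)"
    using A by (intro sets_PiM_I_finite) auto
  ultimately have "emeasure (distr lborel (\<Pi>\<^sub>M v\<in>{..<2}. lborel) vec2) (Pi\<^sub>E {..<2} A) =
      emeasure lborel (A 0 \<times> A 1)"
    by (simp add: emeasure_distr)
  also have "\<dots> = emeasure lborel (A 0) * emeasure lborel (A 1)"
    using Ab by (simp add: emeasure_lborel_Times)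
  also have "\<dots> = (\<Prod>i\<in>{..<2}. emeasure lborel (A i))"
    by (simp add: lessThan_2_3)
  finally show "emeasure (distr lborel (\<Pi>\<^sub>M v\<in>{..<2}. lborel) vec2) (Pi\<^sub>E {..<2} A) =
      (\<Prod>i\<in>{..<2}. emeasure lborel (A i))" .
qed auto

lemma distr_vec3: "distr lborel (\<Pi>\<^sub>M v\<in>{..<3}. lborel) vec3 = (\<Pi>\<^sub>M v\<in>{..<3}. lborel)"
proof (rule lborels.PiM_eqI)
  fix A :: "nat \<Rightarrow> real set" assume A: "\<And>i. i \<in> {..<3} \<Longrightarrow> A i \<in> sets lborel"
  have Ab: "A 0 \<in> sets borel" "A 1 \<in> sets borel" "A 2 \<in> sets borel"
    using A[of 0] A[of 1] A[of 2] by auto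
  have "vec3 -` Pi\<^sub>E {..<3} A \<inter> space lborel = A 0 \<times> A 1 \<times> A 2"
    by (rule set_eqI) (simp only: vimage_eq Int_iff vec3_in_PiE mem_Times_iff space_lborel space_borel UNIV_I simp_thms)
  moreover have "Pi\<^sub>E {..<3} A \<in> sets (\<Pi>\<^sub>M v\<in>{..<3}. lborel)"
    using A by (intro sets_PiM_I_finite) auto
  ultimately have "emeasure (distr lborel (\<Pi>\<^sub>M v\<in>{..<3}. lborel) vec3) (Pi\<^sub>E {..<3} A) =
      emeasure lborel (A 0 \<times> A 1 \<times> A 2)"
    by (simp add: emeasure_distr)
  also have "\<dots> = emeasure lborel (A 0) * (emeasure lborel (A 1) * emeasure lborel (A 2))"
    using Ab by (simp add: emeasure_lborel_Times borel_Times)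
  also have "\<dots> = (\<Prod>i\<in>{..<3}. emeasure lborel (A i))"
    by (simp add: lessThan_2_3)
  finally show "emeasure (distr lborel (\<Pi>\<^sub>M v\<in>{..<3}. lborel) vec3) (Pi\<^sub>E {..<3} A) =
      (\<Prod>i\<in>{..<3}. emeasure lborel (A i))" .
qed auto

text \<open>The integral over the completed product is moved to its uncompleted version by replacing
  \<open>F\<close> with \<open>F0\<close>, then to the plane by \<open>vec2\<close>. As the colour
  classes lie in the unit interval, Lebesgue measure may be replaced by
  \<open>unit2\<close>.\<close>

lemma density_two_vertices:
  fixes f :: "real \<times> real \<Rightarrow> real" and F :: "(nat \<Rightarrow> real) \<Rightarrow> real"
  assumes A: "\<And>v. v < 2 \<Longrightarrow> A v \<in> sets borel" "\<And>v. v < 2 \<Longrightarrow> A v \<subseteq> {0..1}"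
    and F0[measurable]: "F0 \<in> borel_measurable (\<Pi>\<^sub>M v\<in>{..<2}. lborel)"
    and ae: "AE x in (\<Pi>\<^sub>M v\<in>{..<2}. lborel). x \<in> Pi\<^sub>E {..<2} A \<longrightarrow> F x = F0 x"
    and f: "f \<in> borel_measurable borel" "\<And>w. F0 (vec2 w) = f w"
  shows "(LINT x:Pi\<^sub>E {..<2} A|completion (\<Pi>\<^sub>M v\<in>{..<2}. lborel). F x) =
    (\<integral>w. indicator (A 0) (fst w) * indicator (A 1) (snd w) * f w \<partial>unit2)"
proof -
  have PA[measurable]: "Pi\<^sub>E {..<2} A \<in> sets (\<Pi>\<^sub>M v\<in>{..<2}. lborel)"
    using A(1) by (intro sets_PiM_I_finite) auto
  define S where "S = A 0 \<times> A 1"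
  have S: "S \<in> sets borel" "S \<subseteq> square"
    unfolding S_def using A(2)[of 0] A(2)[of 1] by (intro borel_Times A Sigma_mono; simp)+
  have "(LINT x:Pi\<^sub>E {..<2} A|completion (\<Pi>\<^sub>M v\<in>{..<2}. lborel). F x) =
      (\<integral>x. indicator (Pi\<^sub>E {..<2} A) x * F0 x \<partial>(\<Pi>\<^sub>M v\<in>{..<2}. lborel))"
    unfolding set_lebesgue_integral_def
    by (rule integral_completion_cong_AE, intro borel_measurable_times borel_measurable_indicator PA F0,
      use ae in eventually_elim) (simp add: indicator_def)
  also have "\<dots> = (\<integral>w. indicator (Pi\<^sub>E {..<2} A) (vec2 w) * F0 (vec2 w) \<partial>lborel)"
    by (subst distr_vec2[symmetric],
      rule integral_distr[OF vec2_measurable borel_measurable_times[OF borel_measurable_indicator[OF PA] F0]])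
  also have "\<dots> = (\<integral>w. indicator square w * (indicator S w * f w) \<partial>lborel)"
  proof (rule Bochner_Integration.integral_cong[OF refl])
    fix w
    have "vec2 w \<in> Pi\<^sub>E {..<2} A \<longleftrightarrow> w \<in> S"
      unfolding S_def vec2_in_PiE mem_Times_iff ..
    then show "indicator (Pi\<^sub>E {..<2} A) (vec2 w) * F0 (vec2 w) = indicator square w * (indicator S w * f w)"
      using subsetD[OF S(2), of w] by (simp add: f(2) indicator_def)
  qed
  also have "\<dots> = (\<integral>w. indicator S w * f w \<partial>unit2)"
    unfolding unit2_eq
    by (rule integral_density_indicator[symmetric])
      (auto intro!: borel_measurable_times borel_measurable_indicator S f)
  finally show ?thesis unfolding S_def indicator_times .
qed

lemma density_three_vertices:
  fixes f :: "real \<times> real \<times> real \<Rightarrow> real" and F :: "(nat \<Rightarrow> real) \<Rightarrow> real"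
  assumes A: "\<And>v. v < 3 \<Longrightarrow> A v \<in> sets borel" "\<And>v. v < 3 \<Longrightarrow> A v \<subseteq> {0..1}"
    and F0[measurable]: "F0 \<in> borel_measurable (\<Pi>\<^sub>M v\<in>{..<3}. lborel)"
    and ae: "AE x in (\<Pi>\<^sub>M v\<in>{..<3}. lborel). x \<in> Pi\<^sub>E {..<3} A \<longrightarrow> F x = F0 x"
    and f: "f \<in> borel_measurable borel" "\<And>w. F0 (vec3 w) = f w"
  shows "(LINT x:Pi\<^sub>E {..<3} A|completion (\<Pi>\<^sub>M v\<in>{..<3}. lborel). F x) =
    (\<integral>w. indicator (A 0) (fst w) * indicator (A 1) (fst (snd w)) * indicator (A 2) (snd (snd w)) * f w \<partial>unit3)"
proof -
  have PA[measurable]: "Pi\<^sub>E {..<3} A \<in> sets (\<Pi>\<^sub>M v\<in>{..<3}. lborel)"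
    using A(1) by (intro sets_PiM_I_finite) auto
  define S where "S = A 0 \<times> A 1 \<times> A 2"
  have S: "S \<in> sets borel" "S \<subseteq> cube"
    unfolding S_def using A(2)[of 0] A(2)[of 1] A(2)[of 2] by (intro borel_Times A Sigma_mono; simp)+
  have "(LINT x:Pi\<^sub>E {..<3} A|completion (\<Pi>\<^sub>M v\<in>{..<3}. lborel). F x) =
      (\<integral>x. indicator (Pi\<^sub>E {..<3} A) x * F0 x \<partial>(\<Pi>\<^sub>M v\<in>{..<3}. lborel))"
    unfolding set_lebesgue_integral_def
    by (rule integral_completion_cong_AE, intro borel_measurable_times borel_measurable_indicator PA F0,
      use ae in eventually_elim) (simp add: indicator_def)
  also have "\<dots> = (\<integral>w. indicator (Pi\<^sub>E {..<3} A) (vec3 w) * F0 (vec3 w) \<partial>lborel)"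
    by (subst distr_vec3[symmetric],
      rule integral_distr[OF vec3_measurable borel_measurable_times[OF borel_measurable_indicator[OF PA] F0]])
  also have "\<dots> = (\<integral>w. indicator cube w * (indicator S w * f w) \<partial>lborel)"
  proof (rule Bochner_Integration.integral_cong[OF refl])
    fix w
    have "vec3 w \<in> Pi\<^sub>E {..<3} A \<longleftrightarrow> w \<in> S"
      unfolding S_def vec3_in_PiE mem_Times_iff ..
    then show "indicator (Pi\<^sub>E {..<3} A) (vec3 w) * F0 (vec3 w) = indicator cube w * (indicator S w * f w)"
      using subsetD[OF S(2), of w] by (simp add: f(2) indicator_def)
  qed
  also have "\<dots> = (\<integral>w. indicator S w * f w \<partial>unit3)"
    unfolding unit3_eq
    by (rule integral_density_indicator[symmetric])
      (auto intro!: borel_measurable_times borel_measurable_indicator S f)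
  finally show ?thesis unfolding S_def indicator_times mult.assoc .
qed

text \<open>The set where \<open>g\<close> and \<open>g0\<close> differ need not be Borel. A Borel
  null set containing it can be pulled back along coordinate projections with measurability
  intact.\<close>

lemma represents_null_set:
  assumes "represents g0 g"
  obtains N where "N \<in> sets borel" "AE w in unit2. w \<notin> N"
    "\<And>x y. (x, y) \<notin> N \<Longrightarrow> g x y = g0 (x, y)"
proof -
  obtain N where N: "{w \<in> space unit2. g (fst w) (snd w) \<noteq> g0 w} \<subseteq> N" "emeasure unit2 N = 0" "N \<in> sets unit2"
    using AE_E[OF representsD(2)[OF assms]] by blast
  show ?thesis
  proof (rule that[of N])
    show "N \<in> sets borel" using N(3) unfolding sets_unit2 .
    show "AE w in unit2. w \<notin> N" using N(2,3) by (intro AE_not_in) (auto simp: null_sets_def)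
    show "g x y = g0 (x, y)" if "(x, y) \<notin> N" for x y
      using subsetD[OF N(1), of "(x, y)"] that by auto
  qed
qed

lemma edge_density_eq:
  assumes part: "interval_partition k b B" and rep: "represents g0 g" and ij: "i < k" "j < k"
  shows "edge_density B i j g = unit.edge (indicator (B i)) (indicator (B j)) g0"
proof -
  note B = interval_partition_facts[OF part]
  have g0: "g0 \<in> borel_measurable borel"
    using unit.sym_kernelD(1)[OF representsD(1)[OF rep]] by (simp add: measurable_unit2_iff)
  then have [measurable]: "g0 \<in> borel_measurable (borel \<Otimes>\<^sub>M borel)" by (simp add: borel_prod)
  obtain N where N: "N \<in> sets borel" "AE w in unit2. w \<notin> N"
    and gN: "\<And>x y. (x, y) \<notin> N \<Longrightarrow> g x y = g0 (x, y)"
    using represents_null_set[OF rep] by blast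
  have [measurable]: "N \<in> sets (borel \<Otimes>\<^sub>M borel)" using N(1) unfolding borel_prod .
  let ?A = "\<lambda>v. B ([i, j] ! v)"
  have A: "\<And>v. v < 2 \<Longrightarrow> ?A v \<in> sets borel" "\<And>v. v < 2 \<Longrightarrow> ?A v \<subseteq> {0..1}"
    using B(1)[OF ij(1)] B(1)[OF ij(2)] B(2)[OF ij(1)] B(2)[OF ij(2)] by (auto simp: less_2_cases_iff)
  have PA[measurable]: "Pi\<^sub>E {..<2} ?A \<in> sets (\<Pi>\<^sub>M v\<in>{..<2}. lborel)"
    using A(1) by (intro sets_PiM_I_finite) auto
  have [measurable]: "(\<lambda>x. x 0) \<in> measurable (\<Pi>\<^sub>M v\<in>{..<2 :: nat}. lborel) borel"
    "(\<lambda>x. x 1) \<in> measurable (\<Pi>\<^sub>M v\<in>{..<2 :: nat}. lborel) borel"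
    using measurable_component_singleton[of 0 "{..<2}" "\<lambda>_. lborel"]
      measurable_component_singleton[of 1 "{..<2}" "\<lambda>_. lborel"] by simp_all
  \<comment> \<open>\<open>N\<close> is null only for \<open>unit2\<close>, that is, inside the
    square; the premise on \<open>x\<close> keeps the coordinates there.\<close>
  have ae: "AE x in (\<Pi>\<^sub>M v\<in>{..<2}. lborel). x \<in> Pi\<^sub>E {..<2} ?A \<longrightarrow> (x 0, x 1) \<notin> N"
  proof (subst distr_vec2[symmetric], subst AE_distr_iff)
    show "AE w in lborel. vec2 w \<in> Pi\<^sub>E {..<2} ?A \<longrightarrow> (vec2 w 0, vec2 w 1) \<notin> N"
      using N(2) unfolding AE_unit2
    proof eventually_elim
      case (elim w)
      then show ?case
        using A(2)[of 0] A(2)[of 1] unfolding vec2_in_PiE vec2_apply by (auto simp: mem_Times_iff)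
    qed
    show "{x \<in> space (\<Pi>\<^sub>M v\<in>{..<2}. lborel). x \<in> Pi\<^sub>E {..<2} ?A \<longrightarrow> (x 0, x 1) \<notin> N}
      \<in> sets (\<Pi>\<^sub>M v\<in>{..<2}. lborel)" by measurable
  qed measurable
  have "edge_density B i j g = (LINT x:Pi\<^sub>E {..<2} ?A|completion (\<Pi>\<^sub>M v\<in>{..<2}. lborel). g (x 0) (x 1))"
    by (simp add: edge_density_def colored_density_def)
  also have "\<dots> = (\<integral>w. indicator (?A 0) (fst w) * indicator (?A 1) (snd w) * g0 w \<partial>unit2)"
  proof (rule density_two_vertices[where A="?A" and F="\<lambda>x. g (x 0) (x 1)" and F0="\<lambda>x. g0 (x 0, x 1)" and f=g0])
    show "AE x in (\<Pi>\<^sub>M v\<in>{..<2}. lborel). x \<in> Pi\<^sub>E {..<2} ?A \<longrightarrow> g (x 0) (x 1) = g0 (x 0, x 1)"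
      using ae by eventually_elim (auto simp: gN)
    show "(\<lambda>x. g0 (x 0, x 1)) \<in> borel_measurable (\<Pi>\<^sub>M v\<in>{..<2 :: nat}. lborel)" by measurable
  qed (use A in \<open>auto simp: g0 vec2_apply[unfolded One_nat_def]\<close>)
  finally show ?thesis by (simp add: unit.edge_def case_prod_unfold)
qed

lemma triangle_density_eq:
  assumes part: "interval_partition k b B" and rep: "represents g0 g" and ijl: "i < k" "j < k" "l < k"
  shows "triangle_density B i j l g =
    unit.triangle (indicator (B i)) (indicator (B j)) (indicator (B l)) g0"
proof -
  note B = interval_partition_facts[OF part]
  have g0u[measurable]: "g0 \<in> borel_measurable unit2"
    by (rule unit.sym_kernelD(1)[OF representsD(1)[OF rep]])
  then have [measurable]: "g0 \<in> borel_measurable (borel \<Otimes>\<^sub>M borel)"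
    by (simp add: borel_prod measurable_unit2_iff)
  obtain N where N: "N \<in> sets borel" "AE w in unit2. w \<notin> N"
    and gN: "\<And>x y. (x, y) \<notin> N \<Longrightarrow> g x y = g0 (x, y)"
    using represents_null_set[OF rep] by blast
  have [measurable]: "N \<in> sets (borel \<Otimes>\<^sub>M borel)" using N(1) unfolding borel_prod .
  have Nu[measurable]: "N \<in> sets unit2" using N(1) unfolding sets_unit2 .
  let ?A = "\<lambda>v. B ([i, j, l] ! v)"
  have lt3: "v < 3 \<longleftrightarrow> v = 0 \<or> v = 1 \<or> v = 2" for v :: nat by auto
  have A: "\<And>v. v < 3 \<Longrightarrow> ?A v \<in> sets borel" "\<And>v. v < 3 \<Longrightarrow> ?A v \<subseteq> {0..1}"
    unfolding lt3 using B(1)[OF ijl(1)] B(1)[OF ijl(2)] B(1)[OF ijl(3)]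
      B(2)[OF ijl(1)] B(2)[OF ijl(2)] B(2)[OF ijl(3)] by auto
  have PA[measurable]: "Pi\<^sub>E {..<3} ?A \<in> sets (\<Pi>\<^sub>M v\<in>{..<3}. lborel)"
    using A(1) by (intro sets_PiM_I_finite) auto
  have [measurable]: "(\<lambda>x. x 0) \<in> measurable (\<Pi>\<^sub>M v\<in>{..<3 :: nat}. lborel) borel"
    "(\<lambda>x. x 1) \<in> measurable (\<Pi>\<^sub>M v\<in>{..<3 :: nat}. lborel) borel"
    "(\<lambda>x. x 2) \<in> measurable (\<Pi>\<^sub>M v\<in>{..<3 :: nat}. lborel) borel"
    using measurable_component_singleton[of 0 "{..<3}" "\<lambda>_. lborel"]
      measurable_component_singleton[of 1 "{..<3}" "\<lambda>_. lborel"]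
      measurable_component_singleton[of 2 "{..<3}" "\<lambda>_. lborel"] by simp_all
  have ae: "AE x in (\<Pi>\<^sub>M v\<in>{..<3}. lborel). x \<in> Pi\<^sub>E {..<3} ?A \<longrightarrow>
      (x 0, x 1) \<notin> N \<and> (x 0, x 2) \<notin> N \<and> (x 1, x 2) \<notin> N"
  proof (subst distr_vec3[symmetric], subst AE_distr_iff)
    \<comment> \<open>The integrand evaluates the graphon on all three edges, so the null set must
      be avoided by three pairs of coordinates at once.\<close>
    have "AE (x, y, z) in unit3. (x, y) \<notin> N \<and> (x, z) \<notin> N \<and> (y, z) \<notin> N"
      by (rule unit.AE_M3_pairs[OF N(2)]) measurable
    then show "AE w in lborel. vec3 w \<in> Pi\<^sub>E {..<3} ?A \<longrightarrow>
        (vec3 w 0, vec3 w 1) \<notin> N \<and> (vec3 w 0, vec3 w 2) \<notin> N \<and> (vec3 w 1, vec3 w 2) \<notin> N"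
      unfolding AE_unit3
    proof eventually_elim
      case (elim w)
      then show ?case
        using A(2)[of 0] A(2)[of 1] A(2)[of 2] unfolding vec3_in_PiE vec3_apply
        by (auto simp: mem_Times_iff case_prod_unfold)
    qed
    show "{x \<in> space (\<Pi>\<^sub>M v\<in>{..<3}. lborel). x \<in> Pi\<^sub>E {..<3} ?A \<longrightarrow>
        (x 0, x 1) \<notin> N \<and> (x 0, x 2) \<notin> N \<and> (x 1, x 2) \<notin> N}
      \<in> sets (\<Pi>\<^sub>M v\<in>{..<3}. lborel)" by measurable
  qed measurable
  have "(\<Prod>e\<in>{{0, 1}, {0, 2}, {1, 2 :: nat}}. g (x (Min e)) (x (Max e))) =
      g (x 0) (x 1) * g (x 0) (x 2) * g (x 1) (x 2)" for x
    by (simp add: doubleton_eq_iff numeral_2_eq_2)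
  then have "triangle_density B i j l g =
      (LINT x:Pi\<^sub>E {..<3} ?A|completion (\<Pi>\<^sub>M v\<in>{..<3}. lborel). g (x 0) (x 1) * g (x 0) (x 2) * g (x 1) (x 2))"
    by (simp only: triangle_density_def colored_density_def)
  also have "\<dots> = (\<integral>w. indicator (?A 0) (fst w) * indicator (?A 1) (fst (snd w)) * indicator (?A 2) (snd (snd w)) *
      (g0 (fst w, fst (snd w)) * g0 (fst w, snd (snd w)) * g0 (fst (snd w), snd (snd w))) \<partial>unit3)"
  proof (rule density_three_vertices[where A="?A" and F="\<lambda>x. g (x 0) (x 1) * g (x 0) (x 2) * g (x 1) (x 2)" and F0="\<lambda>x. g0 (x 0, x 1) * g0 (x 0, x 2) * g0 (x 1, x 2)"])
    show "AE x in (\<Pi>\<^sub>M v\<in>{..<3}. lborel). x \<in> Pi\<^sub>E {..<3} ?A \<longrightarrow>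
        g (x 0) (x 1) * g (x 0) (x 2) * g (x 1) (x 2) = g0 (x 0, x 1) * g0 (x 0, x 2) * g0 (x 1, x 2)"
      using ae by eventually_elim (auto simp: gN)
    show "(\<lambda>x. g0 (x 0, x 1) * g0 (x 0, x 2) * g0 (x 1, x 2)) \<in> borel_measurable (\<Pi>\<^sub>M v\<in>{..<3 :: nat}. lborel)"
      by measurable
    show "(\<lambda>w. g0 (fst w, fst (snd w)) * g0 (fst w, snd (snd w)) * g0 (fst (snd w), snd (snd w)))
      \<in> borel_measurable borel"
      unfolding measurable_unit3_iff[symmetric] by measurable
  qed (use A in \<open>auto simp: vec3_apply[unfolded One_nat_def]\<close>)
  finally show ?thesis by (simp add: unit.triangle_def case_prod_unfold)
qed

section \<open>Colour-preserving maps and the cut metric\<close>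

definition color_invariant :: "nat \<Rightarrow> (nat \<Rightarrow> real set) \<Rightarrow> (real \<Rightarrow> real) set" where
  "color_invariant k B = {\<sigma>. \<forall>i<k. AE x in unit_measure. indicator (B i) (\<sigma> x) = (indicator (B i) x :: real)}"

text \<open>A map in the definition of the metric is measurable only between Lebesgue
  sigma-algebras, whereas pullbacks of Borel kernels call for a Borel map. A Borel version agrees
  with it almost everywhere on the unit interval, and that suffices to inherit measure preservation
  and colour invariance.\<close>

lemma color_preserving_Borel_version:
  assumes part: "interval_partition k b B" and \<sigma>: "\<sigma> \<in> color_preserving_maps k B"
  shows "\<exists>\<sigma>0\<in>color_invariant k B. unit.measure_preserving \<sigma>0 \<and> (AE x in unit_measure. \<sigma>0 x = \<sigma> x)"
proof -
  let ?I = "{0..1 :: real}" and ?L = "lebesgue_on {0..1 :: real}"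
  note B = interval_partition_facts[OF part]
  have \<sigma>m: "\<sigma> \<in> measurable ?L ?L" and \<sigma>d: "distr ?L ?L \<sigma> = ?L"
    and \<sigma>B: "\<And>i. i < k \<Longrightarrow> emeasure lebesgue (sym_diff (\<sigma> -` B i \<inter> ?I) (B i)) = 0"
    using \<sigma> by (auto simp: color_preserving_maps_def)
  have \<sigma>I: "\<sigma> x \<in> ?I" if "x \<in> ?I" for x
    using measurable_space[OF \<sigma>m, of x] that by simp
  have sub: "A \<in> sets ?L" if "A \<in> sets borel" "A \<subseteq> ?I" for A
    using that by (auto simp: sets_restrict_space image_iff intro!: exI[of _ A])
  have vim: "\<sigma> -` A \<inter> ?I \<in> sets lebesgue" "emeasure lebesgue (\<sigma> -` A \<inter> ?I) = emeasure lborel A"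
    if A: "A \<in> sets borel" "A \<subseteq> ?I" for A
  proof -
    have "\<sigma> -` A \<inter> space ?L \<in> sets ?L" by (rule measurable_sets[OF \<sigma>m sub[OF A]])
    then have *: "\<sigma> -` A \<inter> ?I \<in> sets ?L" by simp
    then show "\<sigma> -` A \<inter> ?I \<in> sets lebesgue" by (subst (asm) sets_restrict_space_iff) auto
    have "emeasure lebesgue (\<sigma> -` A \<inter> ?I) = emeasure ?L (\<sigma> -` A \<inter> ?I)"
      by (rule emeasure_restrict_space[symmetric]) auto
    also have "\<dots> = emeasure (distr ?L ?L \<sigma>) A"
      using sub[OF A] by (simp add: emeasure_distr[OF \<sigma>m])
    also have "\<dots> = emeasure lebesgue A"
      unfolding \<sigma>d using A by (intro emeasure_restrict_space) auto
    finally show "emeasure lebesgue (\<sigma> -` A \<inter> ?I) = emeasure lborel A" using A by simp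
  qed
  have "(\<lambda>x. x) \<in> measurable ?L borel"
    by (intro measurable_restrict_space1 measurable_completion) simp
  then have "\<sigma> \<in> borel_measurable ?L" using measurable_compose[OF \<sigma>m] by blast
  then have "(\<lambda>x. indicator ?I x *\<^sub>R \<sigma> x) \<in> borel_measurable lebesgue"
    by (subst (asm) borel_measurable_restrict_space_iff) auto
  then obtain \<sigma>0 where \<sigma>0: "\<sigma>0 \<in> borel_measurable lborel"
    and ae: "AE x in lborel. indicator ?I x *\<^sub>R \<sigma> x = \<sigma>0 x"
    using completion_ex_borel_measurable_real by blast
  have [measurable]: "\<sigma>0 \<in> borel_measurable borel" using \<sigma>0 by simp
  have eq: "AE x in unit_measure. \<sigma>0 x = \<sigma> x"
    using ae unfolding AE_unit by eventually_elim auto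
  have em: "emeasure unit_measure A = emeasure lborel (?I \<inter> A)" if "A \<in> sets borel" for A
    unfolding unit_measure_def using that by (intro emeasure_restricted) auto
  have "distr unit_measure unit_measure \<sigma>0 = unit_measure"
  proof (rule measure_eqI)
    fix A assume "A \<in> sets (distr unit_measure unit_measure \<sigma>0)"
    then have A[measurable]: "A \<in> sets borel" by simp
    have m: "\<sigma>0 -` A \<in> sets borel" using measurable_sets[of \<sigma>0 borel borel A] by simp
    have "emeasure (distr unit_measure unit_measure \<sigma>0) A = emeasure unit_measure (\<sigma>0 -` A)"
      by (subst emeasure_distr) (auto cong: measurable_cong_sets)
    also have "\<dots> = emeasure lebesgue (?I \<inter> \<sigma>0 -` A)" using m by (simp add: em)
    \<comment> \<open>The two preimages differ by a null set. Since \<open>\<sigma>\<close> maps the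
      unit interval into itself, \<open>A\<close> may be cut down to it.\<close>
    also have "\<dots> = emeasure lebesgue (\<sigma> -` (?I \<inter> A) \<inter> ?I)"
    proof (rule emeasure_eq_AE)
      show "AE x in lebesgue. x \<in> ?I \<inter> \<sigma>0 -` A \<longleftrightarrow> x \<in> \<sigma> -` (?I \<inter> A) \<inter> ?I"
        using AE_completion[OF ae]
      proof eventually_elim
        case (elim x)
        show ?case
        proof (cases "x \<in> ?I")
          case True
          then have "\<sigma>0 x = \<sigma> x" using elim by simp
          then show ?thesis using True \<sigma>I[OF True] by (simp only: Int_iff vimage_eq simp_thms)
        qed blast
      qed
      show "\<sigma> -` (?I \<inter> A) \<inter> ?I \<in> sets lebesgue" by (intro vim) auto
      show "?I \<inter> \<sigma>0 -` A \<in> sets lebesgue" using m by (intro sets_completionI_sets) auto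
    qed
    also have "\<dots> = emeasure lborel (?I \<inter> A)" by (rule vim(2)) auto
    finally show "emeasure (distr unit_measure unit_measure \<sigma>0) A = emeasure unit_measure A"
      by (simp add: em)
  qed simp
  then have mp: "unit.measure_preserving \<sigma>0"
    by (simp add: unit.measure_preserving_def cong: measurable_cong_sets)
  have "AE x in unit_measure. indicator (B i) (\<sigma>0 x) = (indicator (B i) x :: real)" if "i < k" for i
  proof -
    \<comment> \<open>\<open>emeasure\<close> is 0 on nonmeasurable sets as well, so the
      measurability of the preimage from \<open>vim\<close> is essential to turn the vanishing
      measure into a null set.\<close>
    have "sym_diff (\<sigma> -` B i \<inter> ?I) (B i) \<in> null_sets lebesgue"
      using vim(1)[OF B(1,2)[OF that]] B(1)[OF that] \<sigma>B[OF that] by (intro null_setsI sets.Un sets.Diff) auto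
    then have "AE x in lebesgue. x \<notin> sym_diff (\<sigma> -` B i \<inter> ?I) (B i)" by (rule AE_not_in)
    then have "AE x in lborel. x \<notin> sym_diff (\<sigma> -` B i \<inter> ?I) (B i)" by (simp add: AE_completion_iff)
    then have "AE x in unit_measure. x \<in> ?I \<and> x \<notin> sym_diff (\<sigma> -` B i \<inter> ?I) (B i)"
      unfolding AE_unit by eventually_elim auto
    with eq show ?thesis by eventually_elim (auto simp: indicator_def)
  qed
  then have "\<sigma>0 \<in> color_invariant k B" by (simp add: color_invariant_def)
  then show ?thesis using mp eq by blast
qed

text \<open>A uniform bound for the block integrals in \<open>cut_dist\<close>. It is obtained by
  comparison with the indicator of the square, a nonintegrable integrand having integral 0.\<close>

lemma abs_set_integral_square_le_1:
  fixes f :: "real \<times> real \<Rightarrow> real"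
  assumes "A \<subseteq> square" "\<And>w. w \<in> A \<Longrightarrow> \<bar>f w\<bar> \<le> 1"
  shows "\<bar>LINT w:A|lebesgue. f w\<bar> \<le> 1"
proof -
  have m: "indicator square \<in> borel_measurable lborel" (is "?f \<in> _")
    using square_borel by (intro borel_measurable_indicator) simp
  have "emeasure lborel square < \<infinity>"
    by (rule emeasure_bounded_finite) (intro bounded_Times bounded_closed_interval)
  then have int: "integrable lebesgue (indicator square :: _ \<Rightarrow> real)"
    using square_borel m by (simp add: integrable_completion)
  have "(\<integral>w. indicator square w \<partial>lebesgue) = (\<integral>w. indicator square w * (1 :: real) \<partial>lborel)"
    using integral_completion[OF m] by simp
  also have "\<dots> = (\<integral>w. 1 \<partial>unit2)"
    unfolding unit2_eq using square_borel by (intro integral_density_indicator[symmetric]) auto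
  finally have one: "(\<integral>w. indicator square w \<partial>lebesgue) = (1 :: real)" using unit.P2.prob_space by simp
  have "norm (LINT w:A|lebesgue. f w) \<le> (\<integral>w. norm (indicator A w *\<^sub>R f w) \<partial>lebesgue)"
    unfolding set_lebesgue_integral_def by (rule integral_norm_bound)
  also have "\<dots> \<le> (\<integral>w. indicator square w \<partial>lebesgue)"
    by (rule integral_mono'[OF int]) (use assms in \<open>auto simp: indicator_def\<close>)
  finally show ?thesis using one by simp
qed

lemma graphon_pullback_bounds:
  assumes "g \<in> graphons" "\<sigma> \<in> color_preserving_maps k B" "x \<in> {0..1}" "y \<in> {0..1}"
  shows "0 \<le> graphon_pullback g \<sigma> x y" "graphon_pullback g \<sigma> x y \<le> 1"
proof -
  have \<sigma>: "\<sigma> \<in> measurable (lebesgue_on {0..1}) (lebesgue_on {0..1})"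
    using assms(2) by (simp add: color_preserving_maps_def)
  have "\<sigma> x \<in> {0..1}" "\<sigma> y \<in> {0..1}"
    using measurable_space[OF \<sigma>, of x] measurable_space[OF \<sigma>, of y] assms(3,4) by auto
  then show "0 \<le> graphon_pullback g \<sigma> x y" "graphon_pullback g \<sigma> x y \<le> 1"
    using assms(1) by (auto simp: graphons_def graphon_pullback_def)
qed

lemma graphon_diff_pullback_bound:
  assumes "p \<in> graphons" "q \<in> graphons" "\<sigma> \<in> color_preserving_maps k B" "x \<in> {0..1}" "y \<in> {0..1}"
  shows "\<bar>p x y - graphon_pullback q \<sigma> x y\<bar> \<le> 1"
proof -
  have "0 \<le> p x y" "p x y \<le> 1" using assms(1,4,5) unfolding graphons_def by blast+
  then show ?thesis using graphon_pullback_bounds[OF assms(2-5)] by linarith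
qed

text \<open>A real-valued supremum dominates its members only if the family is bounded above; each
  of the \<open>k * k\<close> block terms is at most 1.\<close>

lemma cut_dist_upper:
  assumes bd: "\<And>x y. x \<in> {0..1} \<Longrightarrow> y \<in> {0..1} \<Longrightarrow> \<bar>p x y - q x y\<bar> \<le> 1"
    and CD: "C \<in> sets lebesgue" "D \<in> sets lebesgue" "C \<subseteq> {0..1}" "D \<subseteq> {0..1}"
  shows "(\<Sum>i<k. \<Sum>j<k. \<bar>LINT (x, y):C \<times> D|lebesgue. indicator (B i \<times> B j) (x, y) * (p x y - q x y)\<bar>)
    \<le> cut_dist k B p q"
proof -
  define F where "F = (\<lambda>(C, D). \<Sum>i<k. \<Sum>j<k.
    \<bar>LINT (x, y):C \<times> D|lebesgue. indicator (B i \<times> B j) (x, y) * (p x y - q x y)\<bar>)"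
  define X where "X = {(C, D). C \<in> sets lebesgue \<and> D \<in> sets lebesgue \<and> C \<subseteq> {0..1 :: real} \<and> D \<subseteq> {0..1 :: real}}"
  have "F (C, D) \<le> (SUP c\<in>X. F c)"
  proof (rule cSUP_upper)
    show "(C, D) \<in> X" using CD by (simp add: X_def)
    show "bdd_above (F ` X)"
    proof (rule bdd_aboveI2)
      fix c assume "c \<in> X"
      then obtain C D where c: "c = (C, D)" "C \<subseteq> {0..1}" "D \<subseteq> {0..1}" by (auto simp: X_def)
      have "\<bar>LINT (x, y):C \<times> D|lebesgue. indicator (B i \<times> B j) (x, y) * (p x y - q x y)\<bar> \<le> 1" for i j
      proof (rule abs_set_integral_square_le_1)
        show "C \<times> D \<subseteq> square" using c(2,3) by (rule Sigma_mono)
        fix w assume "w \<in> C \<times> D"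
        then have "\<bar>p (fst w) (snd w) - q (fst w) (snd w)\<bar> \<le> 1"
          using c(2,3) by (intro bd) auto
        then show "\<bar>case w of (x, y) \<Rightarrow> indicator (B i \<times> B j) (x, y) * (p x y - q x y)\<bar> \<le> 1"
          by (cases w) (auto simp: indicator_def)
      qed
      then have "F c \<le> (\<Sum>i<k. \<Sum>j<k. 1)"
        unfolding F_def c(1) prod.case by (intro sum_mono)
      then show "F c \<le> real k * real k" by simp
    qed
  qed
  then show ?thesis by (simp add: cut_dist_def F_def X_def)
qed

lemma cut_dist_nonneg:
  assumes "\<And>x y. x \<in> {0..1} \<Longrightarrow> y \<in> {0..1} \<Longrightarrow> \<bar>p x y - q x y\<bar> \<le> 1"
  shows "0 \<le> cut_dist k B p q"
  by (rule order_trans[OF _ cut_dist_upper[OF assms, where C="{}" and D="{}"]]) (auto intro!: sum_nonneg)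

lemma id_color_preserving:
  assumes "interval_partition k b B"
  shows "(\<lambda>x. x) \<in> color_preserving_maps k B"
proof -
  have "B i \<inter> {0..1} = B i" if "i < k" for i
    using interval_partition_facts(2)[OF assms that] by (rule Int_absorb2)
  then show ?thesis
    by (simp add: color_preserving_maps_def distr_id[unfolded id_def])
qed

text \<open>The identity map attains 0, and every other map contributes a nonnegative distance. This
  places a graphon in its own class.\<close>

lemma cut_metric_refl:
  assumes part: "interval_partition k b B" and g: "g \<in> graphons"
  shows "cut_metric k B g g = 0"
  unfolding cut_metric_def
proof (rule cInf_eq_minimum)
  have "cut_dist k B g (graphon_pullback g (\<lambda>x. x)) = (SUP (C, D) \<in>
    {(C, D). C \<in> sets lebesgue \<and> D \<in> sets lebesgue \<and> C \<subseteq> {0..1 :: real} \<and> D \<subseteq> {0..1 :: real}}. 0)"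
    unfolding cut_dist_def graphon_pullback_def by (simp add: case_prod_unfold)
  also have "\<dots> = (0 :: real)"
    unfolding case_prod_unfold by (rule cSUP_const) (auto intro!: exI[of _ "{}"])
  finally show "0 \<in> (\<lambda>\<sigma>. cut_dist k B g (graphon_pullback g \<sigma>)) ` color_preserving_maps k B"
    using id_color_preserving[OF part] by (metis image_eqI)
  fix x assume "x \<in> (\<lambda>\<sigma>. cut_dist k B g (graphon_pullback g \<sigma>)) ` color_preserving_maps k B"
  then obtain \<sigma> where \<sigma>: "\<sigma> \<in> color_preserving_maps k B" "x = cut_dist k B g (graphon_pullback g \<sigma>)" by auto
  show "0 \<le> x"
    unfolding \<sigma>(2) by (intro cut_dist_nonneg graphon_diff_pullback_bound[OF g g \<sigma>(1)])
qed

text \<open>A vanishing infimum yields maps with arbitrarily small coloured distance. Passing to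
  Borel versions changes each block integral by nothing, and the triangle inequality over the blocks
  bounds the plain cut integral by the coloured distance.\<close>

lemma cut_metric_zero_approximable:
  assumes part: "interval_partition k b B" and p: "p \<in> graphons" and q: "q \<in> graphons"
    and p0: "represents p0 p" and q0: "represents q0 q" and zero: "cut_metric k B p q = 0"
  shows "unit.cut_approximable (color_invariant k B) p0 q0"
  unfolding unit.cut_approximable_def
proof (intro allI impI)
  fix e :: real assume e: "0 < e"
  note B = interval_partition_facts[OF part]
  have "color_preserving_maps k B \<noteq> {}" using id_color_preserving[OF part] by blast
  then obtain \<sigma> where \<sigma>: "\<sigma> \<in> color_preserving_maps k B" and d: "cut_dist k B p (graphon_pullback q \<sigma>) < e"
    using cInf_lessD[of "(\<lambda>\<sigma>. cut_dist k B p (graphon_pullback q \<sigma>)) ` color_preserving_maps k B" e] zero e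
    by (auto simp: cut_metric_def)
  obtain \<sigma>0 where \<sigma>0: "\<sigma>0 \<in> color_invariant k B" "unit.measure_preserving \<sigma>0"
    and ae: "AE x in unit_measure. \<sigma>0 x = \<sigma> x"
    using color_preserving_Borel_version[OF part \<sigma>] by blast
  note kp = representsD(1)[OF p0] and kq = unit.sym_kernel_pullback[OF representsD(1)[OF q0] \<sigma>0(2)]
  define f where "f w = p0 w - unit.pullback q0 \<sigma>0 w" for w
  have fm: "f \<in> borel_measurable borel"
    using unit.sym_kernelD(1)[OF kp] unit.sym_kernelD(1)[OF kq]
    unfolding f_def measurable_unit2_iff[symmetric] by measurable
  have fb: "\<bar>f w\<bar> \<le> 1" for w
    using unit.sym_kernelD(2,3)[OF kp, of w] unit.sym_kernelD(2,3)[OF kq, of w] by (auto simp: f_def)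
  have \<sigma>0m: "\<sigma>0 \<in> measurable unit_measure unit_measure"
    by (rule unit.measure_preserving_measurable[OF \<sigma>0(2)])
  \<comment> \<open>The almost everywhere identity of \<open>q\<close> and \<open>q0\<close>
    survives composition with \<open>\<sigma>0\<close> because that map preserves the measure;
    afterwards \<open>\<sigma>0\<close> is exchanged for \<open>\<sigma>\<close> in both
    coordinates.\<close>
  have feq: "AE w in unit2. p (fst w) (snd w) - graphon_pullback q \<sigma> (fst w) (snd w) = f w"
  proof -
    have T: "(\<lambda>w. (\<sigma>0 (fst w), \<sigma>0 (snd w))) \<in> measurable unit2 unit2"
      using \<sigma>0m by measurable
    have "AE w in distr unit2 unit2 (\<lambda>w. (\<sigma>0 (fst w), \<sigma>0 (snd w))). q (fst w) (snd w) = q0 w"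
      unfolding unit.distr_M2[OF \<sigma>0(2)] by (rule representsD(2)[OF q0])
    from AE_distrD[OF T this]
    have "AE w in unit2. q (\<sigma>0 (fst w)) (\<sigma>0 (snd w)) = q0 (\<sigma>0 (fst w), \<sigma>0 (snd w))"
      by (simp only: fst_conv snd_conv)
    with unit.AE_M2_both[OF ae] representsD(2)[OF p0] show ?thesis
      by eventually_elim (simp add: f_def unit.pullback_def graphon_pullback_def)
  qed
  have "unit.cut_le e f"
    unfolding unit.cut_le_def
  proof (intro ballI)
    fix A D assume "A \<in> sets unit_measure" "D \<in> sets unit_measure"
    then have AD: "A \<in> sets borel" "D \<in> sets borel" unfolding sets_unit_measure by blast+
    \<comment> \<open>\<open>cut_dist\<close> ranges over subsets of the unit interval only, while
      \<open>cut_le\<close> admits all Borel sets; the difference is invisible to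
      \<open>unit2\<close>.\<close>
    define C where "C = A \<inter> {0..1}"
    define E where "E = D \<inter> {0..1}"
    have CE: "C \<in> sets borel" "E \<in> sets borel" "C \<subseteq> {0..1}" "E \<subseteq> {0..1}"
      using AD by (auto simp: C_def E_def)
    have CEm: "C \<times> E \<in> sets borel" "C \<times> E \<subseteq> square"
      by (rule borel_Times[OF CE(1,2)], rule Sigma_mono[OF CE(3,4)])
    let ?L = "\<lambda>i j. LINT (x, y):C \<times> E|lebesgue. indicator (B i \<times> B j) (x, y) * (p x y - graphon_pullback q \<sigma> x y)"
    have "?L i j = (\<integral>w. indicator (B i \<times> B j) w * (f w * indicator (C \<times> E) w) \<partial>unit2)"
      if "i < k" "j < k" for i j
    proof -
      have "?L i j = (\<integral>w. indicator (C \<times> E) w * (indicator (B i \<times> B j) w * f w) \<partial>unit2)"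
      proof (rule set_integral_lebesgue_square[OF CEm])
        show "(\<lambda>w. indicator (B i \<times> B j) w * f w) \<in> borel_measurable borel"
          by (intro borel_measurable_times borel_measurable_indicator borel_Times B that fm)
        show "AE w in unit2. w \<in> C \<times> E \<longrightarrow> (case w of (x, y) \<Rightarrow>
            indicator (B i \<times> B j) (x, y) * (p x y - graphon_pullback q \<sigma> x y)) = indicator (B i \<times> B j) w * f w"
          using feq by eventually_elim (simp add: case_prod_unfold)
      qed
      then show ?thesis by (simp add: mult_ac)
    qed
    then have "(\<Sum>i<k. \<Sum>j<k. ?L i j) =
        (\<Sum>i<k. \<Sum>j<k. \<integral>w. indicator (B i \<times> B j) w * (f w * indicator (C \<times> E) w) \<partial>unit2)"
      by (intro sum.cong refl) auto
    also have "\<dots> = (\<integral>w. f w * indicator (C \<times> E) w \<partial>unit2)"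
    proof (rule sum_integral_color_blocks[OF part])
      show "(\<lambda>w. f w * indicator (C \<times> E) w) \<in> borel_measurable borel"
        by (intro borel_measurable_times borel_measurable_indicator fm CEm)
      show "\<bar>f w * indicator (C \<times> E) w\<bar> \<le> 1" for w
        using fb by (intro abs_mult_le_one) (auto simp: indicator_def)
    qed
    also have "\<dots> = (\<integral>w. f w * indicator (A \<times> D) w \<partial>unit2)"
    proof (rule integral_cong_AE)
      show "(\<lambda>w. f w * indicator (C \<times> E) w) \<in> borel_measurable unit2"
        "(\<lambda>w. f w * indicator (A \<times> D) w) \<in> borel_measurable unit2"
        unfolding measurable_unit2_iff
        by (intro borel_measurable_times borel_measurable_indicator fm CEm borel_Times AD)+
      show "AE w in unit2. f w * indicator (C \<times> E) w = f w * indicator (A \<times> D) w"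
        using AE_unit2_square
      proof eventually_elim
        case (elim w)
        then have "w \<in> C \<times> E \<longleftrightarrow> w \<in> A \<times> D"
          unfolding C_def E_def mem_Times_iff by blast
        then show ?case by (simp only: indicator_def)
      qed
    qed
    finally have eq: "(\<integral>w. f w * indicator (A \<times> D) w \<partial>unit2) = (\<Sum>i<k. \<Sum>j<k. ?L i j)" ..
    have "\<bar>\<Sum>i<k. \<Sum>j<k. ?L i j\<bar> \<le> (\<Sum>i<k. \<bar>\<Sum>j<k. ?L i j\<bar>)" by (rule sum_abs)
    also have "\<dots> \<le> (\<Sum>i<k. \<Sum>j<k. \<bar>?L i j\<bar>)" by (intro sum_mono sum_abs)
    also have "\<dots> \<le> cut_dist k B p (graphon_pullback q \<sigma>)"
      by (rule cut_dist_upper[OF graphon_diff_pullback_bound[OF p q \<sigma>]]) (use CE in auto)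
    finally show "\<bar>\<integral>w. f w * indicator (A \<times> D) w \<partial>unit2\<bar> \<le> e" using d eq by simp
  qed
  then have "unit.cut_le e (\<lambda>w. p0 w - unit.pullback q0 \<sigma>0 w)" unfolding f_def .
  then show "\<exists>\<sigma>\<in>color_invariant k B. unit.measure_preserving \<sigma> \<and> unit.cut_le e (\<lambda>w. p0 w - unit.pullback q0 \<sigma> w)"
    using \<sigma>0 by blast
qed

section \<open>Maximizers\<close>

text \<open>The objective transported to Borel kernels, where invariance and maximality are
  established.\<close>

definition kernel_value ::
    "nat \<Rightarrow> (nat \<Rightarrow> real set) \<Rightarrow> (nat \<Rightarrow> nat \<Rightarrow> nat \<Rightarrow> real) \<Rightarrow> (nat \<Rightarrow> nat \<Rightarrow> real) \<Rightarrow> (real \<times> real \<Rightarrow> real) \<Rightarrow> real"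
  where "kernel_value k B \<alpha> h g =
     1/6 * (\<Sum>i<k. \<Sum>j<k. \<Sum>l<k. \<alpha> i j l * unit.triangle (indicator (B i)) (indicator (B j)) (indicator (B l)) g) +
     1/2 * (\<Sum>i<k. \<Sum>j<k. h i j * unit.edge (indicator (B i)) (indicator (B j)) g) - 1/2 * unit.entropy g"

lemma functional_eq_kernel_value:
  assumes "interval_partition k b B" and "represents g0 g"
  shows "energy_functional k B \<alpha> h g - 1/2 * entropy_functional k B g = kernel_value k B \<alpha> h g0"
  unfolding energy_functional_def kernel_value_def
  using triangle_density_eq[OF assms] edge_density_eq[OF assms] entropy_functional_eq[OF assms]
  by simp

lemma kernel_value_cut_approximable:
  assumes part: "interval_partition k b B" and p: "unit.sym_kernel p" and q: "unit.sym_kernel q"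
    and pq: "unit.cut_approximable (color_invariant k B) p q"
  shows "kernel_value k B \<alpha> h p = kernel_value k B \<alpha> h q"
proof -
  note B = interval_partition_facts[OF part]
  have ind: "indicator (B i) \<in> borel_measurable unit_measure" if "i < k" for i
    using B(1)[OF that] by (intro borel_measurable_indicator) simp
  have inv: "AE x in unit_measure. indicator (B i) (\<sigma> x) = (indicator (B i) x :: real)"
    if "i < k" "\<sigma> \<in> color_invariant k B" for i \<sigma>
    using that by (simp add: color_invariant_def)
  have "unit.triangle (indicator (B i)) (indicator (B j)) (indicator (B l)) p =
      unit.triangle (indicator (B i)) (indicator (B j)) (indicator (B l)) q"
    if "i < k" "j < k" "l < k" for i j l
    using inv[OF that(1)] inv[OF that(2)] inv[OF that(3)] ind that
    by (intro unit.triangle_cut_approximable[OF p q pq]) auto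
  moreover have "unit.edge (indicator (B i)) (indicator (B j)) p = unit.edge (indicator (B i)) (indicator (B j)) q"
    if "i < k" "j < k" for i j
    using inv[OF that(1)] inv[OF that(2)] ind that
    by (intro unit.edge_cut_approximable[OF p q pq]) auto
  ultimately show ?thesis
    unfolding kernel_value_def using unit.entropy_cut_approximable[OF p q pq] by simp
qed

section \<open>The colour coefficients as step functions\<close>

lemma step_measurable:
  assumes "interval_partition k b B"
  shows "(\<lambda>w. \<Delta>_step k B \<alpha> (fst w) (fst (snd w)) (snd (snd w))) \<in> borel_measurable unit3"
    and "(\<lambda>w. h_step k B h (fst w) (snd w)) \<in> borel_measurable unit2"
    and "\<Delta>_step k B \<alpha> x y \<in> borel_measurable borel"
proof -
  have B: "B i \<in> sets unit_measure" if "i \<in> {..<k}" for i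
    using interval_partition_facts(1)[OF assms] that by simp
  show "(\<lambda>w. \<Delta>_step k B \<alpha> (fst w) (fst (snd w)) (snd (snd w))) \<in> borel_measurable unit3"
    unfolding \<Delta>_step_def
  proof (intro borel_measurable_sum)
    fix i j l assume "i \<in> {..<k}" "j \<in> {..<k}" "l \<in> {..<k}"
    note [measurable] = this[THEN B]
    show "(\<lambda>w. \<alpha> i j l * indicator (B i) (fst w) * indicator (B j) (fst (snd w)) *
      indicator (B l) (snd (snd w))) \<in> borel_measurable unit3" by measurable
  qed
  show "(\<lambda>w. h_step k B h (fst w) (snd w)) \<in> borel_measurable unit2"
    unfolding h_step_def
  proof (intro borel_measurable_sum)
    fix i j assume "i \<in> {..<k}" "j \<in> {..<k}"
    note [measurable] = this[THEN B]
    show "(\<lambda>w. h i j * indicator (B i) (fst w) * indicator (B j) (snd w)) \<in> borel_measurable unit2"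
      by measurable
  qed
  show "\<Delta>_step k B \<alpha> x y \<in> borel_measurable borel"
    unfolding \<Delta>_step_def
  proof (intro borel_measurable_sum)
    fix i j l assume "l \<in> {..<k}"
    then have [measurable]: "B l \<in> sets borel" using B by simp
    show "(\<lambda>z. \<alpha> i j l * indicator (B i) x * indicator (B j) y * indicator (B l) z) \<in> borel_measurable borel"
      by measurable
  qed
qed

lemma step_bounds:
  shows "\<bar>\<Delta>_step k B \<alpha> x y z\<bar> \<le> (\<Sum>i<k. \<Sum>j<k. \<Sum>l<k. \<bar>\<alpha> i j l\<bar>)"
    and "\<bar>h_step k B h x y\<bar> \<le> (\<Sum>i<k. \<Sum>j<k. \<bar>h i j\<bar>)"
  unfolding \<Delta>_step_def h_step_def
  by (intro order_trans[OF sum_abs sum_mono] abs_mult_le; simp add: indicator_def)+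

text \<open>Exchanging two arguments is undone by renaming the corresponding summation indices,
  under which the coefficients are invariant.\<close>

lemma step_symmetric:
  assumes "symmetric_tensor k \<alpha>" and "\<And>i j. i < k \<Longrightarrow> j < k \<Longrightarrow> h i j = h j i"
  shows "\<Delta>_step k B \<alpha> x y z = \<Delta>_step k B \<alpha> y x z"
    and "\<Delta>_step k B \<alpha> x y z = \<Delta>_step k B \<alpha> x z y"
    and "h_step k B h x y = h_step k B h y x"
proof -
  have \<alpha>: "\<alpha> i j l = \<alpha> j i l" "\<alpha> i j l = \<alpha> i l j" if "i < k" "j < k" "l < k" for i j l
    using assms(1) that by (auto simp: symmetric_tensor_def)
  show "\<Delta>_step k B \<alpha> x y z = \<Delta>_step k B \<alpha> y x z"
    unfolding \<Delta>_step_def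
    by (subst sum.swap) (intro sum.cong refl, use \<alpha>(1) in \<open>simp add: mult_ac\<close>)
  show "\<Delta>_step k B \<alpha> x y z = \<Delta>_step k B \<alpha> x z y"
    unfolding \<Delta>_step_def
    by (rule sum.cong[OF refl], subst sum.swap) (intro sum.cong refl, use \<alpha>(2) in \<open>simp add: mult_ac\<close>)
  show "h_step k B h x y = h_step k B h y x"
    unfolding h_step_def
    by (subst sum.swap) (intro sum.cong refl, use assms(2) in \<open>simp add: mult_ac\<close>)
qed

text \<open>The colour sums are absorbed into the step functions, so the objective takes the form
  with a single bounded symmetric weight to which \<open>unit.maximizer_fixed_point\<close>
  applies.\<close>

lemma kernel_value_integral:
  assumes part: "interval_partition k b B" and g: "unit.sym_kernel g"
  shows "kernel_value k B \<alpha> h g =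
    1/6 * (\<integral>(x, y, z). \<Delta>_step k B \<alpha> x y z * (g (x, y) * g (x, z) * g (y, z)) \<partial>unit3) +
    1/2 * (\<integral>w. h_step k B h (fst w) (snd w) * g w \<partial>unit2) - 1/2 * unit.entropy g"
proof -
  have B: "B i \<in> sets unit_measure" if "i < k" for i
    using interval_partition_facts(1)[OF part] that by simp
  note [measurable] = unit.sym_kernelD(1)[OF g]
  note gb = unit.sym_kernelD(4)[OF g]
  define t where "t i j l = (\<lambda>(x, y, z). indicator (B i) x * indicator (B j) y * indicator (B l) z *
    (g (x, y) * g (x, z) * g (y, z)))" for i j l
  define e where "e i j = (\<lambda>(x, y). indicator (B i) x * indicator (B j) y * g (x, y))" for i j
  have t: "integrable unit3 (t i j l)" if "i < k" "j < k" "l < k" for i j l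
  proof (rule unit.P3.integrable_bounded[where c=1])
    note [measurable] = that[THEN B]
    show "t i j l \<in> borel_measurable unit3" unfolding t_def by measurable
    show "\<bar>t i j l w\<bar> \<le> 1" for w
      unfolding t_def case_prod_unfold by (intro abs_mult_le_one gb; simp add: indicator_def)
  qed
  have e: "integrable unit2 (e i j)" if "i < k" "j < k" for i j
  proof (rule unit.P2.integrable_bounded[where c=1])
    note [measurable] = that[THEN B]
    show "e i j \<in> borel_measurable unit2" unfolding e_def by measurable
    show "\<bar>e i j w\<bar> \<le> 1" for w
      unfolding e_def case_prod_unfold by (intro abs_mult_le_one gb; simp add: indicator_def)
  qed
  have "(\<integral>(x, y, z). \<Delta>_step k B \<alpha> x y z * (g (x, y) * g (x, z) * g (y, z)) \<partial>unit3) =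
      (\<integral>w. (\<Sum>i<k. \<Sum>j<k. \<Sum>l<k. \<alpha> i j l * t i j l w) \<partial>unit3)"
    unfolding \<Delta>_step_def t_def case_prod_unfold
    by (intro Bochner_Integration.integral_cong refl) (simp only: sum_distrib_right mult.assoc)
  also have "\<dots> = (\<Sum>i<k. \<integral>w. (\<Sum>j<k. \<Sum>l<k. \<alpha> i j l * t i j l w) \<partial>unit3)"
    by (intro Bochner_Integration.integral_sum Bochner_Integration.integrable_sum integrable_mult_right t) auto
  also have "\<dots> = (\<Sum>i<k. \<Sum>j<k. \<integral>w. (\<Sum>l<k. \<alpha> i j l * t i j l w) \<partial>unit3)"
    by (intro sum.cong refl Bochner_Integration.integral_sum Bochner_Integration.integrable_sum integrable_mult_right t) auto
  also have "\<dots> = (\<Sum>i<k. \<Sum>j<k. \<Sum>l<k. \<integral>w. \<alpha> i j l * t i j l w \<partial>unit3)"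
    by (intro sum.cong refl Bochner_Integration.integral_sum integrable_mult_right t) auto
  also have "\<dots> = (\<Sum>i<k. \<Sum>j<k. \<Sum>l<k. \<alpha> i j l * unit.triangle (indicator (B i)) (indicator (B j)) (indicator (B l)) g)"
    unfolding unit.triangle_def t_def by (simp only: integral_mult_right_zero)
  finally have 1: "(\<integral>(x, y, z). \<Delta>_step k B \<alpha> x y z * (g (x, y) * g (x, z) * g (y, z)) \<partial>unit3) = \<dots>" .
  have "(\<integral>w. h_step k B h (fst w) (snd w) * g w \<partial>unit2) = (\<integral>w. (\<Sum>i<k. \<Sum>j<k. h i j * e i j w) \<partial>unit2)"
    unfolding h_step_def e_def case_prod_unfold
    by (intro Bochner_Integration.integral_cong refl) (simp only: sum_distrib_right mult.assoc prod.collapse)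
  also have "\<dots> = (\<Sum>i<k. \<integral>w. (\<Sum>j<k. h i j * e i j w) \<partial>unit2)"
    by (intro Bochner_Integration.integral_sum Bochner_Integration.integrable_sum integrable_mult_right e) auto
  also have "\<dots> = (\<Sum>i<k. \<Sum>j<k. \<integral>w. h i j * e i j w \<partial>unit2)"
    by (intro sum.cong refl Bochner_Integration.integral_sum integrable_mult_right e) auto
  also have "\<dots> = (\<Sum>i<k. \<Sum>j<k. h i j * unit.edge (indicator (B i)) (indicator (B j)) g)"
    unfolding unit.edge_def e_def by (simp only: integral_mult_right_zero)
  finally show ?thesis unfolding kernel_value_def 1 by simp
qed

text \<open>The operator evaluates the graphon along two sections, which a null set of the plane
  could in principle fill. By Fubini almost every section agrees with that of \<open>g0\<close>, and
  for almost every pair both coordinates have this property.\<close>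

lemma T_op_AE_eq:
  assumes part: "interval_partition k b B" and rep: "represents g0 g"
  shows "AE w in unit2. T_op k B \<alpha> g (fst w) (snd w) =
    (\<integral>z. \<Delta>_step k B \<alpha> (fst w) (snd w) z * g0 (fst w, z) * g0 (snd w, z) \<partial>unit_measure)"
proof -
  have g0[measurable]: "g0 \<in> borel_measurable (borel \<Otimes>\<^sub>M borel)"
    using unit.sym_kernelD(1)[OF representsD(1)[OF rep]] by (simp add: measurable_unit2_iff borel_prod)
  note [measurable] = step_measurable(3)[OF part]
  have "AE x in unit_measure. AE z in unit_measure. g x z = g0 (x, z)"
    using unit.P2.AE_pair[OF representsD(2)[OF rep]] by simp
  from unit.AE_M2_both[OF this] show ?thesis
  proof eventually_elim
    case (elim w)
    define F where "F z = \<Delta>_step k B \<alpha> (fst w) (snd w) z * g0 (fst w, z) * g0 (snd w, z)" for z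
    have [measurable]: "F \<in> borel_measurable borel" unfolding F_def by measurable
    have ae: "AE z in lborel. z \<in> {0..1} \<longrightarrow> g (fst w) z = g0 (fst w, z) \<and> g (snd w) z = g0 (snd w, z)"
      using elim[THEN conjunct1] elim[THEN conjunct2] unfolding AE_unit by eventually_elim auto
    have "T_op k B \<alpha> g (fst w) (snd w) = (\<integral>z. indicator {0..1} z * F z \<partial>lborel)"
      unfolding T_op_def set_lebesgue_integral_def
    proof (rule integral_completion_cong_AE)
      show "AE z in lborel. indicator {0..1} z *\<^sub>R
          (\<Delta>_step k B \<alpha> (fst w) (snd w) z * g (fst w) z * g (snd w) z) = indicator {0..1} z * F z"
        using ae by eventually_elim (auto simp: F_def indicator_def)
    qed measurable
    also have "\<dots> = (\<integral>z. F z \<partial>unit_measure)" by (rule integral_unit_measure[symmetric]) measurable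
    finally show ?case unfolding F_def .
  qed
qed

text \<open>The representative picked by \<open>class_rep\<close> and the given \<open>g\<close> are
  each compared with the generator \<open>p\<close> of the class, so one-sided approximability
  suffices and the objective becomes independent of the choice.\<close>

lemma reduced_graphon_class:
  assumes part: "interval_partition k b B" and G: "G \<in> reduced_graphons k B" and g: "(g, B) \<in> G"
    and rep: "represents g0 g"
  shows "quotient_energy k B \<alpha> h G - 1/2 * quotient_entropy k B G = kernel_value k B \<alpha> h g0"
proof -
  obtain p where p: "p \<in> graphons" and Gp: "G = cut_equiv k B `` {(p, B)}"
    using G by (auto simp: reduced_graphons_def quotient_def colored_graphons_def)
  have "(SOME q. q \<in> G) \<in> G" using g by (rule someI)
  then obtain q where q: "q \<in> graphons" "class_rep G = q" "cut_metric k B p q = 0"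
    unfolding class_rep_def Gp by (auto simp: cut_equiv_def colored_graphons_def)
  have g': "g \<in> graphons" "cut_metric k B p g = 0"
    using g unfolding Gp by (auto simp: cut_equiv_def colored_graphons_def)
  obtain p0 q0 where p0: "represents p0 p" and q0: "represents q0 q"
    using graphon_represented[OF p] graphon_represented[OF q(1)] by blast
  have "kernel_value k B \<alpha> h q0 = kernel_value k B \<alpha> h p0"
    using cut_metric_zero_approximable[OF part p q(1) p0 q0 q(3)] representsD(1)[OF p0] representsD(1)[OF q0]
    by (intro kernel_value_cut_approximable[OF part, symmetric])
  also have "\<dots> = kernel_value k B \<alpha> h g0"
    using cut_metric_zero_approximable[OF part p g'(1) p0 rep g'(2)] representsD(1)[OF p0] representsD(1)[OF rep]
    by (intro kernel_value_cut_approximable[OF part])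
  finally show ?thesis
    unfolding quotient_energy_def quotient_entropy_def q(2) functional_eq_kernel_value[OF part q0] .
qed

lemma graphon_class:
  assumes part: "interval_partition k b B" and g: "g \<in> graphons"
  shows "cut_equiv k B `` {(g, B)} \<in> reduced_graphons k B" "(g, B) \<in> cut_equiv k B `` {(g, B)}"
proof -
  show "cut_equiv k B `` {(g, B)} \<in> reduced_graphons k B"
    unfolding reduced_graphons_def using g by (intro quotientI) (simp add: colored_graphons_def)
  show "(g, B) \<in> cut_equiv k B `` {(g, B)}"
    using g cut_metric_refl[OF part g] by (simp add: colored_graphons_def cut_equiv_def)
qed

theorem theorem2p13:
  fixes k :: nat and b :: "nat \<Rightarrow> real" and B :: "nat \<Rightarrow> real set"
    and \<alpha> :: "nat \<Rightarrow> nat \<Rightarrow> nat \<Rightarrow> real" and h :: "nat \<Rightarrow> nat \<Rightarrow> real"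
    and G :: "colored_graphon set" and g :: graphon
  assumes "\<And>i. i < k \<Longrightarrow> b i > 0" and "(\<Sum>i<k. b i) = 1"
    and "interval_partition k b B"
    and "symmetric_tensor k \<alpha>"
    and "\<And>i j. i < k \<Longrightarrow> j < k \<Longrightarrow> h i j = h j i"
    and "is_arg_max (\<lambda>G. quotient_energy k B \<alpha> h G - 1/2 * quotient_entropy k B G)
           (\<lambda>G. G \<in> reduced_graphons k B) G"
    and "(g, B) \<in> G"
  shows "(\<exists>\<delta>>0. AE (x, y) in lebesgue_on ({0..1} \<times> {0..1}). \<delta> \<le> g x y \<and> g x y \<le> 1 - \<delta>) \<and>
         (AE (x, y) in lebesgue_on ({0..1} \<times> {0..1}).
            g x y = exp (h_step k B h x y + T_op k B \<alpha> g x y) /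
                    (1 + exp (h_step k B h x y + T_op k B \<alpha> g x y)))"
proof -
  note part = assms(3)
  have G: "G \<in> reduced_graphons k B"
    and max: "\<And>G'. G' \<in> reduced_graphons k B \<Longrightarrow>
      quotient_energy k B \<alpha> h G' - 1/2 * quotient_entropy k B G' \<le>
      quotient_energy k B \<alpha> h G - 1/2 * quotient_entropy k B G"
    using assms(6) by (auto simp: is_arg_max_def not_less)
  have "g \<in> graphons"
    using G assms(7) by (auto simp: reduced_graphons_def quotient_def cut_equiv_def colored_graphons_def)
  then obtain g0 where g0: "represents g0 g" using graphon_represented by blast
  note kg = representsD(1)[OF g0]
  \<comment> \<open>Every Borel kernel generates a class in the quotient that contains it, so
    maximality among classes becomes maximality among all kernels.\<close>
  have kmax: "kernel_value k B \<alpha> h g' \<le> kernel_value k B \<alpha> h g0" if g': "unit.sym_kernel g'" for g'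
    using max[OF graphon_class(1)[OF part sym_kernel_graphon(1)[OF g']]]
      reduced_graphon_class[OF part graphon_class[OF part sym_kernel_graphon(1)[OF g']] sym_kernel_graphon(2)[OF g']]
      reduced_graphon_class[OF part G assms(7) g0]
    by metis
  define \<Delta> where "\<Delta> = (\<lambda>w. \<Delta>_step k B \<alpha> (fst w) (fst (snd w)) (snd (snd w)))"
  define H where "H = (\<lambda>w. h_step k B h (fst w) (snd w))"
  define a where "a = (\<Sum>i<k. \<Sum>j<k. \<Sum>l<k. \<bar>\<alpha> i j l\<bar>)"
  define c where "c = (\<Sum>i<k. \<Sum>j<k. \<bar>h i j\<bar>)"
  define T where "T w = (\<integral>z. \<Delta> (fst w, snd w, z) * g0 (fst w, z) * g0 (snd w, z) \<partial>unit_measure)" for w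
  have \<Delta>b: "\<bar>\<Delta> w\<bar> \<le> a" for w unfolding \<Delta>_def a_def by (rule step_bounds)
  have Hb: "\<bar>H w\<bar> \<le> c" for w unfolding H_def c_def by (rule step_bounds)
  have fixed: "AE w in unit2. g0 w = logistic (H w + T w)"
    unfolding T_def
  proof (rule unit.maximizer_fixed_point[OF _ \<Delta>b _ _ _ Hb _ kg])
    show "\<Delta> \<in> borel_measurable unit3" "H \<in> borel_measurable unit2"
      unfolding \<Delta>_def H_def by (rule step_measurable[OF part])+
    show "\<Delta> (x, y, z) = \<Delta> (y, x, z)" "\<Delta> (x, y, z) = \<Delta> (x, z, y)" "H (x, y) = H (y, x)" for x y z
      unfolding \<Delta>_def H_def fst_conv snd_conv by (intro step_symmetric[OF assms(4,5)]; assumption)+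
    fix g' assume g': "unit.sym_kernel g'"
    show "1/6 * (\<integral>(x, y, z). \<Delta> (x, y, z) * (g' (x, y) * g' (x, z) * g' (y, z)) \<partial>unit3) +
        1/2 * (\<integral>w. H w * g' w \<partial>unit2) - 1/2 * unit.entropy g' \<le>
      1/6 * (\<integral>(x, y, z). \<Delta> (x, y, z) * (g0 (x, y) * g0 (x, z) * g0 (y, z)) \<partial>unit3) +
        1/2 * (\<integral>w. H w * g0 w \<partial>unit2) - 1/2 * unit.entropy g0"
      using kmax[OF g'] unfolding kernel_value_integral[OF part kg] kernel_value_integral[OF part g']
      by (simp add: \<Delta>_def H_def)
  qed
  have Tb: "\<bar>T w\<bar> \<le> a" for w
    unfolding T_def by (intro unit.abs_integral_bounded abs_mult_le \<Delta>b unit.sym_kernelD(4)[OF kg])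
  \<comment> \<open>The exponent lies between \<open>- (a + c)\<close> and \<open>a + c\<close>.
    Monotonicity of \<open>logistic\<close> and its reflection at 0 give the lower and the upper
    bound with the same constant.\<close>
  define \<delta> where "\<delta> = logistic (- (a + c))"
  have delta: "1 - \<delta> = logistic (a + c)"
    unfolding \<delta>_def logistic_uminus by simp
  have bounds: "\<delta> \<le> logistic (H w + T w)" "logistic (H w + T w) \<le> 1 - \<delta>" for w
    unfolding delta unfolding \<delta>_def using Hb[of w] Tb[of w] by (intro logistic_mono; linarith)+
  have "AE w in unit2. \<delta> \<le> g (fst w) (snd w) \<and> g (fst w) (snd w) \<le> 1 - \<delta>"
    using fixed representsD(2)[OF g0] by eventually_elim (use bounds in simp)
  moreover have "AE w in unit2. g (fst w) (snd w) =
      logistic (h_step k B h (fst w) (snd w) + T_op k B \<alpha> g (fst w) (snd w))"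
    using fixed representsD(2)[OF g0] T_op_AE_eq[OF part g0, of \<alpha>]
    by eventually_elim (simp add: H_def T_def \<Delta>_def)
  ultimately show ?thesis
    unfolding AE_lebesgue_on_square case_prod_unfold logistic_def[symmetric]
    using logistic_bounds(1)[of "- (a + c)"] by (auto simp: \<delta>_def intro!: exI[of _ \<delta>])
qed

end
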